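(* In the class of all persistence modules, and in the class of q-tame persistence modules, every Cauchy sequence (with respect to the interleaving distance) has a limit (within the respective class). Furthermore, the space $\mathrm{(cid)}\cap\mathrm{(qtame)}$ with the interleaving distance is complete, and so is $\mathrm{(cfid)}\cap\mathrm{(qtame)}$.
   Context: Fix a field $\mathbf{k}$. A persistence module is a functor $M:(\mathbb{R},\le)\to \mathrm{Vect}_{\mathbf{k}}$; "persistence module" means isomorphism class. For an interval $J\subset\mathbb{R}$, the interval module $J$ is $\mathbf{k}$ at points of $J$ and $0$ elsewhere, with identity maps between points of $J$ and zero maps otherwise. For $\varepsilon\ge 0$, $M,N$ are $\varepsilon$-interleaved if there are families of linear maps $\varphi_a:M(a)\to N(a+\varepsilon)$ and $\psi_a:N(a)\to M(a+\varepsilon)$, natural in $a\in\mathbb{R}$, with $\psi_{a+\varepsilon}\varphi_a=M(a\le a+2\varepsilon)$ and $\varphi_{a+\varepsilon}\psi_a=N(a\le a+2\varepsilon)$ for all $a$. The interleaving distance is $d_I(M,N)=\inf\{\varepsilon\ge0 : M,N \text{ are } \varepsilon\text{-interleaved}\}$ ($\infty$ if there is none). A sequence $(M_n)$ is Cauchy if for all $\varepsilon>0$ there is $K$ with $d_I(M_n,M_m)<\varepsilon$ for all $n,m\ge K$; $M$ is a limit of $(M_n)$ if $d_I(M_n,M)\to0$ (limits need not be unique). A space is complete if every Cauchy sequence in it has a limit in it. $\mathrm{(qtame)}$: persistence modules $M$ with $M(a<b)$ of finite rank for all $a<b$; $\mathrm{(cid)}$: direct sums of countably many interval modules; $\mathrm{(cfid)}$: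 those in $\mathrm{(cid)}$ with all intervals finite (bounded). *)

theory Defs
  imports "HOL-Analysis.Analysis" "Jordan_Normal_Form.VS_Connect"
begin

text \<open>
  The ground field is the type \<open>'k::field\<close>, seen as a ring record through \<open>class_ring\<close>.
  Vector spaces are \<open>module\<close> records whose carriers are arbitrary subsets of a type \<open>'a\<close>, each
  with its own operations; the record fields \<open>mult\<close> and \<open>one\<close> play no role in \<open>vectorspace\<close>.

  The type \<open>'a\<close> acts as a universe of sets. Any sequence of persistence modules can be realised,
  up to isomorphism, over a single such type, and all notions below are invariant under isomorphism.
\<close>

record ('k, 'a) pmod =
  pm_at :: "real \<Rightarrow> ('k, 'a) module"
  pm_map :: "real \<Rightarrow> real \<Rightarrow> 'a \<Rightarrow> 'a"

locale persistence_module =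
  fixes M :: "('k::field, 'a) pmod"
  assumes vectorspace_at: "vectorspace class_ring (pm_at M a)"
    and linear_pm_map:
      "a \<le> b \<Longrightarrow> linear_map class_ring (pm_at M a) (pm_at M b) (pm_map M a b)"
    and pm_map_id: "x \<in> carrier (pm_at M a) \<Longrightarrow> pm_map M a a x = x"
    and pm_map_comp:
      "a \<le> b \<Longrightarrow> b \<le> c \<Longrightarrow> x \<in> carrier (pm_at M a) \<Longrightarrow>
        pm_map M b c (pm_map M a b x) = pm_map M a c x"

subsection \<open>Morphisms, interleavings and the interleaving distance\<close>

definition shifted_hom ::
  "real \<Rightarrow> ('k::field, 'a) pmod \<Rightarrow> ('k, 'b) pmod \<Rightarrow> (real \<Rightarrow> 'a \<Rightarrow> 'b) \<Rightarrow> bool" where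
  "shifted_hom \<epsilon> M N \<phi> \<longleftrightarrow>
     (\<forall>a. linear_map class_ring (pm_at M a) (pm_at N (a + \<epsilon>)) (\<phi> a)) \<and>
     (\<forall>a b. a \<le> b \<longrightarrow> (\<forall>x \<in> carrier (pm_at M a).
        \<phi> b (pm_map M a b x) = pm_map N (a + \<epsilon>) (b + \<epsilon>) (\<phi> a x)))"

definition interleaved ::
  "real \<Rightarrow> ('k::field, 'a) pmod \<Rightarrow> ('k, 'b) pmod \<Rightarrow> bool" where
  "interleaved \<epsilon> M N \<longleftrightarrow>
     (\<exists>\<phi> \<psi>. shifted_hom \<epsilon> M N \<phi> \<and> shifted_hom \<epsilon> N M \<psi> \<and>
       (\<forall>a. \<forall>x \<in> carrier (pm_at M a). \<psi> (a + \<epsilon>) (\<phi> a x) = pm_map M a (a + 2 * \<epsilon>) x) \<and>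
       (\<forall>a. \<forall>y \<in> carrier (pm_at N a). \<phi> (a + \<epsilon>) (\<psi> a y) = pm_map N a (a + 2 * \<epsilon>) y))"

text \<open>In \<open>ereal\<close> the infimum of the empty set is \<open>\<infinity>\<close>.\<close>

definition interleaving_dist ::
  "('k::field, 'a) pmod \<Rightarrow> ('k, 'b) pmod \<Rightarrow> ereal" where
  "interleaving_dist M N = Inf (ereal ` {\<epsilon>. 0 \<le> \<epsilon> \<and> interleaved \<epsilon> M N})"

definition pm_isomorphic ::
  "('k::field, 'a) pmod \<Rightarrow> ('k, 'b) pmod \<Rightarrow> bool" where
  "pm_isomorphic M N \<longleftrightarrow>
     (\<exists>f. (\<forall>a. linear_map class_ring (pm_at M a) (pm_at N a) (f a) \<and>
               bij_betw (f a) (carrier (pm_at M a)) (carrier (pm_at N a))) \<and>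
          (\<forall>a b. a \<le> b \<longrightarrow> (\<forall>x \<in> carrier (pm_at M a).
             f b (pm_map M a b x) = pm_map N a b (f a x))))"

subsection \<open>Interval modules and direct sums\<close>

definition interval_module :: "real set \<Rightarrow> ('k::field, 'k) pmod" where
  "interval_module J =
     \<lparr> pm_at = (\<lambda>a. \<lparr> carrier = (if a \<in> J then UNIV else {0}),
                       mult = (*), one = 1, zero = 0, add = (+), smult = (*) \<rparr>),
       pm_map = (\<lambda>a b x. if a \<in> J \<and> b \<in> J then x else 0) \<rparr>"

definition vs_direct_sum :: "'i set \<Rightarrow> ('i \<Rightarrow> ('k, 'a) module) \<Rightarrow> ('k, 'i \<Rightarrow> 'a) module" where
  "vs_direct_sum I V =
     \<lparr> carrier = {f \<in> (\<Pi>\<^sub>E i\<in>I. carrier (V i)). finite {i \<in> I. f i \<noteq> \<zero>\<^bsub>V i\<^esub>}},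
       mult = (\<lambda>_ _. undefined), one = undefined,
       zero = (\<lambda>i\<in>I. \<zero>\<^bsub>V i\<^esub>),
       add = (\<lambda>f g. \<lambda>i\<in>I. f i \<oplus>\<^bsub>V i\<^esub> g i),
       smult = (\<lambda>c f. \<lambda>i\<in>I. c \<odot>\<^bsub>V i\<^esub> f i) \<rparr>"

definition pm_direct_sum :: "'i set \<Rightarrow> ('i \<Rightarrow> ('k, 'a) pmod) \<Rightarrow> ('k, 'i \<Rightarrow> 'a) pmod" where
  "pm_direct_sum I N =
     \<lparr> pm_at = (\<lambda>a. vs_direct_sum I (\<lambda>i. pm_at (N i) a)),
       pm_map = (\<lambda>a b f. \<lambda>i\<in>I. pm_map (N i) a b (f i)) \<rparr>"

subsection \<open>Classes of persistence modules\<close>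

text \<open>\<open>finite_rank V W f\<close>: the image of the linear map \<open>f\<close> from \<open>V\<close> to \<open>W\<close>, a subspace of \<open>W\<close>,
  is finite-dimensional.\<close>

definition finite_rank ::
  "('k::field, 'a) module \<Rightarrow> ('k, 'b) module \<Rightarrow> ('a \<Rightarrow> 'b) \<Rightarrow> bool" where
  "finite_rank V W f \<longleftrightarrow> vectorspace.fin_dim class_ring (W\<lparr>carrier := f ` carrier V\<rparr>)"

definition qtame :: "('k::field, 'a) pmod \<Rightarrow> bool" where
  "qtame M \<longleftrightarrow> persistence_module M \<and>
     (\<forall>a b. a < b \<longrightarrow> finite_rank (pm_at M a) (pm_at M b) (pm_map M a b))"

text \<open>Countable families of intervals are indexed by subsets of \<open>nat\<close>, so finite families and the
  empty one (giving the zero module) are included, and intervals may be repeated.\<close>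

definition cid :: "('k::field, 'a) pmod \<Rightarrow> bool" where
  "cid M \<longleftrightarrow> persistence_module M \<and>
     (\<exists>(I :: nat set) J. (\<forall>i\<in>I. is_interval (J i) \<and> J i \<noteq> {}) \<and>
        pm_isomorphic M (pm_direct_sum I (\<lambda>i. interval_module (J i))))"

definition cfid :: "('k::field, 'a) pmod \<Rightarrow> bool" where
  "cfid M \<longleftrightarrow> persistence_module M \<and>
     (\<exists>(I :: nat set) J. (\<forall>i\<in>I. is_interval (J i) \<and> J i \<noteq> {} \<and> bounded (J i)) \<and>
        pm_isomorphic M (pm_direct_sum I (\<lambda>i. interval_module (J i))))"

subsection \<open>Completeness\<close>

definition pm_Cauchy :: "(nat \<Rightarrow> ('k::field, 'a) pmod) \<Rightarrow> bool" where
  "pm_Cauchy X \<longleftrightarrow>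
     (\<forall>\<epsilon>::real. \<epsilon> > 0 \<longrightarrow>
        (\<exists>K. \<forall>n\<ge>K. \<forall>m\<ge>K. interleaving_dist (X n) (X m) < ereal \<epsilon>))"

definition pm_limit :: "(nat \<Rightarrow> ('k::field, 'a) pmod) \<Rightarrow> ('k, 'a) pmod \<Rightarrow> bool" where
  "pm_limit X L \<longleftrightarrow> (\<lambda>n. interleaving_dist (X n) L) \<longlonglongrightarrow> 0"

definition pm_complete :: "('k::field, 'a) pmod set \<Rightarrow> bool" where
  "pm_complete C \<longleftrightarrow>
     (\<forall>X. (\<forall>n. X n \<in> C) \<and> pm_Cauchy X \<longrightarrow> (\<exists>L\<in>C. pm_limit X L))"

end

theory Submission
  imports Defs
begin

text \<open>
  A Cauchy sequence has a subsequence \<open>Y k\<close> in which consecutive modules are interleaved with rapidly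
  decreasing degrees \<open>e k\<close>. Its limit \<open>L\<close> is a telescope: \<open>L\<close> at time \<open>a\<close> is the colimit of the spaces \<open>Y k\<close> at
  time \<open>a - \<delta> k\<close>, with interleaving maps as transition maps and shifts \<open>\<delta> k\<close> tending to \<open>0\<close>. The canonical
  maps from \<open>Y k\<close> to \<open>L\<close> and the maps back induced by the other halves of the interleavings form a
  \<open>\<delta> k\<close>-interleaving. The elements of this colimit can be taken from the given type \<open>'a\<close> for reasons of
  cardinality. Maps of \<open>L\<close> factor through maps of the \<open>Y k\<close> of almost the same length, so \<open>L\<close> is q-tame if the
  given modules are.

  For the remaining two classes the limit is decomposed directly. The shifts \<open>\<delta> k\<close> are chosen so
  generously that every element of \<open>L\<close> is the image of an element from an earlier time, and a q-tame
  module \<open>M\<close> with this property is shown to be a direct sum of countably many intervals. The reason is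
  the following. Suppose that the map from \<open>p\<close> to \<open>q\<close> is non-zero. Among the elements that are alive
  from \<open>p\<close> to \<open>q\<close> choose one that is born as early as possible. As all ranks are finite, a
  Mittag-Leffler argument extends it to a family of elements, compatible over its whole lifetime
  (\<open>bar_exists\<close>). This family spans an interval module. Nothing older than the family is mapped into it,
  and this suffices for the interval module to be a direct summand (\<open>bar_splits\<close>). In the complement the
  rank of the map from \<open>p\<close> to \<open>q\<close> is smaller. If this is repeated for all pairs of rationals, each of
  them infinitely often, then for every pair of times the map between them eventually becomes zero on
  the complement (\<open>bar_sequence\<close>). Since every element comes from an earlier time, the summands that
  were split off exhaust \<open>M\<close>.

  A q-tame sum of bounded intervals has two further properties: every element dies, and at each time
  everything older than a certain time is dead. They pass to the limit along an interleaving, and they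
  force the intervals of the limit to be bounded.
\<close>

section \<open>Linear maps, subspaces and finite dimension over a field type\<close>

abbreviation vspace :: "('k::field, 'a) module \<Rightarrow> bool" where
  "vspace V \<equiv> vectorspace class_ring V"

abbreviation linmap :: "('k::field, 'a) module \<Rightarrow> ('k, 'b) module \<Rightarrow> ('a \<Rightarrow> 'b) \<Rightarrow> bool" where
  "linmap V W f \<equiv> linear_map class_ring V W f"

abbreviation subsp :: "'a set \<Rightarrow> ('k::field, 'a) module \<Rightarrow> bool" where
  "subsp U V \<equiv> VectorSpace.subspace class_ring U V"

context
  fixes V :: "('k::field, 'a) module"
  assumes vs: "vspace V"
begin

interpretation V: vectorspace class_ring V by (rule vs)

lemma vs_zero: "\<zero>\<^bsub>V\<^esub> \<in> carrier V" by simp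
lemma vs_add: "x \<in> carrier V \<Longrightarrow> y \<in> carrier V \<Longrightarrow> x \<oplus>\<^bsub>V\<^esub> y \<in> carrier V" by simp
lemma vs_smult: "x \<in> carrier V \<Longrightarrow> c \<odot>\<^bsub>V\<^esub> x \<in> carrier V" by simp
lemma vs_zero_add: "x \<in> carrier V \<Longrightarrow> \<zero>\<^bsub>V\<^esub> \<oplus>\<^bsub>V\<^esub> x = x" by simp
lemma vs_add_zero: "x \<in> carrier V \<Longrightarrow> x \<oplus>\<^bsub>V\<^esub> \<zero>\<^bsub>V\<^esub> = x" by simp
lemma vs_add_comm: "x \<in> carrier V \<Longrightarrow> y \<in> carrier V \<Longrightarrow> x \<oplus>\<^bsub>V\<^esub> y = y \<oplus>\<^bsub>V\<^esub> x"
  by (rule V.a_comm)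
lemma vs_add_assoc: "x \<in> carrier V \<Longrightarrow> y \<in> carrier V \<Longrightarrow> z \<in> carrier V \<Longrightarrow>
    (x \<oplus>\<^bsub>V\<^esub> y) \<oplus>\<^bsub>V\<^esub> z = x \<oplus>\<^bsub>V\<^esub> (y \<oplus>\<^bsub>V\<^esub> z)"
  by (rule V.a_assoc)
lemma vs_add_lcomm: "x \<in> carrier V \<Longrightarrow> y \<in> carrier V \<Longrightarrow> z \<in> carrier V \<Longrightarrow>
    x \<oplus>\<^bsub>V\<^esub> (y \<oplus>\<^bsub>V\<^esub> z) = y \<oplus>\<^bsub>V\<^esub> (x \<oplus>\<^bsub>V\<^esub> z)"
  by (rule V.a_lcomm)
lemma vs_smult_0: "x \<in> carrier V \<Longrightarrow> 0 \<odot>\<^bsub>V\<^esub> x = \<zero>\<^bsub>V\<^esub>"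
  using V.lmult_0 by simp
lemma vs_smult_zero: "c \<odot>\<^bsub>V\<^esub> \<zero>\<^bsub>V\<^esub> = \<zero>\<^bsub>V\<^esub>"
  using V.rmult_0 by simp
lemma vs_smult_1: "x \<in> carrier V \<Longrightarrow> 1 \<odot>\<^bsub>V\<^esub> x = x"
  using V.smult_one by simp
lemma vs_smult_add: "x \<in> carrier V \<Longrightarrow> y \<in> carrier V \<Longrightarrow>
    c \<odot>\<^bsub>V\<^esub> (x \<oplus>\<^bsub>V\<^esub> y) = c \<odot>\<^bsub>V\<^esub> x \<oplus>\<^bsub>V\<^esub> c \<odot>\<^bsub>V\<^esub> y"
  using V.smult_r_distr by simp
lemma vs_add_smult: "x \<in> carrier V \<Longrightarrow> (c + d) \<odot>\<^bsub>V\<^esub> x = c \<odot>\<^bsub>V\<^esub> x \<oplus>\<^bsub>V\<^esub> d \<odot>\<^bsub>V\<^esub> x"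
  using V.smult_l_distr by simp
lemma vs_smult_smult: "x \<in> carrier V \<Longrightarrow> c \<odot>\<^bsub>V\<^esub> (d \<odot>\<^bsub>V\<^esub> x) = (c * d) \<odot>\<^bsub>V\<^esub> x"
  using V.smult_assoc1 by simp
lemma vs_right_neg: "x \<in> carrier V \<Longrightarrow> x \<oplus>\<^bsub>V\<^esub> (- 1) \<odot>\<^bsub>V\<^esub> x = \<zero>\<^bsub>V\<^esub>"
  using vs_add_smult[of x 1 "- 1"] vs_smult_1[of x] vs_smult_0[of x] by simp
lemma vs_left_cancel:
  assumes "x \<in> carrier V" "y \<in> carrier V" "z \<in> carrier V" "x \<oplus>\<^bsub>V\<^esub> y = x \<oplus>\<^bsub>V\<^esub> z"
  shows "y = z"
proof -
  have "w = (- 1) \<odot>\<^bsub>V\<^esub> x \<oplus>\<^bsub>V\<^esub> (x \<oplus>\<^bsub>V\<^esub> w)" if w: "w \<in> carrier V" for w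
  proof -
    have "(- 1) \<odot>\<^bsub>V\<^esub> x \<oplus>\<^bsub>V\<^esub> (x \<oplus>\<^bsub>V\<^esub> w) = (x \<oplus>\<^bsub>V\<^esub> (- 1) \<odot>\<^bsub>V\<^esub> x) \<oplus>\<^bsub>V\<^esub> w"
      by (simp only: vs_add_assoc vs_add_lcomm[of x] assms(1) w vs_smult)
    then show ?thesis by (simp only: vs_right_neg[OF assms(1)] vs_zero_add[OF w])
  qed
  then show ?thesis using assms by metis
qed

lemmas vs_simps = vs_zero vs_add vs_smult vs_zero_add vs_add_zero vs_smult_0 vs_smult_zero
  vs_smult_1 vs_smult_add vs_add_smult vs_smult_smult
lemmas vs_ac = vs_add_assoc vs_add_comm vs_add_lcomm

lemma subsp_iff:
  "subsp U V \<longleftrightarrow> U \<subseteq> carrier V \<and> \<zero>\<^bsub>V\<^esub> \<in> U \<and> (\<forall>x\<in>U. \<forall>y\<in>U. x \<oplus>\<^bsub>V\<^esub> y \<in> U) \<and>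
     (\<forall>c. \<forall>x\<in>U. c \<odot>\<^bsub>V\<^esub> x \<in> U)"
  using vs V.module_axioms by (auto simp: VectorSpace.subspace_def submodule_def)

lemma
  assumes "subsp U V"
  shows subsp_subset: "U \<subseteq> carrier V"
    and subsp_zero: "\<zero>\<^bsub>V\<^esub> \<in> U"
    and subsp_add: "x \<in> U \<Longrightarrow> y \<in> U \<Longrightarrow> x \<oplus>\<^bsub>V\<^esub> y \<in> U"
    and subsp_smult: "x \<in> U \<Longrightarrow> c \<odot>\<^bsub>V\<^esub> x \<in> U"
  using assms unfolding subsp_iff by simp_all

end

lemma linmap_iff:
  assumes "vspace V" "vspace W"
  shows "linmap V W f \<longleftrightarrow> (\<forall>x\<in>carrier V. f x \<in> carrier W) \<and>
    (\<forall>x\<in>carrier V. \<forall>y\<in>carrier V. f (x \<oplus>\<^bsub>V\<^esub> y) = f x \<oplus>\<^bsub>W\<^esub> f y) \<and>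
    (\<forall>c. \<forall>x\<in>carrier V. f (c \<odot>\<^bsub>V\<^esub> x) = c \<odot>\<^bsub>W\<^esub> f x)"
  using assms
  by (auto simp: linear_map_def mod_hom_def mod_hom_axioms_def module_hom_def vectorspace_def Pi_def)

lemma linmap_vspace: "linmap V W f \<Longrightarrow> vspace V" "linmap V W f \<Longrightarrow> vspace W"
  by (auto simp: linear_map_def)

context
  fixes V :: "('k::field, 'a) module" and W :: "('k, 'b) module" and f
  assumes lin: "linmap V W f"
begin

lemma linmap_in: "x \<in> carrier V \<Longrightarrow> f x \<in> carrier W"
  using lin linmap_iff linmap_vspace[OF lin] by blast
lemma linmap_add: "x \<in> carrier V \<Longrightarrow> y \<in> carrier V \<Longrightarrow> f (x \<oplus>\<^bsub>V\<^esub> y) = f x \<oplus>\<^bsub>W\<^esub> f y"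
  using lin linmap_iff linmap_vspace[OF lin] by blast
lemma linmap_smult: "x \<in> carrier V \<Longrightarrow> f (c \<odot>\<^bsub>V\<^esub> x) = c \<odot>\<^bsub>W\<^esub> f x"
  using lin linmap_iff linmap_vspace[OF lin] by blast
lemma linmap_zero: "f \<zero>\<^bsub>V\<^esub> = \<zero>\<^bsub>W\<^esub>"
  using linmap_smult[of "\<zero>\<^bsub>V\<^esub>" 0] linmap_vspace[OF lin] linmap_in[of "\<zero>\<^bsub>V\<^esub>"]
  by (simp add: vs_zero vs_smult_0)

end

lemma linmap_comp: "linmap V W f \<Longrightarrow> linmap W X g \<Longrightarrow> linmap V X (\<lambda>x. g (f x))"
  by (subst linmap_iff) (auto simp: linmap_vspace linmap_in linmap_add linmap_smult)

lemma subsp_image: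
  assumes lin: "linmap V W f" and U: "subsp U V" shows "subsp (f ` U) W"
proof -
  have v: "vspace V" "vspace W" using linmap_vspace[OF lin] by auto
  have UV: "U \<subseteq> carrier V" and 0: "\<zero>\<^bsub>V\<^esub> \<in> U"
    and add: "\<And>x y. x \<in> U \<Longrightarrow> y \<in> U \<Longrightarrow> x \<oplus>\<^bsub>V\<^esub> y \<in> U"
    and smult: "\<And>c x. x \<in> U \<Longrightarrow> c \<odot>\<^bsub>V\<^esub> x \<in> U"
    using U subsp_iff[OF v(1)] by auto
  show ?thesis
    unfolding subsp_iff[OF v(2)]
  proof (intro conjI ballI allI)
    show "f ` U \<subseteq> carrier W" using UV linmap_in[OF lin] by blast
    show "\<zero>\<^bsub>W\<^esub> \<in> f ` U" using 0 linmap_zero[OF lin] by (metis imageI)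
  next
    fix x y assume "x \<in> f ` U" "y \<in> f ` U"
    then obtain a b where ab: "a \<in> U" "b \<in> U" "x = f a" "y = f b" by blast
    then have "x \<oplus>\<^bsub>W\<^esub> y = f (a \<oplus>\<^bsub>V\<^esub> b)" using linmap_add[OF lin, of a b] UV by (metis subsetD)
    then show "x \<oplus>\<^bsub>W\<^esub> y \<in> f ` U" using add[OF ab(1,2)] by simp
  next
    fix c x assume "x \<in> f ` U"
    then obtain a where a: "a \<in> U" "x = f a" by blast
    then have "c \<odot>\<^bsub>W\<^esub> x = f (c \<odot>\<^bsub>V\<^esub> a)" using linmap_smult[OF lin, of a c] UV by auto
    then show "c \<odot>\<^bsub>W\<^esub> x \<in> f ` U" using smult[OF a(1)] by simp
  qed
qed

lemma subsp_carrier: "vspace V \<Longrightarrow> subsp (carrier V) V"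
  by (simp add: subsp_iff vs_zero vs_add vs_smult)

lemma vspace_subsp: "subsp U V \<Longrightarrow> vspace (V\<lparr>carrier := U\<rparr>)"
  using vectorspace.subspace_is_vs VectorSpace.subspace_def by blast

lemma subsp_of_subsp:
  assumes "subsp U V" "subsp X V" "X \<subseteq> U"
  shows "subsp X (V\<lparr>carrier := U\<rparr>)"
  using assms(2,3) subsp_iff[of V X] subsp_iff[OF vspace_subsp[OF assms(1)], of X] assms(1)
  by (auto simp: VectorSpace.subspace_def)

abbreviation fin_dim :: "('k::field, 'a) module \<Rightarrow> bool" where
  "fin_dim V \<equiv> vectorspace.fin_dim class_ring V"

lemma subsp_submodule: "subsp U V \<Longrightarrow> submodule class_ring U V"
  by (simp add: VectorSpace.subspace_def)

lemma vspace_module: "vspace V \<Longrightarrow> Module.module class_ring V"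
  by (simp add: vectorspace_def)

lemma lin_dep_subsp:
  assumes V: "vspace V" and U: "subsp U V" and S: "S \<subseteq> U"
  shows "module.lin_dep class_ring (V\<lparr>carrier := U\<rparr>) S \<longleftrightarrow> module.lin_dep class_ring V S"
  by (rule module.span_li_not_depend(2)[OF vspace_module[OF V] S subsp_submodule[OF U]])

text \<open>Linearly independent subsets of \<open>U\<close> have at most \<open>dim V\<close> elements, so there is a maximal one,
  and it is a basis of \<open>U\<close>.\<close>

lemma fin_dim_subsp:
  assumes V: "vspace V" and fd: "fin_dim V" and U: "subsp U V"
  shows "fin_dim (V\<lparr>carrier := U\<rparr>)"
proof -
  let ?U = "V\<lparr>carrier := U\<rparr>" and ?P = "\<lambda>S. S \<subseteq> U \<and> \<not> module.lin_dep class_ring V S"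
  note vU = vspace_subsp[OF U]
  note UV = subsp_subset[OF V U]
  have "?P {}"
    by (simp add: module.lin_dep_def[OF vspace_module[OF V]])
  moreover have "finite S \<and> card S \<le> vectorspace.dim class_ring V" if "?P S" for S
    using vectorspace.li_le_dim[OF V fd, of S] that UV by blast
  ultimately obtain A where A: "finite A" "maximal A ?P"
    using maximal_exists[of ?P "vectorspace.dim class_ring V" "{}"] by blast
  have "maximal A (\<lambda>S. S \<subseteq> carrier ?U \<and> \<not> module.lin_dep class_ring ?U S)"
    using A(2) lin_dep_subsp[OF V U] unfolding maximal_def by auto
  then have "module.gen_set class_ring ?U A" by (rule vectorspace.max_li_is_gen[OF vU])
  moreover have "A \<subseteq> carrier ?U" using A(2) by (simp add: maximal_def)
  ultimately show ?thesis unfolding vectorspace.fin_dim_def[OF vU] using A(1) by blast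
qed

lemma subsp_dim_eq:
  assumes V: "vspace V" and fd: "fin_dim V" and U: "subsp U V"
    and d: "vectorspace.dim class_ring (V\<lparr>carrier := U\<rparr>) \<ge> vectorspace.dim class_ring V"
  shows "U = carrier V"
proof -
  let ?U = "V\<lparr>carrier := U\<rparr>"
  note vU = vspace_subsp[OF U]
  note UV = subsp_subset[OF V U]
  obtain B where B: "finite B" "vectorspace.basis class_ring ?U B"
    using vectorspace.finite_basis_exists[OF vU fin_dim_subsp[OF V fd U]] by blast
  have BU: "B \<subseteq> U" and li: "\<not> module.lin_dep class_ring ?U B"
    using B(2) by (simp_all add: vectorspace.basis_def[OF vU])
  have "card B \<ge> vectorspace.dim class_ring V"
    using d vectorspace.dim_basis[OF vU B] by simp
  then have "vectorspace.basis class_ring V B"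
    using vectorspace.dim_li_is_basis[OF V fd B(1)] BU UV li lin_dep_subsp[OF V U BU] by blast
  then have "carrier V = module.span class_ring V B" by (simp add: vectorspace.basis_def[OF V])
  also have "\<dots> \<subseteq> U" by (rule module.span_is_subset[OF vspace_module[OF V] BU subsp_submodule[OF U]])
  finally show ?thesis using UV by auto
qed

text \<open>A member of least dimension is least, because a member properly contained in it would have smaller
  dimension. Finite rank enters the decomposition of q-tame modules only through this stabilisation.\<close>

lemma fin_dim_chain_least:
  assumes V: "vspace V" and fd: "fin_dim V" and ne: "\<U> \<noteq> {}"
    and sub: "\<And>U. U \<in> \<U> \<Longrightarrow> subsp U V"
    and chain: "\<And>U U'. U \<in> \<U> \<Longrightarrow> U' \<in> \<U> \<Longrightarrow> U \<subseteq> U' \<or> U' \<subseteq> U"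
  shows "\<exists>U\<in>\<U>. \<forall>U'\<in>\<U>. U \<subseteq> U'"
proof -
  define d where "d U = vectorspace.dim class_ring (V\<lparr>carrier := U\<rparr>)" for U
  obtain U where U: "U \<in> \<U>" "\<And>U'. U' \<in> \<U> \<Longrightarrow> d U \<le> d U'"
    using ne ex_has_least_nat[of "\<lambda>U. U \<in> \<U>" _ d] by blast
  have "U \<subseteq> U'" if U': "U' \<in> \<U>" for U'
  proof (rule ccontr)
    assume n: "\<not> U \<subseteq> U'"
    then have s: "U' \<subseteq> U" using chain U(1) U' by blast
    have "U' = carrier (V\<lparr>carrier := U\<rparr>)"
    proof (rule subsp_dim_eq)
      show "vspace (V\<lparr>carrier := U\<rparr>)" by (rule vspace_subsp[OF sub[OF U(1)]])
      show "fin_dim (V\<lparr>carrier := U\<rparr>)" by (rule fin_dim_subsp[OF V fd sub[OF U(1)]])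
      show "subsp U' (V\<lparr>carrier := U\<rparr>)" by (rule subsp_of_subsp[OF sub[OF U(1)] sub[OF U'] s])
      show "vectorspace.dim class_ring (V\<lparr>carrier := U, carrier := U'\<rparr>)
          \<ge> vectorspace.dim class_ring (V\<lparr>carrier := U\<rparr>)"
        using U(2)[OF U'] by (simp add: d_def)
    qed
    then show False using n by simp
  qed
  then show ?thesis using U(1) by blast
qed

lemma fin_dim_image:
  assumes lin: "linmap V W f" and U: "subsp U V" and fd: "fin_dim (V\<lparr>carrier := U\<rparr>)"
  shows "fin_dim (W\<lparr>carrier := f ` U\<rparr>)"
proof -
  have v: "vspace V" "vspace W" using linmap_vspace[OF lin] by auto
  note UV = subsp_subset[OF v(1) U]
  have "linmap (V\<lparr>carrier := U\<rparr>) (W\<lparr>carrier := f ` U\<rparr>) f"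
    by (subst linmap_iff[OF vspace_subsp[OF U] vspace_subsp[OF subsp_image[OF lin U]]])
      (simp add: linmap_add[OF lin] linmap_smult[OF lin] subsetD[OF UV])
  then have "f ` carrier (V\<lparr>carrier := U\<rparr>) = carrier (W\<lparr>carrier := f ` U\<rparr>) \<Longrightarrow> ?thesis"
    by (rule linear_map.rank_nullity_main(2)[OF _ fd])
  then show ?thesis by simp
qed

section \<open>Splitting a bar off a persistence submodule\<close>

context persistence_module
begin

abbreviation V where "V \<equiv> pm_at M"
abbreviation push where "push \<equiv> pm_map M"

lemma push_in: "a \<le> b \<Longrightarrow> x \<in> carrier (V a) \<Longrightarrow> push a b x \<in> carrier (V b)"
  by (rule linmap_in[OF linear_pm_map])
lemma push_add: "a \<le> b \<Longrightarrow> x \<in> carrier (V a) \<Longrightarrow> y \<in> carrier (V a) \<Longrightarrow>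
    push a b (x \<oplus>\<^bsub>V a\<^esub> y) = push a b x \<oplus>\<^bsub>V b\<^esub> push a b y"
  by (rule linmap_add[OF linear_pm_map])
lemma push_smult: "a \<le> b \<Longrightarrow> x \<in> carrier (V a) \<Longrightarrow>
    push a b (c \<odot>\<^bsub>V a\<^esub> x) = c \<odot>\<^bsub>V b\<^esub> push a b x"
  by (rule linmap_smult[OF linear_pm_map])
lemma push_zero: "a \<le> b \<Longrightarrow> push a b \<zero>\<^bsub>V a\<^esub> = \<zero>\<^bsub>V b\<^esub>"
  by (rule linmap_zero[OF linear_pm_map])

lemmas V_simps = vs_simps[OF vectorspace_at] push_in push_add push_smult push_zero
  pm_map_id pm_map_comp

text \<open>Persistence submodules are given by their carriers alone, so that they are ordered by inclusion and
  unions of chains make sense.\<close>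

definition pm_sub :: "(real \<Rightarrow> 'a set) \<Rightarrow> bool" where
  "pm_sub C \<longleftrightarrow> (\<forall>t. subsp (C t) (V t)) \<and>
    (\<forall>s t x. s \<le> t \<longrightarrow> x \<in> C s \<longrightarrow> push s t x \<in> C t)"

lemma
  assumes "pm_sub C"
  shows pm_sub_subsp: "subsp (C t) (V t)"
    and pm_sub_carrier: "x \<in> C t \<Longrightarrow> x \<in> carrier (V t)"
    and pm_sub_zero: "\<zero>\<^bsub>V t\<^esub> \<in> C t"
    and pm_sub_add: "x \<in> C t \<Longrightarrow> y \<in> C t \<Longrightarrow> x \<oplus>\<^bsub>V t\<^esub> y \<in> C t"
    and pm_sub_smult: "x \<in> C t \<Longrightarrow> c \<odot>\<^bsub>V t\<^esub> x \<in> C t"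
    and pm_sub_push: "s \<le> t \<Longrightarrow> x \<in> C s \<Longrightarrow> push s t x \<in> C t"
proof -
  show 1: "subsp (C t) (V t)" for t using assms by (simp add: pm_sub_def)
  note v = vectorspace_at
  show "x \<in> C t \<Longrightarrow> x \<in> carrier (V t)" by (rule subsetD[OF subsp_subset[OF v 1]])
  show "\<zero>\<^bsub>V t\<^esub> \<in> C t" by (rule subsp_zero[OF v 1])
  show "x \<in> C t \<Longrightarrow> y \<in> C t \<Longrightarrow> x \<oplus>\<^bsub>V t\<^esub> y \<in> C t" by (rule subsp_add[OF v 1])
  show "x \<in> C t \<Longrightarrow> c \<odot>\<^bsub>V t\<^esub> x \<in> C t" by (rule subsp_smult[OF v 1])
  show "s \<le> t \<Longrightarrow> x \<in> C s \<Longrightarrow> push s t x \<in> C t" using assms by (simp add: pm_sub_def)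
qed

lemma pm_subI:
  assumes "\<And>t x. x \<in> C t \<Longrightarrow> x \<in> carrier (V t)" "\<And>t. \<zero>\<^bsub>V t\<^esub> \<in> C t"
    "\<And>t x y. x \<in> C t \<Longrightarrow> y \<in> C t \<Longrightarrow> x \<oplus>\<^bsub>V t\<^esub> y \<in> C t"
    "\<And>t x c. x \<in> C t \<Longrightarrow> c \<odot>\<^bsub>V t\<^esub> x \<in> C t"
    "\<And>s t x. s \<le> t \<Longrightarrow> x \<in> C s \<Longrightarrow> push s t x \<in> C t"
  shows "pm_sub C"
  unfolding pm_sub_def subsp_iff[OF vectorspace_at] using assms by (simp add: subset_iff)

lemma pm_sub_carriers: "pm_sub (\<lambda>t. carrier (V t))"
  by (rule pm_subI) (simp_all add: V_simps)

text \<open>For a submodule \<open>C\<close> this is the submodule generated by \<open>C\<close> and an element \<open>y\<close> at time \<open>t\<close>.\<close>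

definition adjoin :: "(real \<Rightarrow> 'a set) \<Rightarrow> real \<Rightarrow> 'a \<Rightarrow> real \<Rightarrow> 'a set" where
  "adjoin C t y u =
    (if t \<le> u then {c \<oplus>\<^bsub>V u\<^esub> a \<odot>\<^bsub>V u\<^esub> push t u y | c a. c \<in> C u} else C u)"

lemma adjoinE:
  assumes "x \<in> adjoin C t y u" "t \<le> u"
  obtains c a where "c \<in> C u" "x = c \<oplus>\<^bsub>V u\<^esub> a \<odot>\<^bsub>V u\<^esub> push t u y"
  using assms unfolding adjoin_def by (simp only: if_True) blast

lemma adjoinI:
  assumes "x = c \<oplus>\<^bsub>V u\<^esub> a \<odot>\<^bsub>V u\<^esub> push t u y" "c \<in> C u" "t \<le> u"
  shows "x \<in> adjoin C t y u"
  using assms unfolding adjoin_def by (simp only: if_True) blast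

lemma adjoin_before: "\<not> t \<le> u \<Longrightarrow> adjoin C t y u = C u"
  by (simp only: adjoin_def if_False)

lemma adjoin_superset:
  assumes C: "pm_sub C" and y: "y \<in> carrier (V t)"
  shows "C u \<subseteq> adjoin C t y u"
proof
  fix c assume c: "c \<in> C u"
  show "c \<in> adjoin C t y u"
  proof (cases "t \<le> u")
    case True
    then have "c = c \<oplus>\<^bsub>V u\<^esub> 0 \<odot>\<^bsub>V u\<^esub> push t u y"
      using y pm_sub_carrier[OF C c] by (simp add: V_simps)
    then show ?thesis using c True by (rule adjoinI)
  qed (use c in \<open>simp add: adjoin_before\<close>)
qed

lemma pm_sub_adjoin:
  assumes C: "pm_sub C" and y: "y \<in> carrier (V t)"
  shows "pm_sub (adjoin C t y)"
proof (rule pm_subI)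
  note v = vectorspace_at
  have y': "push t u y \<in> carrier (V u)" if "t \<le> u" for u using that y by (rule push_in)
  note [simp] = V_simps y'
  note c = pm_sub_carrier[OF C]
  fix u
  show "x \<in> carrier (V u)" if x: "x \<in> adjoin C t y u" for x
  proof (cases "t \<le> u")
    case True show ?thesis by (rule adjoinE[OF x True]) (simp add: c True)
  qed (use x c in \<open>simp add: adjoin_before\<close>)
  show "\<zero>\<^bsub>V u\<^esub> \<in> adjoin C t y u"
    using pm_sub_zero[OF C] adjoin_superset[OF C y] by blast
  show "x \<oplus>\<^bsub>V u\<^esub> x' \<in> adjoin C t y u" if x: "x \<in> adjoin C t y u" "x' \<in> adjoin C t y u" for x x'
  proof (cases "t \<le> u")
    case True
    obtain d a where 1: "d \<in> C u" "x = d \<oplus>\<^bsub>V u\<^esub> a \<odot>\<^bsub>V u\<^esub> push t u y"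
      using adjoinE[OF x(1) True] .
    obtain d' a' where 2: "d' \<in> C u" "x' = d' \<oplus>\<^bsub>V u\<^esub> a' \<odot>\<^bsub>V u\<^esub> push t u y"
      using adjoinE[OF x(2) True] .
    have "x \<oplus>\<^bsub>V u\<^esub> x' = (d \<oplus>\<^bsub>V u\<^esub> d') \<oplus>\<^bsub>V u\<^esub> (a + a') \<odot>\<^bsub>V u\<^esub> push t u y"
      using True 1 2 by (simp add: c vs_ac[OF v])
    then show ?thesis using pm_sub_add[OF C 1(1) 2(1)] True by (rule adjoinI)
  qed (use x pm_sub_add[OF C] in \<open>simp add: adjoin_before\<close>)
  show "b \<odot>\<^bsub>V u\<^esub> x \<in> adjoin C t y u" if x: "x \<in> adjoin C t y u" for x b
  proof (cases "t \<le> u")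
    case True
    obtain d a where *: "d \<in> C u" "x = d \<oplus>\<^bsub>V u\<^esub> a \<odot>\<^bsub>V u\<^esub> push t u y"
      using adjoinE[OF x True] .
    have "b \<odot>\<^bsub>V u\<^esub> x = b \<odot>\<^bsub>V u\<^esub> d \<oplus>\<^bsub>V u\<^esub> (b * a) \<odot>\<^bsub>V u\<^esub> push t u y"
      using True * by (simp add: c)
    then show ?thesis using pm_sub_smult[OF C *(1)] True by (rule adjoinI)
  qed (use x pm_sub_smult[OF C] in \<open>simp add: adjoin_before\<close>)
  fix w x assume uw: "u \<le> w" and x: "x \<in> adjoin C t y u"
  show "push u w x \<in> adjoin C t y w"
  proof (cases "t \<le> u")
    case True
    obtain d a where *: "d \<in> C u" "x = d \<oplus>\<^bsub>V u\<^esub> a \<odot>\<^bsub>V u\<^esub> push t u y"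
      using adjoinE[OF x True] .
    have "push u w x = push u w d \<oplus>\<^bsub>V w\<^esub> a \<odot>\<^bsub>V w\<^esub> push t w y"
      using True * uw y by (simp add: c)
    then show ?thesis using pm_sub_push[OF C uw *(1)] by (rule adjoinI) (use True uw in simp)
  next
    case False
    then have "push u w x \<in> C w" using x pm_sub_push[OF C uw] by (simp add: adjoin_before)
    then show ?thesis using adjoin_superset[OF C y] by blast
  qed
qed

text \<open>A family of carriers is coded as a set of pairs here; Zorn's lemma for sets ordered by inclusion then
  applies to submodules.\<close>

lemma pm_sub_Union_chain:
  assumes ne: "\<P> \<noteq> {}" and sub: "\<And>P. P \<in> \<P> \<Longrightarrow> pm_sub (\<lambda>t. P `` {t})"
    and ch: "\<And>P Q. P \<in> \<P> \<Longrightarrow> Q \<in> \<P> \<Longrightarrow> P \<subseteq> Q \<or> Q \<subseteq> P"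
  shows "pm_sub (\<lambda>t. (\<Union>\<P>) `` {t})"
proof (rule pm_subI)
  show "x \<in> carrier (V t)" if "x \<in> (\<Union>\<P>) `` {t}" for t x
    using that pm_sub_carrier[OF sub] by auto
  show "\<zero>\<^bsub>V t\<^esub> \<in> (\<Union>\<P>) `` {t}" for t
    using ne pm_sub_zero[OF sub, of _ t] by auto
  show "c \<odot>\<^bsub>V t\<^esub> x \<in> (\<Union>\<P>) `` {t}" if "x \<in> (\<Union>\<P>) `` {t}" for t x c
    using that pm_sub_smult[OF sub, of _ x t c] by auto
  show "push s t x \<in> (\<Union>\<P>) `` {t}" if "s \<le> t" "x \<in> (\<Union>\<P>) `` {s}" for s t x
    using that pm_sub_push[OF sub, of _ s t x] by auto
  fix t x y assume "x \<in> (\<Union>\<P>) `` {t}" "y \<in> (\<Union>\<P>) `` {t}"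
  then obtain P Q where PQ: "P \<in> \<P>" "Q \<in> \<P>" "x \<in> P `` {t}" "y \<in> Q `` {t}" by auto
  then obtain R where R: "R \<in> \<P>" "x \<in> R `` {t}" "y \<in> R `` {t}"
    using ch[OF PQ(1,2)] by (metis Image_mono subset_refl subsetD)
  show "x \<oplus>\<^bsub>V t\<^esub> y \<in> (\<Union>\<P>) `` {t}"
    using R(1) pm_sub_add[OF sub[OF R(1)] R(2,3)] by auto
qed

text \<open>A bar in \<open>A\<close> is a compatible family of elements that starts from nothing: no element of \<open>A\<close>
  living at a time before the birth of the bar is mapped into the bar. Its non-zero members span a copy
  of an interval module, and the condition at the birth is what makes this copy a direct summand.\<close>

definition bar_in :: "(real \<Rightarrow> 'a set) \<Rightarrow> (real \<Rightarrow> 'a) \<Rightarrow> bool" where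
  "bar_in A x \<longleftrightarrow> (\<forall>t. x t \<in> A t) \<and>
    (\<forall>s t. s \<le> t \<longrightarrow> x s \<noteq> \<zero>\<^bsub>V s\<^esub> \<longrightarrow> push s t (x s) = x t) \<and>
    (\<forall>s t. \<forall>y\<in>A s. s \<le> t \<longrightarrow> x s = \<zero>\<^bsub>V s\<^esub> \<longrightarrow> x t \<noteq> \<zero>\<^bsub>V t\<^esub> \<longrightarrow> push s t y \<noteq> x t)"

text \<open>\<open>A\<close> is the direct sum of the bar \<open>x\<close> and the submodule \<open>C\<close>.\<close>

definition splits :: "(real \<Rightarrow> 'a set) \<Rightarrow> (real \<Rightarrow> 'a) \<Rightarrow> (real \<Rightarrow> 'a set) \<Rightarrow> bool" where
  "splits A x C \<longleftrightarrow> pm_sub C \<and> (\<forall>t. C t \<subseteq> A t) \<and> (\<forall>t. x t \<noteq> \<zero>\<^bsub>V t\<^esub> \<longrightarrow> x t \<notin> C t) \<and>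
    (\<forall>t. \<forall>y\<in>A t. \<exists>a. \<exists>c\<in>C t. y = a \<odot>\<^bsub>V t\<^esub> x t \<oplus>\<^bsub>V t\<^esub> c)"

text \<open>A complement is a submodule that is maximal among those which contain everything coming from times
  where \<open>x\<close> vanishes and which avoid \<open>x\<close> elsewhere. Suppose such a maximal \<open>C\<close> misses some \<open>y\<close> at time \<open>t\<close>.
  Adjoining \<open>y\<close> to \<open>C\<close> must produce some non-zero \<open>x u\<close> with \<open>t \<le> u\<close>, so a suitable combination \<open>y'\<close> of
  \<open>y\<close> and \<open>x t\<close> lies in \<open>C\<close> at time \<open>u\<close>. If \<open>y'\<close> were outside \<open>C\<close> at time \<open>t\<close>, adjoining it would
  produce another member of the bar, and pushing to the later of the two times would put the bar into \<open>C\<close>.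
  Working with finitely many times at once avoids the choice of a functional on the colimit over the whole
  lifetime of the bar.\<close>

lemma bar_splits:
  assumes A: "pm_sub A" and x: "bar_in A x"
  shows "\<exists>C. splits A x C"
proof -
  note v = vectorspace_at
  have xA: "x t \<in> A t" and xpush: "s \<le> t \<Longrightarrow> x s \<noteq> \<zero>\<^bsub>V s\<^esub> \<Longrightarrow> push s t (x s) = x t"
    and xiso: "y \<in> A s \<Longrightarrow> s \<le> t \<Longrightarrow> x s = \<zero>\<^bsub>V s\<^esub> \<Longrightarrow> x t \<noteq> \<zero>\<^bsub>V t\<^esub> \<Longrightarrow> push s t y \<noteq> x t" for s t y
    using x unfolding bar_in_def by auto
  have xV [simp]: "x t \<in> carrier (V t)" for t using pm_sub_carrier[OF A xA] .
  note cA = pm_sub_carrier[OF A]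
  \<comment> \<open>the submodule generated by everything that lives where the bar is zero\<close>
  define C0 where "C0 t = {push s t y | s y. s \<le> t \<and> y \<in> A s \<and> (x s = \<zero>\<^bsub>V s\<^esub> \<or> y = \<zero>\<^bsub>V s\<^esub>)}" for t
  have C0I: "push s t y \<in> C0 t" if "s \<le> t" "y \<in> A s" "x s = \<zero>\<^bsub>V s\<^esub> \<or> y = \<zero>\<^bsub>V s\<^esub>" for s t y
    using that unfolding C0_def by blast
  have C0E: "y = \<zero>\<^bsub>V t\<^esub> \<or> (\<exists>s z. s \<le> t \<and> z \<in> A s \<and> x s = \<zero>\<^bsub>V s\<^esub> \<and> y = push s t z)"
    if "y \<in> C0 t" for y t
    using that push_zero unfolding C0_def by blast
  have C0z: "\<zero>\<^bsub>V t\<^esub> \<in> C0 t" for t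
    using C0I[of t t "\<zero>\<^bsub>V t\<^esub>"] pm_sub_zero[OF A] by (simp add: V_simps)
  have C0A: "y \<in> A t" if "y \<in> C0 t" for y t
    using C0E[OF that] pm_sub_zero[OF A] pm_sub_push[OF A] by auto
  have C0: "pm_sub C0"
  proof (rule pm_subI)
    show "y \<in> carrier (V t)" if "y \<in> C0 t" for y t using cA[OF C0A[OF that]] .
    show "\<zero>\<^bsub>V t\<^esub> \<in> C0 t" for t by (rule C0z)
    show "push s t y \<in> C0 t" if st: "s \<le> t" and y: "y \<in> C0 s" for s t y
      using C0E[OF y]
    proof (elim disjE exE conjE)
      fix r z assume "r \<le> s" "z \<in> A r" "x r = \<zero>\<^bsub>V r\<^esub>" "y = push r s z"
      then show ?thesis using C0I[of r t z] st by (simp add: pm_map_comp cA)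
    qed (use st C0z in \<open>simp add: push_zero\<close>)
    show "c \<odot>\<^bsub>V t\<^esub> y \<in> C0 t" if y: "y \<in> C0 t" for t y c
      using C0E[OF y]
    proof (elim disjE exE conjE)
      fix r z assume "r \<le> t" "z \<in> A r" "x r = \<zero>\<^bsub>V r\<^esub>" "y = push r t z"
      then show ?thesis using C0I[of r t "c \<odot>\<^bsub>V r\<^esub> z"] pm_sub_smult[OF A]
        by (simp add: push_smult cA)
    qed (use C0z in \<open>simp add: vs_simps[OF v]\<close>)
    have aux: "push r t z \<oplus>\<^bsub>V t\<^esub> push r' t z' \<in> C0 t"
      if "r \<le> r'" "r' \<le> t" "z \<in> A r" "x r = \<zero>\<^bsub>V r\<^esub>" "z' \<in> A r'" "x r' = \<zero>\<^bsub>V r'\<^esub>" for r r' t z z'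
    proof -
      have "push r t z \<oplus>\<^bsub>V t\<^esub> push r' t z' = push r' t (push r r' z \<oplus>\<^bsub>V r'\<^esub> z')"
        using that by (simp add: push_add cA push_in pm_map_comp)
      then show ?thesis
        using that C0I[of r' t] pm_sub_add[OF A] pm_sub_push[OF A] by simp
    qed
    show "y \<oplus>\<^bsub>V t\<^esub> y' \<in> C0 t" if y: "y \<in> C0 t" "y' \<in> C0 t" for t y y'
    proof -
      have c: "y \<in> carrier (V t)" "y' \<in> carrier (V t)" using cA[OF C0A] y by auto
      show ?thesis
        using C0E[OF y(1)]
      proof (elim disjE exE conjE)
        fix r z assume r: "r \<le> t" "z \<in> A r" "x r = \<zero>\<^bsub>V r\<^esub>" "y = push r t z"
        show ?thesis using C0E[OF y(2)]
        proof (elim disjE exE conjE)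
          fix r' z' assume r': "r' \<le> t" "z' \<in> A r'" "x r' = \<zero>\<^bsub>V r'\<^esub>" "y' = push r' t z'"
          show ?thesis
          proof (cases "r \<le> r'")
            case True then show ?thesis using aux[of r r' t z z'] r r' by simp
          next
            case False then show ?thesis using aux[of r' r t z' z] r r' vs_add_comm[OF v c] by simp
          qed
        qed (use y c in \<open>simp add: vs_simps[OF v]\<close>)
      qed (use y c in \<open>simp add: vs_simps[OF v]\<close>)
    qed
  qed
  have C0x: "x t \<notin> C0 t" if nz: "x t \<noteq> \<zero>\<^bsub>V t\<^esub>" for t
  proof
    assume "x t \<in> C0 t"
    then obtain s z where "s \<le> t" "z \<in> A s" "x s = \<zero>\<^bsub>V s\<^esub>" "x t = push s t z"
      using C0E[of "x t" t] nz by blast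
    then show False using xiso nz by metis
  qed
  define \<A> where "\<A> = {P. pm_sub (\<lambda>t. P `` {t}) \<and> Sigma UNIV C0 \<subseteq> P \<and> P \<subseteq> Sigma UNIV A \<and>
      (\<forall>t. x t \<noteq> \<zero>\<^bsub>V t\<^esub> \<longrightarrow> (t, x t) \<notin> P)}"
  have "Sigma UNIV C0 \<in> \<A>"
    unfolding \<A>_def using C0 C0x C0A by (auto simp: Sigma_Image)
  moreover have "\<Union>\<P> \<in> \<A>" if "\<P> \<noteq> {}" "subset.chain \<A> \<P>" for \<P>
  proof -
    have sub: "\<P> \<subseteq> \<A>" and ch: "\<And>P Q. P \<in> \<P> \<Longrightarrow> Q \<in> \<P> \<Longrightarrow> P \<subseteq> Q \<or> Q \<subseteq> P"
      using that(2) unfolding subset_chain_def by auto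
    have "pm_sub (\<lambda>t. (\<Union>\<P>) `` {t})"
      by (rule pm_sub_Union_chain[OF that(1)]) (use sub ch in \<open>auto simp: \<A>_def\<close>)
    moreover have "Sigma UNIV C0 \<subseteq> \<Union>\<P>" using that(1) sub unfolding \<A>_def by blast
    ultimately show ?thesis using sub unfolding \<A>_def by blast
  qed
  ultimately obtain P where P: "P \<in> \<A>" and Pmax: "\<And>Q. Q \<in> \<A> \<Longrightarrow> P \<subseteq> Q \<Longrightarrow> Q = P"
    using subset_Zorn_nonempty[of \<A>] by blast
  define C where "C t = P `` {t}" for t
  have C: "pm_sub C" and C0C: "\<And>t. C0 t \<subseteq> C t" and CA: "\<And>t. C t \<subseteq> A t"
    and Cx: "\<And>t. x t \<noteq> \<zero>\<^bsub>V t\<^esub> \<Longrightarrow> x t \<notin> C t"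
    using P unfolding \<A>_def C_def by auto
  note cC = pm_sub_carrier[OF C]
  have adj: "\<exists>u\<ge>t. x u \<noteq> \<zero>\<^bsub>V u\<^esub> \<and> (\<exists>c\<in>C u. \<exists>a. x u = c \<oplus>\<^bsub>V u\<^esub> a \<odot>\<^bsub>V u\<^esub> push t u y)"
    if y: "y \<in> A t" "y \<notin> C t" for t y
  proof (rule ccontr)
    assume neg: "\<not> ?thesis"
    define D where "D = adjoin C t y"
    have D: "pm_sub D" unfolding D_def by (rule pm_sub_adjoin[OF C cA[OF y(1)]])
    have py: "push t u y \<in> A u" if "t \<le> u" for u using pm_sub_push[OF A that y(1)] .
    have CD: "C u \<subseteq> D u" for u unfolding D_def by (rule adjoin_superset[OF C cA[OF y(1)]])
    have DA: "z \<in> A u" if z: "z \<in> D u" for u z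
    proof (cases "t \<le> u")
      case True
      show ?thesis
        by (rule adjoinE[OF z[unfolded D_def] True])
          (use pm_sub_add[OF A subsetD[OF CA] pm_sub_smult[OF A py[OF True]]] in simp)
    qed (use z CA in \<open>auto simp: D_def adjoin_before\<close>)
    have Dx: "x u \<notin> D u" if xu: "x u \<noteq> \<zero>\<^bsub>V u\<^esub>" for u
    proof
      assume D: "x u \<in> D u"
      show False
      proof (cases "t \<le> u")
        case True
        show ?thesis by (rule adjoinE[OF D[unfolded D_def] True]) (use neg xu True in blast)
      qed (use D Cx[OF xu] in \<open>simp add: D_def adjoin_before\<close>)
    qed
    have "Sigma UNIV D \<in> \<A>"
      unfolding \<A>_def using D Dx CD C0C DA by (fastforce simp: Sigma_Image)
    moreover have "P \<subseteq> Sigma UNIV D" using CD unfolding C_def by auto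
    ultimately have "Sigma UNIV D = P" by (rule Pmax)
    then have "D t = C t" unfolding C_def by auto
    moreover have "y \<in> D t"
      unfolding D_def
      by (rule adjoinI[where c = "\<zero>\<^bsub>V t\<^esub>" and a = 1]) (use pm_sub_zero[OF C] cA[OF y(1)] in \<open>simp_all add: V_simps\<close>)
    ultimately show False using y(2) by simp
  qed
  have main: "\<exists>a. \<exists>c\<in>C t. y = a \<odot>\<^bsub>V t\<^esub> x t \<oplus>\<^bsub>V t\<^esub> c" if y: "y \<in> A t" for t y
  proof (cases "y \<in> C t")
    case True
    then have "y = 0 \<odot>\<^bsub>V t\<^esub> x t \<oplus>\<^bsub>V t\<^esub> y" by (simp add: vs_simps[OF v] cC)
    then show ?thesis using True by blast
  next
    case False
    have xt: "x t \<noteq> \<zero>\<^bsub>V t\<^esub>"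
    proof
      assume "x t = \<zero>\<^bsub>V t\<^esub>"
      then have "push t t y \<in> C0 t" using C0I[of t t y] y by simp
      then show False using False C0C by (auto simp: V_simps cA[OF y])
    qed
    note yV = cA[OF y]
    obtain u c a where u: "t \<le> u" "x u \<noteq> \<zero>\<^bsub>V u\<^esub>" "c \<in> C u"
      "x u = c \<oplus>\<^bsub>V u\<^esub> a \<odot>\<^bsub>V u\<^esub> push t u y"
      using adj[OF y False] by blast
    have pu: "push t u y \<in> carrier (V u)" using push_in[OF u(1) yV] .
    have a: "a \<noteq> 0"
    proof
      assume "a = 0"
      then have "x u = c" using u(4) pu cC[OF u(3)] by (simp add: vs_simps[OF v])
      then show False using Cx[OF u(2)] u(3) by simp
    qed
    \<comment> \<open>solving the relation at time \<open>u\<close> for the component of \<open>y\<close> along the bar\<close>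
    define b where "b = inverse a"
    define y' where "y' = y \<oplus>\<^bsub>V t\<^esub> (- b) \<odot>\<^bsub>V t\<^esub> x t"
    have y'A: "y' \<in> A t" unfolding y'_def using y xA pm_sub_add[OF A] pm_sub_smult[OF A] by simp
    have yy': "y = b \<odot>\<^bsub>V t\<^esub> x t \<oplus>\<^bsub>V t\<^esub> y'"
    proof -
      have "b \<odot>\<^bsub>V t\<^esub> x t \<oplus>\<^bsub>V t\<^esub> y' = y \<oplus>\<^bsub>V t\<^esub> (b \<odot>\<^bsub>V t\<^esub> x t \<oplus>\<^bsub>V t\<^esub> (- b) \<odot>\<^bsub>V t\<^esub> x t)"
        unfolding y'_def using yV by (simp add: vs_add[OF v] vs_smult[OF v] vs_add_lcomm[OF v])
      also have "\<dots> = y" using yV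
        by (simp add: vs_add_smult[OF v, symmetric] vs_smult_0[OF v] vs_add_zero[OF v])
      finally show ?thesis by simp
    qed
    have y'u: "push t u y' \<in> C u"
    proof -
      have "push t u y' = push t u y \<oplus>\<^bsub>V u\<^esub> (- b) \<odot>\<^bsub>V u\<^esub> x u"
        unfolding y'_def using u(1) yV xpush[OF u(1) xt]
        by (simp add: push_add push_smult vs_smult[OF v])
      also have "\<dots> = push t u y \<oplus>\<^bsub>V u\<^esub> ((- b) \<odot>\<^bsub>V u\<^esub> c \<oplus>\<^bsub>V u\<^esub> (- b * a) \<odot>\<^bsub>V u\<^esub> push t u y)"
        unfolding u(4) using pu cC[OF u(3)]
        by (simp add: vs_smult_add[OF v] vs_smult_smult[OF v] vs_smult[OF v])
      also have "\<dots> = (- b) \<odot>\<^bsub>V u\<^esub> c \<oplus>\<^bsub>V u\<^esub> (push t u y \<oplus>\<^bsub>V u\<^esub> (- 1) \<odot>\<^bsub>V u\<^esub> push t u y)"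
        using pu cC[OF u(3)] a by (simp add: b_def vs_smult[OF v] vs_add_lcomm[OF v])
      also have "\<dots> = (- b) \<odot>\<^bsub>V u\<^esub> c"
        using pu cC[OF u(3)] by (simp only: vs_right_neg[OF v] vs_add_zero[OF v] vs_smult[OF v])
      finally show ?thesis using pm_sub_smult[OF C u(3)] by simp
    qed
    have "y' \<in> C t"
    proof (rule ccontr)
      assume "y' \<notin> C t"
      then obtain w d e where w: "t \<le> w" "x w \<noteq> \<zero>\<^bsub>V w\<^esub>" "d \<in> C w"
        "x w = d \<oplus>\<^bsub>V w\<^esub> e \<odot>\<^bsub>V w\<^esub> push t w y'"
        using adj[OF y'A] by blast
      have y'V: "y' \<in> carrier (V t)" using cA[OF y'A] .
      have in_max: "x z \<in> C z" if "w \<le> z" "u \<le> z" for z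
      proof -
        have "x z = push w z d \<oplus>\<^bsub>V z\<^esub> e \<odot>\<^bsub>V z\<^esub> push u z (push t u y')"
          using xpush[OF that(1) w(2)] that u(1) w(1) y'V cC[OF w(3)] unfolding w(4)
          by (simp add: V_simps)
        then show ?thesis
          using pm_sub_add[OF C] pm_sub_smult[OF C] pm_sub_push[OF C] w(3) y'u that by simp
      qed
      show False
      proof (cases "w \<le> u")
        case True then show ?thesis using in_max[of u] Cx[OF u(2)] by simp
      next
        case False then show ?thesis using in_max[of w] Cx[OF w(2)] by simp
      qed
    qed
    then show ?thesis using yy' by blast
  qed
  show ?thesis
    unfolding splits_def using C CA Cx main by blast
qed

end

section \<open>Bars in a q-tame module in which every element has a past\<close>

context persistence_module
begin

text \<open>Every element has a past. For a direct sum of intervals this says that no interval has a least element.\<close>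

definition left_generated :: "(real \<Rightarrow> 'a set) \<Rightarrow> bool" where
  "left_generated A \<longleftrightarrow> (\<forall>t. \<forall>y\<in>A t. \<exists>s<t. \<exists>z\<in>A s. push s t z = y)"

text \<open>Two different coefficients would exhibit \<open>x t\<close> as a multiple of an element of the complement.\<close>

lemma splits_unique:
  assumes sp: "splits A x C" and xV: "x t \<in> carrier (V t)" and c: "c \<in> C t" "d \<in> C t"
    and eq: "a \<odot>\<^bsub>V t\<^esub> x t \<oplus>\<^bsub>V t\<^esub> c = b \<odot>\<^bsub>V t\<^esub> x t \<oplus>\<^bsub>V t\<^esub> d"
  shows "c = d" and "x t \<noteq> \<zero>\<^bsub>V t\<^esub> \<Longrightarrow> a = b"
proof -
  note v = vectorspace_at
  have C: "pm_sub C" and xC: "x t \<noteq> \<zero>\<^bsub>V t\<^esub> \<Longrightarrow> x t \<notin> C t" using sp by (auto simp: splits_def)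
  note cV = pm_sub_carrier[OF C]
  have cc: "c \<in> carrier (V t)" "d \<in> carrier (V t)" using c cV by auto
  note [simp] = vs_simps[OF v] xV cc
  have ab: "a = b" if nz: "x t \<noteq> \<zero>\<^bsub>V t\<^esub>"
  proof (rule ccontr)
    assume ne: "a \<noteq> b"
    have "(a - b) \<odot>\<^bsub>V t\<^esub> x t = (- b) \<odot>\<^bsub>V t\<^esub> x t \<oplus>\<^bsub>V t\<^esub> a \<odot>\<^bsub>V t\<^esub> x t"
      using vs_add_smult[OF v xV, of "- b" a] by simp
    also have "\<dots> = (- b) \<odot>\<^bsub>V t\<^esub> x t \<oplus>\<^bsub>V t\<^esub> (a \<odot>\<^bsub>V t\<^esub> x t \<oplus>\<^bsub>V t\<^esub> (c \<oplus>\<^bsub>V t\<^esub> (- 1) \<odot>\<^bsub>V t\<^esub> c))"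
      by (simp only: vs_right_neg[OF v cc(1)] vs_add_zero[OF v vs_smult[OF v xV]])
    also have "\<dots> = (- b) \<odot>\<^bsub>V t\<^esub> x t \<oplus>\<^bsub>V t\<^esub> ((a \<odot>\<^bsub>V t\<^esub> x t \<oplus>\<^bsub>V t\<^esub> c) \<oplus>\<^bsub>V t\<^esub> (- 1) \<odot>\<^bsub>V t\<^esub> c)"
      by (simp add: vs_add_assoc[OF v])
    also have "\<dots> = ((- b) \<odot>\<^bsub>V t\<^esub> x t \<oplus>\<^bsub>V t\<^esub> b \<odot>\<^bsub>V t\<^esub> x t) \<oplus>\<^bsub>V t\<^esub> (d \<oplus>\<^bsub>V t\<^esub> (- 1) \<odot>\<^bsub>V t\<^esub> c)"
      unfolding eq by (simp add: vs_add_assoc[OF v])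
    also have "\<dots> = d \<oplus>\<^bsub>V t\<^esub> (- 1) \<odot>\<^bsub>V t\<^esub> c"
      by (simp add: vs_add_smult[OF v xV, symmetric])
    finally have "(a - b) \<odot>\<^bsub>V t\<^esub> x t \<in> C t"
      using pm_sub_add[OF C c(2) pm_sub_smult[OF C c(1)]] by simp
    then have "inverse (a - b) \<odot>\<^bsub>V t\<^esub> ((a - b) \<odot>\<^bsub>V t\<^esub> x t) \<in> C t" by (rule pm_sub_smult[OF C])
    then have "x t \<in> C t" using ne by simp
    then show False using xC[OF nz] by simp
  qed
  then show "x t \<noteq> \<zero>\<^bsub>V t\<^esub> \<Longrightarrow> a = b" .
  have "a \<odot>\<^bsub>V t\<^esub> x t = b \<odot>\<^bsub>V t\<^esub> x t" using ab by (cases "x t = \<zero>\<^bsub>V t\<^esub>") auto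
  then show "c = d" using eq vs_left_cancel[OF v _ cc, of "b \<odot>\<^bsub>V t\<^esub> x t"] by simp
qed

text \<open>An element of the complement has a preimage at an earlier time in \<open>A\<close>; by uniqueness of components
  the complement part of this preimage is already a preimage.\<close>

lemma left_generated_splits:
  assumes A: "pm_sub A" and rad: "left_generated A" and x: "bar_in A x" and sp: "splits A x C"
  shows "left_generated C"
  unfolding left_generated_def
proof (intro allI ballI)
  fix t y assume y: "y \<in> C t"
  note v = vectorspace_at
  have C: "pm_sub C" and CA: "C t \<subseteq> A t" using sp by (auto simp: splits_def)
  have xV: "x t \<in> carrier (V t)" for t using x pm_sub_carrier[OF A] by (auto simp: bar_in_def)
  obtain s z where s: "s < t" "z \<in> A s" "push s t z = y"
    using rad y CA unfolding left_generated_def by blast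
  obtain a c where c: "c \<in> C s" "z = a \<odot>\<^bsub>V s\<^esub> x s \<oplus>\<^bsub>V s\<^esub> c"
    using sp s(2) unfolding splits_def by blast
  have cV: "c \<in> carrier (V s)" using pm_sub_carrier[OF C c(1)] .
  define b where "b = (if x s = \<zero>\<^bsub>V s\<^esub> then 0 else a)"
  have "a \<odot>\<^bsub>V t\<^esub> push s t (x s) = b \<odot>\<^bsub>V t\<^esub> x t"
  proof (cases "x s = \<zero>\<^bsub>V s\<^esub>")
    case True
    then show ?thesis using s(1) xV by (simp add: b_def V_simps)
  next
    case False
    then show ?thesis using s(1) x by (simp add: b_def bar_in_def)
  qed
  then have "y = b \<odot>\<^bsub>V t\<^esub> x t \<oplus>\<^bsub>V t\<^esub> push s t c"
    using s c(2) cV xV by (simp add: push_add push_smult vs_smult[OF v])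
  then have "0 \<odot>\<^bsub>V t\<^esub> x t \<oplus>\<^bsub>V t\<^esub> y = b \<odot>\<^bsub>V t\<^esub> x t \<oplus>\<^bsub>V t\<^esub> push s t c"
    using pm_sub_carrier[OF C y] xV by (simp add: vs_simps[OF v])
  then have "y = push s t c"
    using splits_unique(1)[where x = x, OF sp xV y pm_sub_push[OF C _ c(1)]] s(1) by simp
  then show "\<exists>s<t. \<exists>z\<in>C s. push s t z = y" using s(1) c(1) by blast
qed

end

lemma coinitial_sequence:
  fixes B :: "real set"
  assumes ne: "p \<in> B" and no_least: "\<And>s. s \<in> B \<Longrightarrow> \<exists>r\<in>B. r < s"
  obtains T where "\<And>n::nat. T n \<in> B" "\<And>m n. m \<le> n \<Longrightarrow> T n \<le> T m" "\<And>s. s \<in> B \<Longrightarrow> \<exists>n. T n \<le> s"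
proof -
  have "\<exists>S. (\<forall>n::nat. S n \<in> B) \<and> (\<forall>s\<in>B. \<exists>n. S n \<le> s)"
  proof (cases "bdd_below B")
    case False
    then have "\<exists>s\<in>B. s < - real n" for n unfolding bdd_below_def by (meson not_le)
    then obtain S where S: "\<And>n. S n \<in> B" "\<And>n. S n < - real n" by metis
    have "\<exists>n. S n \<le> s" for s
    proof -
      obtain n where "- s < real n" using reals_Archimedean2 by blast
      then show ?thesis using S(2)[of n] by (intro exI[of _ n]) linarith
    qed
    then show ?thesis using S(1) by blast
  next
    case True
    have "\<exists>s\<in>B. s < Inf B + inverse (real (Suc n))" for n
      using cInf_less_iff[OF _ True, of "Inf B + inverse (real (Suc n))"] ne by auto
    then obtain S where S: "\<And>n. S n \<in> B" "\<And>n. S n < Inf B + inverse (real (Suc n))" by metis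
    have "\<exists>n. S n \<le> s" if s: "s \<in> B" for s
    proof -
      obtain r where "r \<in> B" "r < s" using no_least[OF s] by blast
      then have "Inf B < s" using cInf_lower[OF _ True, of r] by linarith
      then obtain n where "inverse (real (Suc n)) < s - Inf B" using reals_Archimedean[of "s - Inf B"] by auto
      then show ?thesis using S(2)[of n] by (intro exI[of _ n]) linarith
    qed
    then show ?thesis using S(1) by blast
  qed
  then obtain S where S: "\<And>n::nat. S n \<in> B" "\<And>s. s \<in> B \<Longrightarrow> \<exists>n. S n \<le> s" by blast
  define T where "T n = Min (S ` {..n})" for n
  have "T n \<in> S ` {..n}" for n unfolding T_def by (rule Min_in) auto
  then have "T n \<in> B" for n using S(1) by (metis imageE)
  moreover have "T n \<le> T m" if "m \<le> n" for m n
    unfolding T_def using that by (intro Min_antimono) auto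
  moreover have "T n \<le> S n" for n unfolding T_def by auto
  ultimately show ?thesis using S(2) that[of T] by (meson order_trans)
qed

locale q_tame_module = persistence_module M for M :: "('k::field, 'a) pmod" +
  assumes finite_rank: "a < b \<Longrightarrow> finite_rank (pm_at M a) (pm_at M b) (pm_map M a b)"
begin

text \<open>All these images lie in the image of the map from \<open>a\<close> to \<open>b\<close>, which has finite rank. The lemma is used
  for one submodule at varying times and for varying submodules at one time, hence the index set.\<close>

lemma least_image:
  assumes I: "I \<noteq> {}" and ab: "a < b" and A: "\<And>i. i \<in> I \<Longrightarrow> pm_sub (A i)"
    and r: "\<And>i. i \<in> I \<Longrightarrow> r i \<le> a"
    and chain: "\<And>i j. i \<in> I \<Longrightarrow> j \<in> I \<Longrightarrow>
      push (r i) b ` A i (r i) \<subseteq> push (r j) b ` A j (r j) \<or>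
      push (r j) b ` A j (r j) \<subseteq> push (r i) b ` A i (r i)"
  shows "\<exists>i\<in>I. \<forall>j\<in>I. push (r i) b ` A i (r i) \<subseteq> push (r j) b ` A j (r j)"
proof -
  let ?im = "push a b ` carrier (V a)"
  have im: "subsp ?im (V b)"
    using ab by (intro subsp_image[OF linear_pm_map subsp_carrier[OF vectorspace_at]]) simp
  have "\<exists>U\<in>(\<lambda>i. push (r i) b ` A i (r i)) ` I. \<forall>U'\<in>(\<lambda>i. push (r i) b ` A i (r i)) ` I. U \<subseteq> U'"
  proof (rule fin_dim_chain_least[OF vspace_subsp[OF im]])
    show "fin_dim (V b\<lparr>carrier := ?im\<rparr>)"
      using finite_rank[OF ab] by (simp add: finite_rank_def)
    show "(\<lambda>i. push (r i) b ` A i (r i)) ` I \<noteq> {}" using I by simp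
    fix U assume "U \<in> (\<lambda>i. push (r i) b ` A i (r i)) ` I"
    then obtain i where i: "i \<in> I" and U: "U = push (r i) b ` A i (r i)" by blast
    have "subsp U (V b)"
      unfolding U using ab r[OF i]
      by (intro subsp_image[OF linear_pm_map pm_sub_subsp[OF A[OF i]]]) simp
    moreover have "U \<subseteq> ?im"
    proof
      fix u assume "u \<in> U"
      then obtain z where z: "z \<in> A i (r i)" "u = push (r i) b z" unfolding U by blast
      then have zV: "z \<in> carrier (V (r i))" using pm_sub_carrier[OF A[OF i]] by simp
      then have "u = push a b (push (r i) a z)" using z ab r[OF i] by (simp add: pm_map_comp)
      then show "u \<in> ?im" using push_in[OF r[OF i] zV] by simp
    qed
    ultimately show "subsp U (V b\<lparr>carrier := ?im\<rparr>)" by (rule subsp_of_subsp[OF im])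
  next
    fix U U' assume "U \<in> (\<lambda>i. push (r i) b ` A i (r i)) ` I" "U' \<in> (\<lambda>i. push (r i) b ` A i (r i)) ` I"
    then show "U \<subseteq> U' \<or> U' \<subseteq> U" using chain by (elim imageE) simp
  qed
  then show ?thesis by auto
qed

text \<open>Let \<open>B\<close> be the set of times \<open>s \<le> p\<close> from which something non-zero reaches \<open>q\<close>. An element that is
  non-zero at \<open>q\<close> and has preimages at all times in \<open>B\<close> is born as early as anything alive on \<open>[p, q]\<close>, so
  nothing older can be mapped onto it. To extend it to a compatible family along \<open>B\<close>, note that for each
  \<open>t \<in> B\<close> the images of the earlier times of \<open>B\<close> in time \<open>t\<close> stabilise because the ranks are finite, and that
  the stable images map onto each other (Mittag-Leffler). Since \<open>A\<close> is left generated, \<open>B\<close> has no least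
  element, so a sequence of times decreasing along \<open>B\<close> is all that has to be considered.\<close>

lemma bar_exists:
  assumes A: "pm_sub A" and rad: "left_generated A" and pq: "p < q"
    and nz: "\<exists>y\<in>A p. push p q y \<noteq> \<zero>\<^bsub>V q\<^esub>"
  shows "\<exists>x. bar_in A x \<and> is_interval {t. x t \<noteq> \<zero>\<^bsub>V t\<^esub>} \<and> x p \<noteq> \<zero>\<^bsub>V p\<^esub> \<and> x q \<noteq> \<zero>\<^bsub>V q\<^esub>"
proof -
  note AV = pm_sub_carrier[OF A]
  have comp: "push b c (push a b y) = push a c y" if "a \<le> b" "b \<le> c" "y \<in> A a" for a b c y
    using that by (simp add: pm_map_comp AV)
  define B where "B = {s. s \<le> p \<and> (\<exists>z\<in>A s. push s q z \<noteq> \<zero>\<^bsub>V q\<^esub>)}"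
  have pB: "p \<in> B" using nz by (simp add: B_def)
  have no_least: "\<exists>r\<in>B. r < s" if s: "s \<in> B" for s
  proof -
    obtain z where z: "z \<in> A s" "push s q z \<noteq> \<zero>\<^bsub>V q\<^esub>" and sp: "s \<le> p" using s by (auto simp: B_def)
    obtain r w where r: "r < s" "w \<in> A r" "push r s w = z" using rad z(1) unfolding left_generated_def by blast
    have "push r q w \<noteq> \<zero>\<^bsub>V q\<^esub>" using comp[of r s q w] r z(2) sp pq by simp
    then show ?thesis using r(1,2) sp unfolding B_def by (intro bexI[of _ r]) auto
  qed
  have stable: "\<exists>r\<in>B. r < t \<and> (\<forall>s\<in>B. s \<le> t \<longrightarrow> push r t ` A r \<subseteq> push s t ` A s)" if t: "t \<in> B" for t
  proof -
    obtain s0 where s0: "s0 \<in> B" "s0 < t" using no_least[OF t] by blast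
    have mono: "push r t ` A r \<subseteq> push s t ` A s" if "r \<le> s" "s \<le> t" for r s
    proof
      fix u assume "u \<in> push r t ` A r"
      then obtain z where "z \<in> A r" "u = push r t z" by blast
      then have "u = push s t (push r s z)" "push r s z \<in> A s"
        using that comp pm_sub_push[OF A] by auto
      then show "u \<in> push s t ` A s" by blast
    qed
    have "\<exists>r\<in>{s\<in>B. s \<le> s0}. \<forall>s\<in>{s\<in>B. s \<le> s0}. push r t ` A r \<subseteq> push s t ` A s"
    proof (rule least_image[where r = "\<lambda>s. s" and A = "\<lambda>_. A"])
      show "s0 < t" by (rule s0(2))
      show "{s \<in> B. s \<le> s0} \<noteq> {}" using s0(1) by auto
      show "pm_sub A" by (rule A)
      fix i j assume ij: "i \<in> {s \<in> B. s \<le> s0}" "j \<in> {s \<in> B. s \<le> s0}"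
      show "i \<le> s0" using ij by simp
      show "push i t ` A i \<subseteq> push j t ` A j \<or> push j t ` A j \<subseteq> push i t ` A i"
        using ij s0(2) mono[of i j] mono[of j i] by (cases "i \<le> j") auto
    qed
    then obtain r where r: "r \<in> B" "r \<le> s0" "\<And>s. s \<in> B \<Longrightarrow> s \<le> s0 \<Longrightarrow> push r t ` A r \<subseteq> push s t ` A s"
      by auto
    have "push r t ` A r \<subseteq> push s t ` A s" if "s \<in> B" "s \<le> t" for s
      using that r(3)[of s] mono[of r s] r(2) by (cases "s \<le> s0") auto
    then show ?thesis using r(1,2) s0(2) by (intro bexI[of _ r]) auto
  qed
  \<comment> \<open>\<open>\<rho> t\<close> is an earlier time whose image in \<open>t\<close> is already the stable one\<close>
  then obtain \<rho> where \<rho>: "\<And>t. t \<in> B \<Longrightarrow> \<rho> t \<in> B" "\<And>t. t \<in> B \<Longrightarrow> \<rho> t < t"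
    "\<And>t s. t \<in> B \<Longrightarrow> s \<in> B \<Longrightarrow> s \<le> t \<Longrightarrow> push (\<rho> t) t ` A (\<rho> t) \<subseteq> push s t ` A s"
    by metis
  obtain T where T: "\<And>n::nat. T n \<in> B" "\<And>m n. m \<le> n \<Longrightarrow> T n \<le> T m" "\<And>s. s \<in> B \<Longrightarrow> \<exists>n. T n \<le> s"
    using coinitial_sequence[OF pB no_least] by metis
  have Tp: "T n \<le> p" for n using T(1)[of n] by (simp add: B_def)
  define S where "S n = push (\<rho> (T n)) (T n) ` A (\<rho> (T n))" for n
  have SA: "y \<in> A (T n)" if "y \<in> S n" for y n
    using that pm_sub_push[OF A] \<rho>(2)[OF T(1)[of n]] unfolding S_def by auto
  obtain z where z: "z \<in> A (\<rho> (T 0))" "push (\<rho> (T 0)) q z \<noteq> \<zero>\<^bsub>V q\<^esub>"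
    using \<rho>(1)[OF T(1)[of 0]] by (auto simp: B_def)
  have lift: "\<exists>y'\<in>S (Suc n). push (T (Suc n)) (T n) y' = y" if y: "y \<in> S n" for n y
  proof -
    let ?s = "\<rho> (T (Suc n))"
    have le: "?s \<le> T (Suc n)" "T (Suc n) \<le> T n" using \<rho>(2)[OF T(1)[of "Suc n"]] T(2)[of n "Suc n"] by auto
    obtain w where w: "w \<in> A ?s" "y = push ?s (T n) w"
      using \<rho>(3)[OF T(1)[of n] \<rho>(1)[OF T(1)[of "Suc n"]]] y le unfolding S_def by auto
    then show ?thesis using le comp unfolding S_def by (intro bexI[of _ "push ?s (T (Suc n)) w"]) auto
  qed
  have "\<exists>Y. \<forall>n. (Y n \<in> S n \<and> (n = 0 \<longrightarrow> push (T 0) q (Y n) \<noteq> \<zero>\<^bsub>V q\<^esub>)) \<and> push (T (Suc n)) (T n) (Y (Suc n)) = Y n"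
  proof (rule dependent_nat_choice)
    let ?y = "push (\<rho> (T 0)) (T 0) z"
    have "push (T 0) q ?y \<noteq> \<zero>\<^bsub>V q\<^esub>"
      using z comp[of "\<rho> (T 0)" "T 0" q z] \<rho>(2)[OF T(1)[of 0]] Tp[of 0] pq by simp
    then show "\<exists>y. y \<in> S 0 \<and> (0 = (0::nat) \<longrightarrow> push (T 0) q y \<noteq> \<zero>\<^bsub>V q\<^esub>)"
      using z(1) unfolding S_def by blast
  next
    fix y n assume "y \<in> S n \<and> (n = 0 \<longrightarrow> push (T 0) q y \<noteq> \<zero>\<^bsub>V q\<^esub>)"
    then show "\<exists>y'. (y' \<in> S (Suc n) \<and> (Suc n = 0 \<longrightarrow> push (T 0) q y' \<noteq> \<zero>\<^bsub>V q\<^esub>)) \<and> push (T (Suc n)) (T n) y' = y"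
      using lift[of y n] by auto
  qed
  then obtain Y where Y: "\<And>n. Y n \<in> S n" "push (T 0) q (Y 0) \<noteq> \<zero>\<^bsub>V q\<^esub>"
    "\<And>n. push (T (Suc n)) (T n) (Y (Suc n)) = Y n" by metis
  have YA: "Y n \<in> A (T n)" for n using SA[OF Y(1)] .
  have YY: "push (T (n + k)) (T n) (Y (n + k)) = Y n" for n k
  proof (induction k)
    case 0 then show ?case using pm_map_id[OF AV[OF YA]] by simp
  next
    case (Suc k)
    have "push (T (n + Suc k)) (T n) (Y (n + Suc k)) =
        push (T (n + k)) (T n) (push (T (n + Suc k)) (T (n + k)) (Y (n + Suc k)))"
      by (rule comp[symmetric]) (use T(2) YA in auto)
    then show ?case using Y(3)[of "n + k"] Suc by simp
  qed
  define x where "x t = (if \<exists>n. T n \<le> t then push (T (LEAST n. T n \<le> t)) t (Y (LEAST n. T n \<le> t))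
      else \<zero>\<^bsub>V t\<^esub>)" for t
  have x: "x t = push (T n) t (Y n)" if n: "T n \<le> t" for t n
  proof -
    define k where "k = (LEAST n. T n \<le> t)"
    have k: "k \<le> n" "T k \<le> t" unfolding k_def using n by (auto intro: Least_le LeastI)
    have "x t = push (T k) t (Y k)" unfolding x_def k_def using n by auto
    also have "Y k = push (T n) (T k) (Y n)" using YY[of k "n - k"] k(1) by simp
    also have "push (T k) t \<dots> = push (T n) t (Y n)" by (rule comp) (use T(2) k YA in auto)
    finally show ?thesis .
  qed
  have x_early: "x t = \<zero>\<^bsub>V t\<^esub>" if "\<not> (\<exists>n. T n \<le> t)" for t using that by (simp add: x_def)
  have xA: "x t \<in> A t" for t
    using x[of _ t] x_early[of t] pm_sub_push[OF A _ YA] pm_sub_zero[OF A] by metis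
  have xpush: "push s t (x s) = x t" if "s \<le> t" "T n \<le> s" for s t n
    using x[OF that(2)] x[of n t] that comp[of "T n" s t "Y n"] YA by simp
  have xq: "x q \<noteq> \<zero>\<^bsub>V q\<^esub>" using x[of 0 q] Tp[of 0] pq Y(2) by simp
  have xp: "x p \<noteq> \<zero>\<^bsub>V p\<^esub>" using xpush[of p q 0] Tp[of 0] pq xq push_zero[of p q] by auto
  have "bar_in A x"
    unfolding bar_in_def
  proof (intro conjI allI ballI impI)
    show "x t \<in> A t" for t by (rule xA)
    show "push s t (x s) = x t" if "s \<le> t" "x s \<noteq> \<zero>\<^bsub>V s\<^esub>" for s t
      using that x_early xpush by blast
    fix s t y assume *: "y \<in> A s" "s \<le> t" "x s = \<zero>\<^bsub>V s\<^esub>" "x t \<noteq> \<zero>\<^bsub>V t\<^esub>"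
    show "push s t y \<noteq> x t"
    proof
      assume eq: "push s t y = x t"
      have s: "\<not> (\<exists>n. T n \<le> s)" using xpush[of s t] * push_zero[of s t] by auto
      then have "s \<notin> B" "s < p" using T(3) Tp[of 0] by (meson, meson not_le order_trans)
      then have 0: "push s q y = \<zero>\<^bsub>V q\<^esub>" using *(1) by (auto simp: B_def)
      obtain n where n: "T n \<le> t" using x_early[of t] *(4) by blast
      show False
      proof (cases "t \<le> q")
        case True
        then have "x q = push t q (push s t y)" using xpush[OF True n] eq by simp
        then show False using 0 comp[of s t q y] * True xq by simp
      next
        case False
        then have "x t = push q t (push s q y)" using eq comp[of s q t y] * \<open>s < p\<close> pq by simp
        then show False using 0 push_zero[of q t] False *(4) by simp
      qed
    qed
  qed
  moreover have "is_interval {t. x t \<noteq> \<zero>\<^bsub>V t\<^esub>}"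
    unfolding is_interval_1
  proof (intro ballI allI impI)
    fix a c b assume "a \<in> {t. x t \<noteq> \<zero>\<^bsub>V t\<^esub>}" "c \<in> {t. x t \<noteq> \<zero>\<^bsub>V t\<^esub>}" and abc: "a \<le> b \<and> b \<le> c"
    then obtain n where "T n \<le> a" and c: "x c \<noteq> \<zero>\<^bsub>V c\<^esub>" using x_early by blast
    then have "push b c (x b) = x c" using xpush[of b c n] abc by simp
    then show "b \<in> {t. x t \<noteq> \<zero>\<^bsub>V t\<^esub>}" using c push_zero[of b c] abc by auto
  qed
  ultimately show ?thesis using xp xq by blast
qed

end

section \<open>Splitting off bars one after the other\<close>

context q_tame_module
begin

text \<open>When the map from \<open>p\<close> to \<open>q\<close> vanishes on \<open>A\<close>, the zero bar is split off; thus the step is possible for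
  every pair \<open>p\<close>, \<open>q\<close>.\<close>

lemma bar_step:
  assumes A: "pm_sub A" and rad: "left_generated A"
  shows "\<exists>x C. bar_in A x \<and> is_interval {t. x t \<noteq> \<zero>\<^bsub>V t\<^esub>} \<and> splits A x C \<and> left_generated C \<and>
    (p < q \<and> (\<exists>y\<in>A p. push p q y \<noteq> \<zero>\<^bsub>V q\<^esub>) \<longrightarrow> x p \<noteq> \<zero>\<^bsub>V p\<^esub> \<and> x q \<noteq> \<zero>\<^bsub>V q\<^esub>)"
proof (cases "p < q \<and> (\<exists>y\<in>A p. push p q y \<noteq> \<zero>\<^bsub>V q\<^esub>)")
  case True
  then have pq: "p < q" and nz: "\<exists>y\<in>A p. push p q y \<noteq> \<zero>\<^bsub>V q\<^esub>" by (rule conjunct1, rule conjunct2)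
  obtain x where x: "bar_in A x" "is_interval {t. x t \<noteq> \<zero>\<^bsub>V t\<^esub>}" "x p \<noteq> \<zero>\<^bsub>V p\<^esub>" "x q \<noteq> \<zero>\<^bsub>V q\<^esub>"
    using bar_exists[OF A rad pq nz] by (elim exE conjE) (rule that)
  obtain C where C: "splits A x C" using bar_splits[OF A x(1)] by (elim exE) (rule that)
  show ?thesis
    by (rule exI[of _ x], rule exI[of _ C]) (use x C left_generated_splits[OF A rad x(1) C] in simp)
next
  case False
  have "bar_in A (\<lambda>t. \<zero>\<^bsub>V t\<^esub>)" using pm_sub_zero[OF A] by (simp add: bar_in_def)
  moreover have "splits A (\<lambda>t. \<zero>\<^bsub>V t\<^esub>) A"
    unfolding splits_def
  proof (intro conjI allI impI ballI)
    fix t y assume y: "y \<in> A t"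
    then have "y = 0 \<odot>\<^bsub>V t\<^esub> \<zero>\<^bsub>V t\<^esub> \<oplus>\<^bsub>V t\<^esub> y" using pm_sub_carrier[OF A] by (simp add: V_simps)
    then show "\<exists>a. \<exists>c\<in>A t. y = a \<odot>\<^bsub>V t\<^esub> \<zero>\<^bsub>V t\<^esub> \<oplus>\<^bsub>V t\<^esub> c" using y by blast
  qed (use A in auto)
  moreover have "is_interval {t. \<zero>\<^bsub>V t\<^esub> \<noteq> \<zero>\<^bsub>V t\<^esub>}" by simp
  ultimately show ?thesis using False rad by (intro exI[of _ "\<lambda>t. \<zero>\<^bsub>V t\<^esub>"] exI[of _ A] conjI impI) (assumption | simp only: simp_thms)+
qed

text \<open>Every pair of rationals is treated infinitely often. For a fixed pair the images of the successive
  complements form a decreasing sequence of finite-dimensional spaces, which becomes constant. A bar that is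
  split off for this pair after that moment would contribute a vector lost in the next complement, so from
  then on the map is zero on the complements. Any \<open>p < q\<close> have a pair of rationals between them.\<close>

lemma bar_sequence:
  assumes rad: "left_generated (\<lambda>t. carrier (V t))"
  obtains C :: "nat \<Rightarrow> real \<Rightarrow> 'a set" and x :: "nat \<Rightarrow> real \<Rightarrow> 'a"
  where "C 0 = (\<lambda>t. carrier (V t))" "\<And>n. pm_sub (C n)" "\<And>n. bar_in (C n) (x n)"
    "\<And>n. splits (C n) (x n) (C (Suc n))" "\<And>n. is_interval {t. x n t \<noteq> \<zero>\<^bsub>V t\<^esub>}"
    "\<And>p q. p < q \<Longrightarrow> \<exists>N. \<forall>n\<ge>N. \<forall>y\<in>C n p. push p q y = \<zero>\<^bsub>V q\<^esub>"
proof -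
  define e where "e n = (from_nat (fst (prod_decode n)) :: rat \<times> rat)" for n
  define p where "p n = (of_rat (fst (e n)) :: real)" for n
  define q where "q n = (of_rat (snd (e n)) :: real)" for n
  define R where "R n A x C \<longleftrightarrow> bar_in A x \<and> is_interval {t. x t \<noteq> \<zero>\<^bsub>V t\<^esub>} \<and> splits A x C \<and> left_generated C \<and>
    (p n < q n \<and> (\<exists>y\<in>A (p n). push (p n) (q n) y \<noteq> \<zero>\<^bsub>V (q n)\<^esub>) \<longrightarrow>
      x (p n) \<noteq> \<zero>\<^bsub>V (p n)\<^esub> \<and> x (q n) \<noteq> \<zero>\<^bsub>V (q n)\<^esub>)" for n A x C
  have "\<exists>C. \<forall>n. (pm_sub (C n) \<and> left_generated (C n) \<and> (n = 0 \<longrightarrow> C n = (\<lambda>t. carrier (V t)))) \<and>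
      (\<exists>x. R n (C n) x (C (Suc n)))"
  proof (rule dependent_nat_choice)
    show "\<exists>A. pm_sub A \<and> left_generated A \<and> (0 = (0::nat) \<longrightarrow> A = (\<lambda>t. carrier (V t)))"
      using rad pm_sub_carriers by blast
  next
    fix A and n :: nat assume "pm_sub A \<and> left_generated A \<and> (n = 0 \<longrightarrow> A = (\<lambda>t. carrier (V t)))"
    then obtain x C where "R n A x C" using bar_step[of A "p n" "q n"] unfolding R_def by blast
    moreover from this have "pm_sub C \<and> left_generated C" by (simp add: R_def splits_def)
    ultimately show "\<exists>C. (pm_sub C \<and> left_generated C \<and> (Suc n = 0 \<longrightarrow> C = (\<lambda>t. carrier (V t)))) \<and> (\<exists>x. R n A x C)"
      by blast
  qed
  then obtain C x where C: "C 0 = (\<lambda>t. carrier (V t))" "\<And>n. pm_sub (C n)" "\<And>n. R n (C n) (x n) (C (Suc n))"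
    by metis
  have bar: "bar_in (C n) (x n)" and sp: "splits (C n) (x n) (C (Suc n))"
    and int: "is_interval {t. x n t \<noteq> \<zero>\<^bsub>V t\<^esub>}"
    and hit: "p n < q n \<Longrightarrow> y \<in> C n (p n) \<Longrightarrow> push (p n) (q n) y \<noteq> \<zero>\<^bsub>V (q n)\<^esub> \<Longrightarrow>
      x n (p n) \<noteq> \<zero>\<^bsub>V (p n)\<^esub> \<and> x n (q n) \<noteq> \<zero>\<^bsub>V (q n)\<^esub>" for n y
    using C(3)[of n] unfolding R_def by blast+
  have decr: "C n t \<subseteq> C m t" if "m \<le> n" for m n t
    using that
  proof (induction rule: dec_induct)
    case (step n)
    have "C (Suc n) t \<subseteq> C n t" using sp[of n] by (simp add: splits_def)
    then show ?case using step.IH by (rule subset_trans)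
  qed simp
  have dies: "\<exists>N. \<forall>n\<ge>N. \<forall>y\<in>C n a. push a b y = \<zero>\<^bsub>V b\<^esub>" if ab: "a < b" for a b
  proof -
    obtain a' b' :: rat where ab': "a < of_rat a'" "of_rat a' < (of_rat b' :: real)" "of_rat b' < b"
      using ab by (metis of_rat_dense)
    let ?a = "of_rat a' :: real" and ?b = "of_rat b' :: real"
    define U where "U n = push ?a ?b ` C n ?a" for n
    have Udecr: "U n \<subseteq> U m" if "m \<le> n" for m n using decr[OF that] unfolding U_def by blast
    have "\<exists>N\<in>UNIV. \<forall>n\<in>UNIV. U N \<subseteq> U n"
      unfolding U_def
    proof (rule least_image[where r = "\<lambda>_. ?a" and a = ?a])
      show "pm_sub (C i)" for i by (rule C(2))
      show "push ?a ?b ` C i ?a \<subseteq> push ?a ?b ` C j ?a \<or> push ?a ?b ` C j ?a \<subseteq> push ?a ?b ` C i ?a" for i j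
        using Udecr[of i j] Udecr[of j i] unfolding U_def by (cases "i \<le> j") auto
    qed (use ab' in auto)
    then obtain N where N: "\<And>n. U N \<subseteq> U n" by blast
    \<comment> \<open>a step at which this pair is treated and the images are already constant\<close>
    define n where "n = prod_encode (to_nat (a', b'), N)"
    have n: "N \<le> n" "p n = ?a" "q n = ?b"
      using le_prod_encode_2 by (simp_all add: n_def p_def q_def e_def)
    have zero: "push ?a ?b y = \<zero>\<^bsub>V ?b\<^esub>" if y: "y \<in> C n ?a" for y
    proof (rule ccontr)
      assume "push ?a ?b y \<noteq> \<zero>\<^bsub>V ?b\<^esub>"
      then have nz: "x n ?a \<noteq> \<zero>\<^bsub>V ?a\<^esub>" "x n ?b \<noteq> \<zero>\<^bsub>V ?b\<^esub>" using hit[of n y] y n ab'(2) by auto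
      have "x n ?b = push ?a ?b (x n ?a)" "x n ?a \<in> C n ?a"
        using bar[of n] nz(1) ab'(2) by (auto simp: bar_in_def)
      then have "x n ?b \<in> U n" unfolding U_def by blast
      then have "x n ?b \<in> U (Suc n)" using Udecr[OF n(1)] N by blast
      then have "x n ?b \<in> C (Suc n) ?b"
        using pm_sub_push[OF C(2)] ab'(2) unfolding U_def by auto
      then show False using sp[of n] nz(2) by (auto simp: splits_def)
    qed
    have "push a b y = \<zero>\<^bsub>V b\<^esub>" if "m \<ge> n" "y \<in> C m a" for m y
    proof -
      have yV: "y \<in> carrier (V a)" using pm_sub_carrier[OF C(2) that(2)] .
      have "push a ?a y \<in> C n ?a" using pm_sub_push[OF C(2), of a ?a y n] that decr[OF that(1)] ab' by auto
      then have "push ?b b (push ?a ?b (push a ?a y)) = \<zero>\<^bsub>V b\<^esub>"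
        using zero push_zero[of ?b b] ab' by simp
      then show ?thesis using ab' yV by (simp add: pm_map_comp push_in)
    qed
    then show ?thesis by blast
  qed
  show ?thesis using that[of C x] C bar sp int dies by blast
qed

end

lemma vspace_direct_sum:
  fixes W :: "'i \<Rightarrow> ('k::field, 'b) module"
  assumes W: "\<And>i. i \<in> I \<Longrightarrow> vspace (W i)"
  shows "vspace (vs_direct_sum I W)"
proof (rule vs_criteria)
  note v = vs_simps[OF W]
  let ?S = "vs_direct_sum I W"
  show "field (class_ring :: 'k ring)" by unfold_locales
  have mem: "f \<in> carrier ?S \<longleftrightarrow> f \<in> (\<Pi>\<^sub>E i\<in>I. carrier (W i)) \<and> finite {i \<in> I. f i \<noteq> \<zero>\<^bsub>W i\<^esub>}" for f
    by (simp add: vs_direct_sum_def)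
  have ext: "f = g" if "f \<in> (\<Pi>\<^sub>E i\<in>I. carrier (W i))" "g \<in> (\<Pi>\<^sub>E i\<in>I. carrier (W i))" "\<And>i. i \<in> I \<Longrightarrow> f i = g i" for f g
    using that by (metis PiE_ext)
  have add: "f \<oplus>\<^bsub>?S\<^esub> g = (\<lambda>i\<in>I. f i \<oplus>\<^bsub>W i\<^esub> g i)" for f g by (simp add: vs_direct_sum_def)
  have smult: "c \<odot>\<^bsub>?S\<^esub> f = (\<lambda>i\<in>I. c \<odot>\<^bsub>W i\<^esub> f i)" for c f by (simp add: vs_direct_sum_def)
  have zero: "\<zero>\<^bsub>?S\<^esub> = (\<lambda>i\<in>I. \<zero>\<^bsub>W i\<^esub>)" by (simp add: vs_direct_sum_def)
  have z: "\<zero>\<^bsub>?S\<^esub> \<in> carrier ?S" unfolding mem zero by (auto simp: v)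
  have a: "f \<oplus>\<^bsub>?S\<^esub> g \<in> carrier ?S" if "f \<in> carrier ?S" "g \<in> carrier ?S" for f g
  proof -
    have "finite ({i \<in> I. f i \<noteq> \<zero>\<^bsub>W i\<^esub>} \<union> {i \<in> I. g i \<noteq> \<zero>\<^bsub>W i\<^esub>})" using that by (simp add: mem)
    then have "finite {i \<in> I. (f \<oplus>\<^bsub>?S\<^esub> g) i \<noteq> \<zero>\<^bsub>W i\<^esub>}"
      by (rule rev_finite_subset) (auto simp: add v)
    moreover have "f \<oplus>\<^bsub>?S\<^esub> g \<in> (\<Pi>\<^sub>E i\<in>I. carrier (W i))" using that unfolding add mem by (auto simp: v PiE_iff)
    ultimately show ?thesis by (simp add: mem)
  qed
  have s: "c \<odot>\<^bsub>?S\<^esub> f \<in> carrier ?S" if "f \<in> carrier ?S" for c f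
  proof -
    have "finite {i \<in> I. f i \<noteq> \<zero>\<^bsub>W i\<^esub>}" using that by (simp add: mem)
    then have "finite {i \<in> I. (c \<odot>\<^bsub>?S\<^esub> f) i \<noteq> \<zero>\<^bsub>W i\<^esub>}"
      by (rule rev_finite_subset) (auto simp: smult v)
    moreover have "c \<odot>\<^bsub>?S\<^esub> f \<in> (\<Pi>\<^sub>E i\<in>I. carrier (W i))" using that unfolding smult mem by (auto simp: v PiE_iff)
    ultimately show ?thesis by (simp add: mem)
  qed
  have ext: "f = g" if "f \<in> carrier ?S" "g \<in> carrier ?S" "\<And>i. i \<in> I \<Longrightarrow> f i = g i" for f g
    using that ext by (simp add: mem)
  have fi: "f i \<in> carrier (W i)" if "f \<in> carrier ?S" "i \<in> I" for f i using that by (auto simp: mem)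
  show "\<zero>\<^bsub>?S\<^esub> \<in> carrier ?S" by (rule z)
  show "\<forall>f g. f \<in> carrier ?S \<and> g \<in> carrier ?S \<longrightarrow> f \<oplus>\<^bsub>?S\<^esub> g \<in> carrier ?S" using a by blast
  show "\<forall>f\<in>carrier ?S. \<exists>g\<in>carrier ?S. f \<oplus>\<^bsub>?S\<^esub> g = \<zero>\<^bsub>?S\<^esub>"
  proof
    fix f assume f: "f \<in> carrier ?S"
    have "f \<oplus>\<^bsub>?S\<^esub> (- 1) \<odot>\<^bsub>?S\<^esub> f = \<zero>\<^bsub>?S\<^esub>"
      by (rule ext[OF a[OF f s[OF f]] z]) (simp add: add smult zero vs_right_neg[OF W] fi[OF f])
    then show "\<exists>g\<in>carrier ?S. f \<oplus>\<^bsub>?S\<^esub> g = \<zero>\<^bsub>?S\<^esub>" using s[OF f] by blast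
  qed
  show "\<forall>c f. c \<in> carrier class_ring \<and> f \<in> carrier ?S \<longrightarrow> c \<odot>\<^bsub>?S\<^esub> f \<in> carrier ?S" using s by blast
  show "\<forall>f g. f \<in> carrier ?S \<and> g \<in> carrier ?S \<longrightarrow> f \<oplus>\<^bsub>?S\<^esub> g = g \<oplus>\<^bsub>?S\<^esub> f"
    by (intro allI impI ext) (auto simp: a, simp add: add vs_add_comm[OF W] fi)
  show "\<forall>f g h. f \<in> carrier ?S \<and> g \<in> carrier ?S \<and> h \<in> carrier ?S \<longrightarrow>
      (f \<oplus>\<^bsub>?S\<^esub> g) \<oplus>\<^bsub>?S\<^esub> h = f \<oplus>\<^bsub>?S\<^esub> (g \<oplus>\<^bsub>?S\<^esub> h)"
    by (intro allI impI ext) (auto simp: a, simp add: add vs_add_assoc[OF W] fi)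
  show "\<forall>f\<in>carrier ?S. f \<oplus>\<^bsub>?S\<^esub> \<zero>\<^bsub>?S\<^esub> = f"
    by (intro ballI ext) (auto simp: a z, simp add: add zero v fi)
  show "\<forall>c d f. c \<in> carrier class_ring \<and> d \<in> carrier class_ring \<and> f \<in> carrier ?S \<longrightarrow>
      (c \<otimes>\<^bsub>class_ring\<^esub> d) \<odot>\<^bsub>?S\<^esub> f = c \<odot>\<^bsub>?S\<^esub> (d \<odot>\<^bsub>?S\<^esub> f)"
    by (intro allI impI ext) (auto simp: s, simp add: smult v fi)
  show "\<forall>f\<in>carrier ?S. \<one>\<^bsub>class_ring\<^esub> \<odot>\<^bsub>?S\<^esub> f = f"
    by (intro ballI ext) (auto simp: s, simp add: smult v fi)
  show "\<forall>c d f. c \<in> carrier class_ring \<and> d \<in> carrier class_ring \<and> f \<in> carrier ?S \<longrightarrow>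
      (c \<oplus>\<^bsub>class_ring\<^esub> d) \<odot>\<^bsub>?S\<^esub> f = c \<odot>\<^bsub>?S\<^esub> f \<oplus>\<^bsub>?S\<^esub> d \<odot>\<^bsub>?S\<^esub> f"
    by (intro allI impI ext) (auto simp: s a, simp add: smult add v fi)
  show "\<forall>c f g. c \<in> carrier class_ring \<and> f \<in> carrier ?S \<and> g \<in> carrier ?S \<longrightarrow>
      c \<odot>\<^bsub>?S\<^esub> (f \<oplus>\<^bsub>?S\<^esub> g) = c \<odot>\<^bsub>?S\<^esub> f \<oplus>\<^bsub>?S\<^esub> c \<odot>\<^bsub>?S\<^esub> g"
    by (intro allI impI ext) (auto simp: s a, simp add: smult add v fi)
qed

lemma vspace_interval_module: "vspace (pm_at (interval_module J) t)"
proof (rule vs_criteria)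
  show "field (class_ring :: 'a ring)" by unfold_locales
qed (auto simp: interval_module_def algebra_simps intro: exI[of _ "- v" for v])

section \<open>From split bars to a direct sum of interval modules\<close>

text \<open>The bars \<open>x n\<close> have been split off one after the other, with remainders \<open>C n\<close>; the remainders die out
  between any two times.\<close>

locale bar_filtration = persistence_module M for M :: "('k::field, 'a) pmod" +
  fixes C :: "nat \<Rightarrow> real \<Rightarrow> 'a set" and x :: "nat \<Rightarrow> real \<Rightarrow> 'a"
  assumes C_0: "C 0 t = carrier (pm_at M t)"
    and C_sub: "pm_sub (C n)"
    and bar: "bar_in (C n) (x n)"
    and split: "splits (C n) (x n) (C (Suc n))"
    and intervals: "is_interval {t. x n t \<noteq> \<zero>\<^bsub>pm_at M t\<^esub>}"
    and dies: "p < q \<Longrightarrow> \<exists>N. \<forall>n\<ge>N. \<forall>y\<in>C n p. push p q y = \<zero>\<^bsub>pm_at M q\<^esub>"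
    and left_generated: "left_generated (\<lambda>t. carrier (pm_at M t))"
begin

lemma C_V: "y \<in> C n t \<Longrightarrow> y \<in> carrier (V t)"
  by (rule pm_sub_carrier[OF C_sub])

lemma x_C: "x n t \<in> C n t"
  using bar[of n] by (simp add: bar_in_def)

lemmas x_V = C_V[OF x_C]

lemma x_push: "s \<le> t \<Longrightarrow> x n s \<noteq> \<zero>\<^bsub>V s\<^esub> \<Longrightarrow> push s t (x n s) = x n t"
  using bar[of n] by (simp add: bar_in_def)

lemma C_Suc: "C (Suc n) t \<subseteq> C n t"
  using split[of n] by (simp add: splits_def)

lemma C_antimono: "m \<le> n \<Longrightarrow> C n t \<subseteq> C m t"
proof (induction rule: dec_induct)
  case (step n)
  show ?case by (rule subset_trans[OF C_Suc step.IH])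
qed simp

text \<open>The coefficient is normalised to \<open>0\<close> where the bar vanishes; otherwise it would not be determined.\<close>

definition decomposes :: "nat \<Rightarrow> real \<Rightarrow> 'a \<Rightarrow> 'k \<Rightarrow> 'a \<Rightarrow> bool" where
  "decomposes n t y a c \<longleftrightarrow> c \<in> C (Suc n) t \<and> y = a \<odot>\<^bsub>V t\<^esub> x n t \<oplus>\<^bsub>V t\<^esub> c \<and>
    (x n t = \<zero>\<^bsub>V t\<^esub> \<longrightarrow> a = 0)"

definition coef :: "nat \<Rightarrow> real \<Rightarrow> 'a \<Rightarrow> 'k" where
  "coef n t y = fst (SOME ac. decomposes n t y (fst ac) (snd ac))"

definition proj :: "nat \<Rightarrow> real \<Rightarrow> 'a \<Rightarrow> 'a" where
  "proj n t y = snd (SOME ac. decomposes n t y (fst ac) (snd ac))"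

lemma decomposes_coef_proj:
  assumes y: "y \<in> C n t"
  shows "decomposes n t y (coef n t y) (proj n t y)"
proof -
  have "\<forall>y\<in>C n t. \<exists>a. \<exists>c\<in>C (Suc n) t. y = a \<odot>\<^bsub>V t\<^esub> x n t \<oplus>\<^bsub>V t\<^esub> c"
    using split[of n] by (simp add: splits_def)
  then obtain a c where c: "c \<in> C (Suc n) t" "y = a \<odot>\<^bsub>V t\<^esub> x n t \<oplus>\<^bsub>V t\<^esub> c" using y by metis
  have "decomposes n t y (if x n t = \<zero>\<^bsub>V t\<^esub> then 0 else a) c"
    using c C_V[OF c(1)] by (simp add: decomposes_def V_simps)
  then show ?thesis
    unfolding coef_def proj_def
    by (intro someI[where P = "\<lambda>ac. decomposes n t y (fst ac) (snd ac)" and x = "(if x n t = \<zero>\<^bsub>V t\<^esub> then 0 else a, c)"])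
      simp
qed

lemma decomposes_unique:
  assumes "decomposes n t y a c" "decomposes n t y b d"
  shows "a = b" "c = d"
proof -
  have eq: "a \<odot>\<^bsub>V t\<^esub> x n t \<oplus>\<^bsub>V t\<^esub> c = b \<odot>\<^bsub>V t\<^esub> x n t \<oplus>\<^bsub>V t\<^esub> d" and cd: "c \<in> C (Suc n) t" "d \<in> C (Suc n) t"
    using assms unfolding decomposes_def by metis+
  note u = splits_unique[OF split x_V cd eq]
  show "c = d" by (rule u(1))
  show "a = b" using u(2) assms by (cases "x n t = \<zero>\<^bsub>V t\<^esub>") (simp_all add: decomposes_def)
qed

lemma coef_proj_eqI:
  assumes "decomposes n t y a c" "y \<in> C n t"
  shows "coef n t y = a" "proj n t y = c"
  using decomposes_unique[OF decomposes_coef_proj[OF assms(2)] assms(1)] by auto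

lemma decomposes_add:
  assumes "decomposes n t y a c" "decomposes n t z b d"
  shows "decomposes n t (y \<oplus>\<^bsub>V t\<^esub> z) (a + b) (c \<oplus>\<^bsub>V t\<^esub> d)"
proof -
  note v = vectorspace_at
  have c: "c \<in> C (Suc n) t" "d \<in> C (Suc n) t" using assms by (auto simp: decomposes_def)
  have "(a \<odot>\<^bsub>V t\<^esub> x n t \<oplus>\<^bsub>V t\<^esub> c) \<oplus>\<^bsub>V t\<^esub> (b \<odot>\<^bsub>V t\<^esub> x n t \<oplus>\<^bsub>V t\<^esub> d) =
      (a + b) \<odot>\<^bsub>V t\<^esub> x n t \<oplus>\<^bsub>V t\<^esub> (c \<oplus>\<^bsub>V t\<^esub> d)"
    using C_V[OF c(1)] C_V[OF c(2)] x_V[of n t]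
    by (simp add: vs_add_smult[OF v] vs_ac[OF v] vs_smult[OF v] vs_add[OF v])
  then show ?thesis using assms pm_sub_add[OF C_sub c] by (simp add: decomposes_def)
qed

lemma decomposes_smult:
  assumes "decomposes n t y a c"
  shows "decomposes n t (b \<odot>\<^bsub>V t\<^esub> y) (b * a) (b \<odot>\<^bsub>V t\<^esub> c)"
proof -
  have c: "c \<in> C (Suc n) t" using assms by (simp add: decomposes_def)
  have "b \<odot>\<^bsub>V t\<^esub> (a \<odot>\<^bsub>V t\<^esub> x n t \<oplus>\<^bsub>V t\<^esub> c) = (b * a) \<odot>\<^bsub>V t\<^esub> x n t \<oplus>\<^bsub>V t\<^esub> b \<odot>\<^bsub>V t\<^esub> c"
    using C_V[OF c] x_V[of n t] by (simp add: V_simps)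
  then show ?thesis using assms pm_sub_smult[OF C_sub c] by (simp add: decomposes_def)
qed

lemma decomposes_push:
  assumes "decomposes n s y a c" and st: "s \<le> t"
  shows "decomposes n t (push s t y) (if x n t = \<zero>\<^bsub>V t\<^esub> then 0 else a) (push s t c)"
proof -
  have c: "c \<in> C (Suc n) s" "y = a \<odot>\<^bsub>V s\<^esub> x n s \<oplus>\<^bsub>V s\<^esub> c" "x n s = \<zero>\<^bsub>V s\<^esub> \<Longrightarrow> a = 0"
    using assms(1) by (auto simp: decomposes_def)
  have "push s t y = a \<odot>\<^bsub>V t\<^esub> push s t (x n s) \<oplus>\<^bsub>V t\<^esub> push s t c"
    unfolding c(2) using st x_V C_V[OF c(1)] by (simp add: push_add push_smult vs_smult[OF vectorspace_at])
  moreover have "a \<odot>\<^bsub>V t\<^esub> push s t (x n s) = (if x n t = \<zero>\<^bsub>V t\<^esub> then 0 else a) \<odot>\<^bsub>V t\<^esub> x n t"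
  proof (cases "x n s = \<zero>\<^bsub>V s\<^esub>")
    case True
    then show ?thesis using st c(3) x_V by (simp add: V_simps)
  next
    case False
    then show ?thesis using x_push[OF st False] by (simp add: V_simps)
  qed
  ultimately show ?thesis using pm_sub_push[OF C_sub st c(1)] by (simp add: decomposes_def)
qed

text \<open>\<open>rest n t y\<close> is the component of \<open>y\<close> in \<open>C n\<close>, and \<open>coord t y\<close> lists its coefficients along the bars.\<close>

primrec rest :: "nat \<Rightarrow> real \<Rightarrow> 'a \<Rightarrow> 'a" where
  "rest 0 t y = y"
| "rest (Suc n) t y = proj n t (rest n t y)"

definition coord :: "real \<Rightarrow> 'a \<Rightarrow> nat \<Rightarrow> 'k" where
  "coord t y n = coef n t (rest n t y)"

lemma rest_C: "y \<in> carrier (V t) \<Longrightarrow> rest n t y \<in> C n t"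
proof (induction n)
  case (Suc n)
  then show ?case using decomposes_coef_proj[of "rest n t y" n t] by (simp add: decomposes_def)
qed (simp add: C_0)

lemma decomposes_rest:
  "y \<in> carrier (V t) \<Longrightarrow> decomposes n t (rest n t y) (coord t y n) (rest (Suc n) t y)"
  using decomposes_coef_proj[OF rest_C] by (simp add: coord_def)

lemma rest_coord_step:
  assumes "y \<in> carrier (V t)" "decomposes n t (rest n t y) a c"
  shows "rest (Suc n) t y = c" "coord t y n = a"
  using coef_proj_eqI[OF assms(2) rest_C[OF assms(1)]] by (simp_all add: coord_def)

lemma rest_add:
  assumes y: "y \<in> carrier (V t)" "z \<in> carrier (V t)"
  shows "rest n t (y \<oplus>\<^bsub>V t\<^esub> z) = rest n t y \<oplus>\<^bsub>V t\<^esub> rest n t z"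
    and "coord t (y \<oplus>\<^bsub>V t\<^esub> z) n = coord t y n + coord t z n"
proof -
  have yz: "y \<oplus>\<^bsub>V t\<^esub> z \<in> carrier (V t)" using y by (rule vs_add[OF vectorspace_at])
  have d: "decomposes n t (rest n t y \<oplus>\<^bsub>V t\<^esub> rest n t z) (coord t y n + coord t z n)
      (rest (Suc n) t y \<oplus>\<^bsub>V t\<^esub> rest (Suc n) t z)" for n
    using y by (intro decomposes_add decomposes_rest)
  show r: "rest n t (y \<oplus>\<^bsub>V t\<^esub> z) = rest n t y \<oplus>\<^bsub>V t\<^esub> rest n t z" for n
  proof (induction n)
    case (Suc n)
    show ?case by (rule rest_coord_step(1)[OF yz]) (use d[of n] Suc in simp)
  qed simp
  show "coord t (y \<oplus>\<^bsub>V t\<^esub> z) n = coord t y n + coord t z n"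
    by (rule rest_coord_step(2)[OF yz]) (use d[of n] r[of n] in simp)
qed

lemma rest_smult:
  assumes y: "y \<in> carrier (V t)"
  shows "rest n t (b \<odot>\<^bsub>V t\<^esub> y) = b \<odot>\<^bsub>V t\<^esub> rest n t y"
    and "coord t (b \<odot>\<^bsub>V t\<^esub> y) n = b * coord t y n"
proof -
  have yz: "b \<odot>\<^bsub>V t\<^esub> y \<in> carrier (V t)" using y by (rule vs_smult[OF vectorspace_at])
  have d: "decomposes n t (b \<odot>\<^bsub>V t\<^esub> rest n t y) (b * coord t y n) (b \<odot>\<^bsub>V t\<^esub> rest (Suc n) t y)" for n
    using y by (intro decomposes_smult decomposes_rest)
  show r: "rest n t (b \<odot>\<^bsub>V t\<^esub> y) = b \<odot>\<^bsub>V t\<^esub> rest n t y" for n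
  proof (induction n)
    case (Suc n)
    show ?case by (rule rest_coord_step(1)[OF yz]) (use d[of n] Suc in simp)
  qed simp
  show "coord t (b \<odot>\<^bsub>V t\<^esub> y) n = b * coord t y n"
    by (rule rest_coord_step(2)[OF yz]) (use d[of n] r[of n] in simp)
qed

lemma rest_push:
  assumes y: "y \<in> carrier (V s)" and st: "s \<le> t"
  shows "rest n t (push s t y) = push s t (rest n s y)"
    and "coord t (push s t y) n = (if x n t = \<zero>\<^bsub>V t\<^esub> then 0 else coord s y n)"
proof -
  have py: "push s t y \<in> carrier (V t)" using st y by (rule push_in)
  have d: "decomposes n t (push s t (rest n s y)) (if x n t = \<zero>\<^bsub>V t\<^esub> then 0 else coord s y n)
      (push s t (rest (Suc n) s y))" for n
    using y st by (intro decomposes_push decomposes_rest)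
  show r: "rest n t (push s t y) = push s t (rest n s y)" for n
  proof (induction n)
    case (Suc n)
    show ?case by (rule rest_coord_step(1)[OF py]) (use d[of n] Suc in simp)
  qed simp
  show "coord t (push s t y) n = (if x n t = \<zero>\<^bsub>V t\<^esub> then 0 else coord s y n)"
    by (rule rest_coord_step(2)[OF py]) (use d[of n] r[of n] in simp)
qed

lemma coord_zero_outside: "y \<in> carrier (V t) \<Longrightarrow> x n t = \<zero>\<^bsub>V t\<^esub> \<Longrightarrow> coord t y n = 0"
  using decomposes_rest[of y t n] by (simp add: decomposes_def)

lemma decomposes_zero: "decomposes n t \<zero>\<^bsub>V t\<^esub> 0 \<zero>\<^bsub>V t\<^esub>"
  using x_V by (simp add: decomposes_def pm_sub_zero[OF C_sub] V_simps)

text \<open>The element comes from an earlier time \<open>s\<close>, and its components in \<open>C n\<close> are images of elements of \<open>C n\<close>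
  at time \<open>s\<close>, which die before \<open>t\<close> once \<open>n\<close> is large.\<close>

lemma rest_eventually_zero:
  assumes y: "y \<in> carrier (V t)"
  shows "\<exists>N. \<forall>n\<ge>N. rest n t y = \<zero>\<^bsub>V t\<^esub> \<and> coord t y n = 0"
proof -
  obtain s z where s: "s < t" "z \<in> carrier (V s)" "push s t z = y"
    using left_generated y unfolding left_generated_def by metis
  obtain N where N: "\<And>n w. n \<ge> N \<Longrightarrow> w \<in> C n s \<Longrightarrow> push s t w = \<zero>\<^bsub>V t\<^esub>"
    using dies[OF s(1)] by metis
  have r: "rest n t y = \<zero>\<^bsub>V t\<^esub>" if "n \<ge> N" for n
    using rest_push(1)[OF s(2), of t n] s N[OF that rest_C[OF s(2)]] by simp
  have "coord t y n = 0" if n: "n \<ge> N" for n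
    by (rule rest_coord_step(2)[OF y, of n 0 "\<zero>\<^bsub>V t\<^esub>"]) (simp add: r[OF n] decomposes_zero)
  then show ?thesis using r by blast
qed

text \<open>Both remainders are zero from some step on, and equal coefficients allow to go back step by step.\<close>

lemma coord_inj:
  assumes y: "y \<in> carrier (V t)" "z \<in> carrier (V t)" and eq: "\<And>n. coord t y n = coord t z n"
  shows "y = z"
proof -
  obtain N where N: "rest N t y = \<zero>\<^bsub>V t\<^esub>" "rest N t z = \<zero>\<^bsub>V t\<^esub>"
    using rest_eventually_zero[OF y(1)] rest_eventually_zero[OF y(2)] by (meson nat_le_linear)
  have "rest n t y = rest n t z" if "n \<le> N" for n
    using that
  proof (induction rule: inc_induct)
    case (step n)
    then show ?case
      using decomposes_rest[OF y(1), of n] decomposes_rest[OF y(2), of n] eq[of n]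
      by (simp add: decomposes_def)
  qed (simp add: N)
  from this[of 0] show ?thesis by simp
qed

text \<open>The bar \<open>x n\<close> lies in all remainders up to \<open>C n\<close>, and nothing of it is left in the later ones.\<close>

lemma coord_x: "coord t (x n t) m = (if m = n \<and> x n t \<noteq> \<zero>\<^bsub>V t\<^esub> then 1 else 0)"
proof -
  have r1: "rest m t (x n t) = x n t" if "m \<le> n" for m
    using that
  proof (induction m)
    case (Suc m)
    have "decomposes m t (x n t) 0 (x n t)"
      using C_antimono[of "Suc m" n t] Suc.prems x_C[of n t] x_V by (auto simp: decomposes_def V_simps)
    then show ?case using rest_coord_step(1)[OF x_V, of m t n] Suc by simp
  qed simp
  have c1: "coord t (x n t) m = 0" if "m < n"
  proof (rule rest_coord_step(2)[OF x_V])
    show "decomposes m t (rest m t (x n t)) 0 (x n t)"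
      using that r1[of m] C_antimono[of "Suc m" n t] x_C[of n t] x_V by (auto simp: decomposes_def V_simps)
  qed
  have d: "decomposes n t (rest n t (x n t)) (if x n t \<noteq> \<zero>\<^bsub>V t\<^esub> then 1 else 0) \<zero>\<^bsub>V t\<^esub>"
    using r1[of n] pm_sub_zero[OF C_sub] x_V by (simp add: decomposes_def V_simps)
  have r2: "rest (Suc n + k) t (x n t) = \<zero>\<^bsub>V t\<^esub>" for k
  proof (induction k)
    case 0 then show ?case using rest_coord_step(1)[OF x_V d] by simp
  next
    case (Suc k)
    then show ?case using rest_coord_step(1)[OF x_V, of "Suc n + k" t n 0 "\<zero>\<^bsub>V t\<^esub>"] decomposes_zero by simp
  qed
  have c2: "coord t (x n t) m = 0" if "n < m"
    by (rule rest_coord_step(2)[OF x_V, where c = "\<zero>\<^bsub>V t\<^esub>"])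
      (use r2[of "m - Suc n"] that decomposes_zero in simp)
  show ?thesis using c1 c2 rest_coord_step(2)[OF x_V d] by (cases m n rule: linorder_cases) auto
qed

lemma coord_zero: "coord t \<zero>\<^bsub>V t\<^esub> n = 0"
  using rest_smult(2)[of "\<zero>\<^bsub>V t\<^esub>" t 0 n] by (simp add: V_simps)

lemma coord_surj:
  assumes "\<And>n. x n t = \<zero>\<^bsub>V t\<^esub> \<Longrightarrow> h n = 0" "\<And>n. n \<ge> N \<Longrightarrow> h n = 0"
  shows "\<exists>y\<in>carrier (V t). coord t y = h"
proof -
  have "\<exists>y\<in>carrier (V t). \<forall>n. coord t y n = (if n < K then h n else 0)" for K
  proof (induction K)
    case 0
    show ?case by (rule bexI[of _ "\<zero>\<^bsub>V t\<^esub>"]) (simp_all add: coord_zero V_simps)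
  next
    case (Suc K)
    then obtain y where y: "y \<in> carrier (V t)" "\<And>n. coord t y n = (if n < K then h n else 0)" by metis
    let ?z = "y \<oplus>\<^bsub>V t\<^esub> h K \<odot>\<^bsub>V t\<^esub> x K t"
    have "coord t ?z n = (if n < Suc K then h n else 0)" for n
      using y assms(1)[of K] x_V[of K t] by (simp add: rest_add rest_smult coord_x V_simps less_Suc_eq)
    moreover have "?z \<in> carrier (V t)" using y(1) x_V by (simp add: V_simps)
    ultimately show ?case by metis
  qed
  from this[of N] obtain y where y: "y \<in> carrier (V t)" "\<And>n. coord t y n = (if n < N then h n else 0)" by metis
  then have "coord t y = h" using assms(2) by (auto simp: fun_eq_iff)
  then show ?thesis using y(1) by metis
qed

text \<open>The isomorphism sends an element to its coordinates along the bars that are not identically zero.\<close>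

lemma cid_M: "cid M"
proof -
  define I where "I = {n. \<exists>t. x n t \<noteq> \<zero>\<^bsub>V t\<^esub>}"
  define J where "J n = {t. x n t \<noteq> \<zero>\<^bsub>V t\<^esub>}" for n
  have J: "t \<in> J n \<longleftrightarrow> x n t \<noteq> \<zero>\<^bsub>V t\<^esub>" for n t by (simp add: J_def)
  let ?S = "pm_direct_sum I (\<lambda>i. interval_module (J i)) :: ('k, nat \<Rightarrow> 'k) pmod"
  define f where "f t y = (\<lambda>i\<in>I. coord t y i)" for t y
  have S_at: "pm_at ?S t = vs_direct_sum I (\<lambda>i. pm_at (interval_module (J i)) t)" for t
    by (simp add: pm_direct_sum_def)
  have S_map: "pm_map ?S s t h = (\<lambda>i\<in>I. if s \<in> J i \<and> t \<in> J i then h i else 0)" for s t h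
    by (auto simp: pm_direct_sum_def interval_module_def)
  have S_carrier: "h \<in> carrier (pm_at ?S t) \<longleftrightarrow>
      h \<in> extensional I \<and> (\<forall>i\<in>I. t \<notin> J i \<longrightarrow> h i = 0) \<and> finite {i\<in>I. h i \<noteq> 0}" for h t
    unfolding S_at by (auto simp: vs_direct_sum_def interval_module_def PiE_iff)
  have S_add: "h \<oplus>\<^bsub>pm_at ?S t\<^esub> h' = (\<lambda>i\<in>I. h i + h' i)" and
    S_smult: "c \<odot>\<^bsub>pm_at ?S t\<^esub> h = (\<lambda>i\<in>I. c * h i)" for h h' c t
    unfolding S_at by (auto simp: vs_direct_sum_def interval_module_def)
  have fin: "finite {n. coord t y n \<noteq> 0}" if y: "y \<in> carrier (V t)" for y t
  proof -
    obtain N where "\<And>n. n \<ge> N \<Longrightarrow> coord t y n = 0" using rest_eventually_zero[OF y] by metis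
    then have "{n. coord t y n \<noteq> 0} \<subseteq> {..<N}" by (auto simp: not_less[symmetric])
    then show ?thesis by (rule finite_subset) simp
  qed
  have fV: "f t y \<in> carrier (pm_at ?S t)" if y: "y \<in> carrier (V t)" for t y
  proof -
    have "finite {i\<in>I. f t y i \<noteq> 0}" by (rule finite_subset[OF _ fin[OF y]]) (auto simp: f_def)
    then show ?thesis using coord_zero_outside[OF y] by (auto simp: S_carrier f_def J)
  qed
  have "linmap (V t) (pm_at ?S t) (f t)" for t
  proof (subst linmap_iff[OF vectorspace_at])
    show "vspace (pm_at ?S t)"
      unfolding S_at by (intro vspace_direct_sum vspace_interval_module)
    show "(\<forall>y\<in>carrier (V t). f t y \<in> carrier (pm_at ?S t)) \<and>
      (\<forall>y\<in>carrier (V t). \<forall>z\<in>carrier (V t). f t (y \<oplus>\<^bsub>V t\<^esub> z) = f t y \<oplus>\<^bsub>pm_at ?S t\<^esub> f t z) \<and>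
      (\<forall>c. \<forall>y\<in>carrier (V t). f t (c \<odot>\<^bsub>V t\<^esub> y) = c \<odot>\<^bsub>pm_at ?S t\<^esub> f t y)"
      using fV by (auto simp: S_add S_smult f_def rest_add rest_smult)
  qed
  moreover have "bij_betw (f t) (carrier (V t)) (carrier (pm_at ?S t))" for t
  proof (rule bij_betw_imageI)
    show "inj_on (f t) (carrier (V t))"
    proof (rule inj_onI)
      fix y z assume yz: "y \<in> carrier (V t)" "z \<in> carrier (V t)" "f t y = f t z"
      have "coord t y n = coord t z n" for n
      proof (cases "n \<in> I")
        case True
        then show ?thesis using fun_cong[OF yz(3), of n] by (simp add: f_def)
      next
        case False
        then show ?thesis using coord_zero_outside yz(1,2) by (simp add: I_def)
      qed
      then show "y = z" by (rule coord_inj[OF yz(1,2)])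
    qed
    show "f t ` carrier (V t) = carrier (pm_at ?S t)"
    proof
      show "f t ` carrier (V t) \<subseteq> carrier (pm_at ?S t)" using fV by auto
      show "carrier (pm_at ?S t) \<subseteq> f t ` carrier (V t)"
      proof
        fix h assume h: "h \<in> carrier (pm_at ?S t)"
        define h' where "h' n = (if n \<in> I then h n else 0)" for n
        have "finite {i\<in>I. h i \<noteq> 0}" using h by (simp add: S_carrier)
        then obtain N where "\<And>i. i \<in> I \<Longrightarrow> h i \<noteq> 0 \<Longrightarrow> i < N" by (auto simp: finite_nat_set_iff_bounded)
        then have "h' n = 0" if "n \<ge> N" for n using that by (auto simp: h'_def not_less[symmetric])
        moreover have "h' n = 0" if "x n t = \<zero>\<^bsub>V t\<^esub>" for n
          using h that by (auto simp: h'_def S_carrier J)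
        ultimately obtain y where y: "y \<in> carrier (V t)" "coord t y = h'" using coord_surj by metis
        have "f t y = h" using h unfolding f_def y(2) h'_def by (auto simp: S_carrier extensional_def)
        then show "h \<in> f t ` carrier (V t)" using y(1) by blast
      qed
    qed
  qed
  moreover have "f b (push a b y) = pm_map ?S a b (f a y)" if "a \<le> b" "y \<in> carrier (V a)" for a b y
    using rest_push(2)[OF that(2,1)] coord_zero_outside[OF that(2)]
    by (auto simp: f_def S_map J)
  ultimately have "pm_isomorphic M ?S"
    unfolding pm_isomorphic_def by (intro exI[of _ f]) simp
  moreover have "\<forall>i\<in>I. is_interval (J i) \<and> J i \<noteq> {}"
    using intervals unfolding J_def I_def by auto
  moreover have "persistence_module M" by unfold_locales
  ultimately show ?thesis unfolding cid_def by metis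
qed

end

theorem q_tame_left_generated_cid:
  assumes "qtame M" and "persistence_module.left_generated M (\<lambda>t. carrier (pm_at M t))"
  shows "cid M"
proof -
  interpret q_tame_module M
    using assms(1) unfolding qtame_def q_tame_module_def q_tame_module_axioms_def by blast
  obtain C x where "bar_filtration M C x"
  proof (rule bar_sequence[OF assms(2)])
    fix C x
    assume "C 0 = (\<lambda>t. carrier (V t))" "\<And>n. pm_sub (C n)" "\<And>n. bar_in (C n) (x n)"
    "\<And>n. splits (C n) (x n) (C (Suc n))" "\<And>n. is_interval {t. x n t \<noteq> \<zero>\<^bsub>V t\<^esub>}"
    "\<And>p q. p < q \<Longrightarrow> \<exists>N. \<forall>n\<ge>N. \<forall>y\<in>C n p. push p q y = \<zero>\<^bsub>V q\<^esub>"
    then have "bar_filtration M C x" using assms(2) by unfold_locales simp_all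
    then show thesis by (rule that)
  qed
  then show ?thesis by (rule bar_filtration.cid_M)
qed

section \<open>Interleavings with room to spare\<close>

text \<open>A morphism of degree \<open>\<epsilon>\<close> followed by all structure maps: a map from \<open>M a\<close> to \<open>N b\<close> for every \<open>b \<ge> a + \<epsilon>\<close>.
  In this form degrees can be increased freely, and indices that agree only after a computation with real
  numbers need not be identified.\<close>

definition slack_hom :: "real \<Rightarrow> ('k::field, 'a) pmod \<Rightarrow> ('k, 'b) pmod \<Rightarrow> (real \<Rightarrow> real \<Rightarrow> 'a \<Rightarrow> 'b) \<Rightarrow> bool" where
  "slack_hom \<epsilon> M N \<phi> \<longleftrightarrow>
    (\<forall>a b. a + \<epsilon> \<le> b \<longrightarrow> linmap (pm_at M a) (pm_at N b) (\<phi> a b)) \<and>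
    (\<forall>a b c. \<forall>x\<in>carrier (pm_at M a). a + \<epsilon> \<le> b \<longrightarrow> b \<le> c \<longrightarrow> pm_map N b c (\<phi> a b x) = \<phi> a c x) \<and>
    (\<forall>a b c. \<forall>x\<in>carrier (pm_at M a). a \<le> b \<longrightarrow> b + \<epsilon> \<le> c \<longrightarrow> \<phi> b c (pm_map M a b x) = \<phi> a c x)"

lemma
  assumes "slack_hom \<epsilon> M N \<phi>"
  shows slack_linear: "a + \<epsilon> \<le> b \<Longrightarrow> linmap (pm_at M a) (pm_at N b) (\<phi> a b)"
    and slack_push: "x \<in> carrier (pm_at M a) \<Longrightarrow> a + \<epsilon> \<le> b \<Longrightarrow> b \<le> c \<Longrightarrow>
      pm_map N b c (\<phi> a b x) = \<phi> a c x"
    and slack_pull: "x \<in> carrier (pm_at M a) \<Longrightarrow> a \<le> b \<Longrightarrow> b + \<epsilon> \<le> c \<Longrightarrow>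
      \<phi> b c (pm_map M a b x) = \<phi> a c x"
    and slack_in: "x \<in> carrier (pm_at M a) \<Longrightarrow> a + \<epsilon> \<le> b \<Longrightarrow> \<phi> a b x \<in> carrier (pm_at N b)"
proof -
  show 1: "a + \<epsilon> \<le> b \<Longrightarrow> linmap (pm_at M a) (pm_at N b) (\<phi> a b)" for a b
    using assms by (simp add: slack_hom_def)
  show "x \<in> carrier (pm_at M a) \<Longrightarrow> a + \<epsilon> \<le> b \<Longrightarrow> b \<le> c \<Longrightarrow> pm_map N b c (\<phi> a b x) = \<phi> a c x"
    using assms by (simp add: slack_hom_def)
  show "x \<in> carrier (pm_at M a) \<Longrightarrow> a \<le> b \<Longrightarrow> b + \<epsilon> \<le> c \<Longrightarrow> \<phi> b c (pm_map M a b x) = \<phi> a c x"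
    using assms by (simp add: slack_hom_def)
  show "x \<in> carrier (pm_at M a) \<Longrightarrow> a + \<epsilon> \<le> b \<Longrightarrow> \<phi> a b x \<in> carrier (pm_at N b)"
    using linmap_in[OF 1] .
qed

definition slack_interleaved :: "real \<Rightarrow> ('k::field, 'a) pmod \<Rightarrow> ('k, 'b) pmod \<Rightarrow>
    (real \<Rightarrow> real \<Rightarrow> 'a \<Rightarrow> 'b) \<Rightarrow> (real \<Rightarrow> real \<Rightarrow> 'b \<Rightarrow> 'a) \<Rightarrow> bool" where
  "slack_interleaved \<epsilon> M N \<phi> \<psi> \<longleftrightarrow> slack_hom \<epsilon> M N \<phi> \<and> slack_hom \<epsilon> N M \<psi> \<and>
    (\<forall>a b c. \<forall>x\<in>carrier (pm_at M a). a + \<epsilon> \<le> b \<longrightarrow> b + \<epsilon> \<le> c \<longrightarrow> \<psi> b c (\<phi> a b x) = pm_map M a c x) \<and>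
    (\<forall>a b c. \<forall>x\<in>carrier (pm_at N a). a + \<epsilon> \<le> b \<longrightarrow> b + \<epsilon> \<le> c \<longrightarrow> \<phi> b c (\<psi> a b x) = pm_map N a c x)"

lemma
  assumes "slack_interleaved \<epsilon> M N \<phi> \<psi>"
  shows slack_interleaved_hom: "slack_hom \<epsilon> M N \<phi>" "slack_hom \<epsilon> N M \<psi>"
    and slack_interleaved_back: "x \<in> carrier (pm_at M a) \<Longrightarrow> a + \<epsilon> \<le> b \<Longrightarrow> b + \<epsilon> \<le> c \<Longrightarrow>
      \<psi> b c (\<phi> a b x) = pm_map M a c x"
    and slack_interleaved_forth: "y \<in> carrier (pm_at N a) \<Longrightarrow> a + \<epsilon> \<le> b \<Longrightarrow> b + \<epsilon> \<le> c \<Longrightarrow>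
      \<phi> b c (\<psi> a b y) = pm_map N a c y"
  using assms by (simp_all add: slack_interleaved_def)

lemma slack_hom_mono: "slack_hom \<epsilon> M N \<phi> \<Longrightarrow> \<epsilon> \<le> \<delta> \<Longrightarrow> slack_hom \<delta> M N \<phi>"
  unfolding slack_hom_def by (meson add_left_mono order_trans)

lemma slack_interleaved_mono: "slack_interleaved \<epsilon> M N \<phi> \<psi> \<Longrightarrow> \<epsilon> \<le> \<delta> \<Longrightarrow> slack_interleaved \<delta> M N \<phi> \<psi>"
  using slack_hom_mono[of \<epsilon> M N \<phi> \<delta>] slack_hom_mono[of \<epsilon> N M \<psi> \<delta>]
  by (auto simp: slack_interleaved_def)

lemma slack_interleaved_refl:
  assumes "persistence_module M"
  shows "slack_interleaved 0 M M (pm_map M) (pm_map M)"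
proof -
  interpret persistence_module M by (rule assms)
  show ?thesis unfolding slack_interleaved_def slack_hom_def by (simp add: linear_pm_map pm_map_comp)
qed

text \<open>The intermediate time in a composite is arbitrary within its admissible range. Choosing it latest
  possible or earliest possible gives two descriptions of the same morphism.\<close>

lemma slack_hom_comp:
  assumes \<phi>: "slack_hom \<epsilon> M N \<phi>" and \<psi>: "slack_hom \<delta> N P \<psi>"
  shows "slack_hom (\<epsilon> + \<delta>) M P (\<lambda>a b x. \<psi> (b - \<delta>) b (\<phi> a (b - \<delta>) x))"
    and "slack_hom (\<epsilon> + \<delta>) M P (\<lambda>a b x. \<psi> (a + \<epsilon>) b (\<phi> a (a + \<epsilon>) x))"
    and "x \<in> carrier (pm_at M a) \<Longrightarrow> a + \<epsilon> \<le> b \<Longrightarrow> b + \<delta> \<le> c \<Longrightarrow> \<psi> b c (\<phi> a b x) = \<psi> (c - \<delta>) c (\<phi> a (c - \<delta>) x)"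
    and "x \<in> carrier (pm_at M a) \<Longrightarrow> a + \<epsilon> \<le> b \<Longrightarrow> b + \<delta> \<le> c \<Longrightarrow> \<psi> b c (\<phi> a b x) = \<psi> (a + \<epsilon>) c (\<phi> a (a + \<epsilon>) x)"
proof -
  have mid: "\<psi> b c (\<phi> a b x) = \<psi> b' c (\<phi> a b' x)"
    if "x \<in> carrier (pm_at M a)" "a + \<epsilon> \<le> b" "b \<le> b'" "b' + \<delta> \<le> c" for a b b' c x
    using slack_pull[OF \<psi>, of "\<phi> a b x" b b' c] slack_push[OF \<phi>, of x a b b'] slack_in[OF \<phi>, of x a b] that
    by simp
  show 1: "\<psi> b c (\<phi> a b x) = \<psi> (c - \<delta>) c (\<phi> a (c - \<delta>) x)"
    if "x \<in> carrier (pm_at M a)" "a + \<epsilon> \<le> b" "b + \<delta> \<le> c" for a b c x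
    by (rule mid) (use that in auto)
  show 2: "\<psi> b c (\<phi> a b x) = \<psi> (a + \<epsilon>) c (\<phi> a (a + \<epsilon>) x)"
    if "x \<in> carrier (pm_at M a)" "a + \<epsilon> \<le> b" "b + \<delta> \<le> c" for a b c x
    by (rule mid[symmetric]) (use that in auto)
  let ?\<chi> = "\<lambda>a b x. \<psi> (b - \<delta>) b (\<phi> a (b - \<delta>) x)"
  show *: "slack_hom (\<epsilon> + \<delta>) M P ?\<chi>"
    unfolding slack_hom_def
  proof (intro conjI allI impI ballI)
    show "linmap (pm_at M a) (pm_at P b) (?\<chi> a b)" if "a + (\<epsilon> + \<delta>) \<le> b" for a b
      by (rule linmap_comp[OF slack_linear[OF \<phi>] slack_linear[OF \<psi>]]) (use that in auto)
    show "pm_map P b c (?\<chi> a b x) = ?\<chi> a c x"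
      if "x \<in> carrier (pm_at M a)" "a + (\<epsilon> + \<delta>) \<le> b" "b \<le> c" for a b c x
      using slack_push[OF \<psi>, of "\<phi> a (b - \<delta>) x" "b - \<delta>" b c] slack_in[OF \<phi>, of x a "b - \<delta>"]
        1[of x a "b - \<delta>" c] that by simp
    show "?\<chi> b c (pm_map M a b x) = ?\<chi> a c x"
      if "x \<in> carrier (pm_at M a)" "a \<le> b" "b + (\<epsilon> + \<delta>) \<le> c" for a b c x
      using slack_pull[OF \<phi>, of x a b "c - \<delta>"] that by simp
  qed
  have "?\<chi> a b x = \<psi> (a + \<epsilon>) b (\<phi> a (a + \<epsilon>) x)"
    if "x \<in> carrier (pm_at M a)" "a + (\<epsilon> + \<delta>) \<le> b" for a b x
    using 2[of x a "b - \<delta>" b] that by simp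
  note eq = this
  show "slack_hom (\<epsilon> + \<delta>) M P (\<lambda>a b x. \<psi> (a + \<epsilon>) b (\<phi> a (a + \<epsilon>) x))"
    unfolding slack_hom_def
  proof (intro conjI allI impI ballI)
    show "linmap (pm_at M a) (pm_at P b) (\<lambda>x. \<psi> (a + \<epsilon>) b (\<phi> a (a + \<epsilon>) x))" if "a + (\<epsilon> + \<delta>) \<le> b" for a b
      by (rule linmap_comp[OF slack_linear[OF \<phi>] slack_linear[OF \<psi>]]) (use that in auto)
    show "pm_map P b c (\<psi> (a + \<epsilon>) b (\<phi> a (a + \<epsilon>) x)) = \<psi> (a + \<epsilon>) c (\<phi> a (a + \<epsilon>) x)"
      if "x \<in> carrier (pm_at M a)" "a + (\<epsilon> + \<delta>) \<le> b" "b \<le> c" for a b c x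
      using slack_push[OF \<psi>, of "\<phi> a (a + \<epsilon>) x" "a + \<epsilon>" b c] slack_in[OF \<phi>, of x a "a + \<epsilon>"] that by simp
    show "\<psi> (b + \<epsilon>) c (\<phi> b (b + \<epsilon>) (pm_map M a b x)) = \<psi> (a + \<epsilon>) c (\<phi> a (a + \<epsilon>) x)"
      if "x \<in> carrier (pm_at M a)" "a \<le> b" "b + (\<epsilon> + \<delta>) \<le> c" for a b c x
      using slack_pull[OF \<phi>, of x a b "b + \<epsilon>"] 2[of x a "b + \<epsilon>" c] that by simp
  qed
qed

lemma slack_interleaved_trans:
  assumes nonneg: "0 \<le> \<epsilon>" "0 \<le> \<delta>" and 1: "slack_interleaved \<epsilon> M N \<phi> \<psi>" and 2: "slack_interleaved \<delta> N P \<phi>' \<psi>'"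
  shows "slack_interleaved (\<epsilon> + \<delta>) M P (\<lambda>a b x. \<phi>' (b - \<delta>) b (\<phi> a (b - \<delta>) x))
    (\<lambda>a b x. \<psi> (a + \<delta>) b (\<psi>' a (a + \<delta>) x))"
proof -
  note h1 = slack_interleaved_hom[OF 1] and h2 = slack_interleaved_hom[OF 2]
  show ?thesis
    unfolding slack_interleaved_def
  proof (intro conjI allI impI ballI)
    show "slack_hom (\<epsilon> + \<delta>) M P (\<lambda>a b x. \<phi>' (b - \<delta>) b (\<phi> a (b - \<delta>) x))"
      by (rule slack_hom_comp[OF h1(1) h2(1)])
    have "slack_hom (\<delta> + \<epsilon>) P M (\<lambda>a b x. \<psi> (a + \<delta>) b (\<psi>' a (a + \<delta>) x))"
      by (rule slack_hom_comp[OF h2(2) h1(2)])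
    then show "slack_hom (\<epsilon> + \<delta>) P M (\<lambda>a b x. \<psi> (a + \<delta>) b (\<psi>' a (a + \<delta>) x))" by (simp add: add.commute)
    show "\<psi> (b + \<delta>) c (\<psi>' b (b + \<delta>) (\<phi>' (b - \<delta>) b (\<phi> a (b - \<delta>) x))) = pm_map M a c x"
      if x: "x \<in> carrier (pm_at M a)" and b: "a + (\<epsilon> + \<delta>) \<le> b" "b + (\<epsilon> + \<delta>) \<le> c" for a b c x
    proof -
      let ?y = "\<phi> a (b - \<delta>) x"
      have y: "?y \<in> carrier (pm_at N (b - \<delta>))" using slack_in[OF h1(1) x] b by simp
      show ?thesis
        using slack_interleaved_back[OF 2 y, of b "b + \<delta>"] slack_pull[OF h1(2) y, of "b + \<delta>" c]
          slack_interleaved_back[OF 1 x, of "b - \<delta>" c] b nonneg by simp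
    qed
    show "\<phi>' (c - \<delta>) c (\<phi> b (c - \<delta>) (\<psi> (a + \<delta>) b (\<psi>' a (a + \<delta>) x))) = pm_map P a c x"
      if x: "x \<in> carrier (pm_at P a)" and b: "a + (\<epsilon> + \<delta>) \<le> b" "b + (\<epsilon> + \<delta>) \<le> c" for a b c x
    proof -
      let ?z = "\<psi>' a (a + \<delta>) x"
      have z: "?z \<in> carrier (pm_at N (a + \<delta>))" using slack_in[OF h2(2) x] by simp
      show ?thesis
        using slack_interleaved_forth[OF 1 z, of b "c - \<delta>"] slack_pull[OF h2(1) z, of "c - \<delta>" c]
          slack_interleaved_forth[OF 2 x, of "a + \<delta>" c] b nonneg by simp
    qed
  qed
qed

lemma shifted_hom_imp_slack:
  assumes N: "persistence_module N" and \<phi>: "shifted_hom \<epsilon> M N \<phi>"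
  shows "slack_hom \<epsilon> M N (\<lambda>a b x. pm_map N (a + \<epsilon>) b (\<phi> a x))"
proof -
  interpret N: persistence_module N by (rule N)
  have lin: "linmap (pm_at M a) (pm_at N (a + \<epsilon>)) (\<phi> a)" for a
    using \<phi> by (simp add: shifted_hom_def)
  have nat: "\<phi> b (pm_map M a b x) = pm_map N (a + \<epsilon>) (b + \<epsilon>) (\<phi> a x)"
    if "a \<le> b" "x \<in> carrier (pm_at M a)" for a b x
    using \<phi> that by (simp add: shifted_hom_def)
  show ?thesis
    unfolding slack_hom_def
    by (intro conjI allI impI ballI linmap_comp[OF lin N.linear_pm_map])
      (simp_all add: N.pm_map_comp linmap_in[OF lin] nat)
qed

lemma slack_imp_shifted_hom:
  assumes "slack_hom \<epsilon> M N \<phi>"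
  shows "shifted_hom \<epsilon> M N (\<lambda>a. \<phi> a (a + \<epsilon>))"
  unfolding shifted_hom_def
  by (intro conjI allI impI ballI) (simp_all add: slack_linear[OF assms] slack_push[OF assms] slack_pull[OF assms])

lemma interleaved_imp_slack:
  assumes M: "persistence_module M" and N: "persistence_module N" and int: "interleaved \<epsilon> M N"
    and nonneg: "0 \<le> \<epsilon>"
  shows "\<exists>\<phi> \<psi>. slack_interleaved \<epsilon> M N \<phi> \<psi>"
proof -
  interpret M: persistence_module M by (rule M)
  interpret N: persistence_module N by (rule N)
  obtain \<phi> \<psi> where *: "shifted_hom \<epsilon> M N \<phi> \<and> shifted_hom \<epsilon> N M \<psi> \<and>
       (\<forall>a. \<forall>x \<in> carrier (pm_at M a). \<psi> (a + \<epsilon>) (\<phi> a x) = pm_map M a (a + 2 * \<epsilon>) x) \<and>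
       (\<forall>a. \<forall>y \<in> carrier (pm_at N a). \<phi> (a + \<epsilon>) (\<psi> a y) = pm_map N a (a + 2 * \<epsilon>) y)"
    using int unfolding interleaved_def by (elim exE) (rule that)
  have \<phi>: "shifted_hom \<epsilon> M N \<phi>" and \<psi>: "shifted_hom \<epsilon> N M \<psi>" using * by simp_all
  have there: "\<psi> (a + \<epsilon>) (\<phi> a x) = pm_map M a (a + 2 * \<epsilon>) x" if "x \<in> carrier (pm_at M a)" for a x
    using * that by simp
  have forth: "\<phi> (a + \<epsilon>) (\<psi> a y) = pm_map N a (a + 2 * \<epsilon>) y" if "y \<in> carrier (pm_at N a)" for a y
    using * that by simp
  have lin: "linmap (pm_at M a) (pm_at N (a + \<epsilon>)) (\<phi> a)" "linmap (pm_at N a) (pm_at M (a + \<epsilon>)) (\<psi> a)" for a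
    using \<phi> \<psi> by (simp_all add: shifted_hom_def)
  have e: "a + \<epsilon> + \<epsilon> = a + 2 * \<epsilon>" for a :: real by simp
  have "slack_interleaved \<epsilon> M N (\<lambda>a b x. pm_map N (a + \<epsilon>) b (\<phi> a x)) (\<lambda>a b x. pm_map M (a + \<epsilon>) b (\<psi> a x))"
    unfolding slack_interleaved_def
  proof (intro conjI allI impI ballI shifted_hom_imp_slack M N \<phi> \<psi>)
    show "pm_map M (b + \<epsilon>) c (\<psi> b (pm_map N (a + \<epsilon>) b (\<phi> a x))) = pm_map M a c x"
      if x: "x \<in> carrier (pm_at M a)" and b: "a + \<epsilon> \<le> b" "b + \<epsilon> \<le> c" for a b c x
    proof -
      have y: "\<phi> a x \<in> carrier (pm_at N (a + \<epsilon>))" by (rule linmap_in[OF lin(1) x])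
      have "\<psi> b (pm_map N (a + \<epsilon>) b (\<phi> a x)) = pm_map M (a + \<epsilon> + \<epsilon>) (b + \<epsilon>) (\<psi> (a + \<epsilon>) (\<phi> a x))"
        using \<psi> b y by (simp add: shifted_hom_def)
      also have "\<psi> (a + \<epsilon>) (\<phi> a x) = pm_map M a (a + \<epsilon> + \<epsilon>) x" using there[OF x] by (simp only: e)
      finally show ?thesis using x b nonneg M.pm_map_comp[OF _ _ x] M.push_in[OF _ x] by simp
    qed
    show "pm_map N (b + \<epsilon>) c (\<phi> b (pm_map M (a + \<epsilon>) b (\<psi> a x))) = pm_map N a c x"
      if x: "x \<in> carrier (pm_at N a)" and b: "a + \<epsilon> \<le> b" "b + \<epsilon> \<le> c" for a b c x
    proof -
      have y: "\<psi> a x \<in> carrier (pm_at M (a + \<epsilon>))" by (rule linmap_in[OF lin(2) x])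
      have "\<phi> b (pm_map M (a + \<epsilon>) b (\<psi> a x)) = pm_map N (a + \<epsilon> + \<epsilon>) (b + \<epsilon>) (\<phi> (a + \<epsilon>) (\<psi> a x))"
        using \<phi> b y by (simp add: shifted_hom_def)
      also have "\<phi> (a + \<epsilon>) (\<psi> a x) = pm_map N a (a + \<epsilon> + \<epsilon>) x" using forth[OF x] by (simp only: e)
      finally show ?thesis using x b nonneg N.pm_map_comp[OF _ _ x] N.push_in[OF _ x] by simp
    qed
  qed
  then show ?thesis by (intro exI)
qed

lemma slack_imp_interleaved:
  assumes "slack_interleaved \<epsilon> M N \<phi> \<psi>"
  shows "interleaved \<epsilon> M N"
proof -
  note h = slack_interleaved_hom[OF assms]
  have e: "a + \<epsilon> + \<epsilon> = a + 2 * \<epsilon>" for a :: real by simp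
  show ?thesis
    unfolding interleaved_def
    using slack_imp_shifted_hom[OF h(1)] slack_imp_shifted_hom[OF h(2)]
      slack_interleaved_back[OF assms] slack_interleaved_forth[OF assms]
    by (intro exI[of _ "\<lambda>a. \<phi> a (a + \<epsilon>)"] exI[of _ "\<lambda>a. \<psi> a (a + \<epsilon>)"]) (simp add: e)
qed

lemma slack_imp_dist_le:
  assumes "slack_interleaved \<epsilon> M N \<phi> \<psi>" "0 \<le> \<epsilon>"
  shows "interleaving_dist M N \<le> ereal \<epsilon>"
  unfolding interleaving_dist_def
  by (rule Inf_lower) (use assms slack_imp_interleaved[OF assms(1)] in simp)

lemma dist_nonneg: "0 \<le> interleaving_dist M N"
  unfolding interleaving_dist_def by (rule Inf_greatest) auto

lemma dist_less_imp_slack: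
  assumes M: "persistence_module M" and N: "persistence_module N" and d: "interleaving_dist M N < ereal \<epsilon>"
  shows "\<exists>\<phi> \<psi>. slack_interleaved \<epsilon> M N \<phi> \<psi>"
proof -
  obtain \<delta> where "0 \<le> \<delta>" "interleaved \<delta> M N" "\<delta> < \<epsilon>"
    using d unfolding interleaving_dist_def Inf_less_iff by auto
  then obtain \<phi> \<psi> where "slack_interleaved \<delta> M N \<phi> \<psi>" using interleaved_imp_slack[OF M N, of \<delta>] by auto
  then have "slack_interleaved \<epsilon> M N \<phi> \<psi>" by (rule slack_interleaved_mono) (use \<open>\<delta> < \<epsilon>\<close> in simp)
  then show ?thesis by (intro exI)
qed

section \<open>Sequential colimits of vector spaces inside a fixed universe\<close>

text \<open>A set covered by countably many copies of \<open>'a\<close> embeds into \<open>'a\<close> when \<open>'a\<close> is infinite. When \<open>'a\<close> is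
  finite this can fail, but then it suffices that every finite part embeds: the set is finite, with at most
  as many elements as \<open>'a\<close>.\<close>

lemma ex_inj_of_countable_cover:
  fixes S :: "(nat \<times> 'a) set" and f :: "nat \<times> 'a \<Rightarrow> 'c"
  assumes stage: "\<And>T. finite T \<Longrightarrow> T \<subseteq> f ` S \<Longrightarrow> \<exists>h :: 'c \<Rightarrow> 'a. inj_on h T"
  shows "\<exists>g :: 'c \<Rightarrow> 'a. inj_on g (f ` S)"
proof (cases "finite (UNIV :: 'a set)")
  case True
  have small: "card T \<le> card (UNIV :: 'a set)" if "finite T" "T \<subseteq> f ` S" for T
    using stage[OF that] card_inj_on_le[of _ T "UNIV :: 'a set"] True by auto
  have fin: "finite (f ` S)"
  proof (rule ccontr)
    assume "infinite (f ` S)"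
    then obtain T where "finite T" "card T = Suc (card (UNIV :: 'a set))" "T \<subseteq> f ` S"
      using infinite_arbitrarily_large by metis
    then show False using small by fastforce
  qed
  show ?thesis by (rule stage[OF fin subset_refl])
next
  case False
  have "(card_of (UNIV :: nat set), card_of (UNIV :: 'a set)) \<in> ordLeq"
    by (rule iffD1[OF infinite_iff_card_of_nat False])
  then have "(card_of ((UNIV :: nat set) \<times> (UNIV :: 'a set)), card_of (UNIV :: 'a set)) \<in> ordIso"
    by (rule conjunct2[OF card_of_Times_infinite[OF False UNIV_not_empty]])
  then have "(card_of ((UNIV :: nat set) \<times> (UNIV :: 'a set)), card_of (UNIV :: 'a set)) \<in> ordLeq"
    by (rule ordIso_imp_ordLeq)
  then have "\<exists>e :: nat \<times> 'a \<Rightarrow> 'a. inj_on e (UNIV \<times> UNIV) \<and> e ` (UNIV \<times> UNIV) \<subseteq> UNIV"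
    by (rule iffD2[OF card_of_ordLeq])
  then obtain e :: "nat \<times> 'a \<Rightarrow> 'a" where e: "inj_on e (UNIV \<times> UNIV)" by (elim exE conjE) (rule that)
  have "inj_on (e \<circ> inv_into S f) (f ` S)"
    by (rule comp_inj_on[OF inj_on_inv_into[OF subset_refl] inj_on_subset[OF e]]) simp
  then show ?thesis by (rule exI[of _ "e \<circ> inv_into S f"])
qed

text \<open>Colimits of sequences of vector spaces whose elements belong to \<open>'a\<close> are built with elements of \<open>'a\<close>
  again; this is what keeps the limit of persistence modules in the same universe.\<close>

locale direct_system =
  fixes W :: "nat \<Rightarrow> ('k::field, 'a) module" and F :: "nat \<Rightarrow> nat \<Rightarrow> 'a \<Rightarrow> 'a"
  assumes F_linear: "n \<le> m \<Longrightarrow> linmap (W n) (W m) (F n m)"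
    and F_id: "x \<in> carrier (W n) \<Longrightarrow> F n n x = x"
    and F_F: "n \<le> m \<Longrightarrow> m \<le> l \<Longrightarrow> x \<in> carrier (W n) \<Longrightarrow> F m l (F n m x) = F n l x"
begin

lemma vspace_W: "vspace (W n)"
  using linmap_vspace(1)[OF F_linear[OF order_refl]] .

lemma F_in: "n \<le> m \<Longrightarrow> x \<in> carrier (W n) \<Longrightarrow> F n m x \<in> carrier (W m)"
  by (rule linmap_in[OF F_linear])

definition merges :: "nat \<Rightarrow> 'a \<Rightarrow> nat \<Rightarrow> 'a \<Rightarrow> bool" where
  "merges n x m y \<longleftrightarrow> (\<exists>k. n \<le> k \<and> m \<le> k \<and> F n k x = F m k y)"

lemma merges_later:
  assumes "F n k x = F m k y" "x \<in> carrier (W n)" "y \<in> carrier (W m)" "n \<le> k" "m \<le> k" "k \<le> l"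
  shows "F n l x = F m l y"
  using F_F[of n k l x] F_F[of m k l y] assms by simp

lemma merges_sym: "merges n x m y \<Longrightarrow> merges m y n x"
  unfolding merges_def by metis

lemma merges_trans:
  assumes xyz: "x \<in> carrier (W n)" "y \<in> carrier (W m)" "z \<in> carrier (W l)"
    and 1: "merges n x m y" and 2: "merges m y l z"
  shows "merges n x l z"
proof -
  obtain i where i: "n \<le> i" "m \<le> i" "F n i x = F m i y" using 1 unfolding merges_def by metis
  obtain j where j: "m \<le> j" "l \<le> j" "F m j y = F l j z" using 2 unfolding merges_def by metis
  have "F n (max i j) x = F m (max i j) y" by (rule merges_later[OF i(3) xyz(1,2) i(1,2)]) simp
  also have "\<dots> = F l (max i j) z" by (rule merges_later[OF j(3) xyz(2,3) j(1,2)]) simp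
  finally show ?thesis unfolding merges_def using i j by (intro exI[of _ "max i j"]) auto
qed

text \<open>\<open>\<iota> n x\<close> is a name in \<open>'a\<close> for the class of \<open>x\<close> in the colimit. Finitely many classes have
  representatives at one common stage, where distinct classes have distinct representatives.\<close>

lemma encoding:
  "\<exists>\<iota> :: nat \<Rightarrow> 'a \<Rightarrow> 'a. \<forall>n m. \<forall>x\<in>carrier (W n). \<forall>y\<in>carrier (W m). \<iota> n x = \<iota> m y \<longleftrightarrow> merges n x m y"
proof -
  define cl where "cl = (\<lambda>(n, x). {(m, y). y \<in> carrier (W m) \<and> merges n x m y})"
  define S where "S = (SIGMA n:UNIV. carrier (W n))"
  have cl_eq: "cl (n, x) = cl (m, y) \<longleftrightarrow> merges n x m y"
    if xy: "x \<in> carrier (W n)" "y \<in> carrier (W m)" for n m x y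
  proof
    assume "cl (n, x) = cl (m, y)"
    moreover have "(m, y) \<in> cl (m, y)" using xy by (auto simp: cl_def merges_def)
    ultimately show "merges n x m y" by (auto simp: cl_def)
  next
    assume "merges n x m y"
    then show "cl (n, x) = cl (m, y)"
      using merges_trans[OF xy] merges_trans[OF xy(2,1)] merges_sym by (auto simp: cl_def)
  qed
  have "\<exists>g :: _ \<Rightarrow> 'a. inj_on g (cl ` S)"
  proof (rule ex_inj_of_countable_cover)
    fix T assume T: "finite T" "T \<subseteq> cl ` S"
    define r where "r = inv_into S cl"
    have r: "r c \<in> S" "cl (r c) = c" if "c \<in> T" for c
      unfolding r_def by (rule inv_into_into[OF subsetD[OF T(2) that]], rule f_inv_into_f[OF subsetD[OF T(2) that]])
    define N where "N = Max (insert 0 (fst ` r ` T))"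
    have N: "fst (r c) \<le> N" if "c \<in> T" for c unfolding N_def using T(1) that by (intro Max_ge) auto
    have "inj_on (\<lambda>c. F (fst (r c)) N (snd (r c))) T"
    proof (rule inj_onI)
      fix c d assume cd: "c \<in> T" "d \<in> T" "F (fst (r c)) N (snd (r c)) = F (fst (r d)) N (snd (r d))"
      then have "merges (fst (r c)) (snd (r c)) (fst (r d)) (snd (r d))"
        unfolding merges_def using N by metis
      moreover have "snd (r c) \<in> carrier (W (fst (r c)))" "snd (r d) \<in> carrier (W (fst (r d)))"
        using r(1)[OF cd(1)] r(1)[OF cd(2)] by (auto simp: S_def)
      ultimately have "cl (r c) = cl (r d)" using cl_eq by (metis prod.collapse)
      then show "c = d" using r(2) cd(1,2) by simp
    qed
    then show "\<exists>h :: _ \<Rightarrow> 'a. inj_on h T" by metis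
  qed
  then obtain g :: "_ \<Rightarrow> 'a" where g: "inj_on g (cl ` S)" by metis
  have "g (cl (n, x)) = g (cl (m, y)) \<longleftrightarrow> merges n x m y"
    if "x \<in> carrier (W n)" "y \<in> carrier (W m)" for n m x y
    using inj_on_eq_iff[OF g, of "cl (n, x)" "cl (m, y)"] cl_eq[OF that] that by (auto simp: S_def)
  then show ?thesis by (intro exI[of _ "\<lambda>n x. g (cl (n, x))"]) simp
qed

text \<open>The usual description of a sequential colimit by representatives, from which the universal property is
  derived below.\<close>

definition is_colimit :: "('k, 'a) module \<Rightarrow> (nat \<Rightarrow> 'a \<Rightarrow> 'a) \<Rightarrow> bool" where
  "is_colimit L \<iota> \<longleftrightarrow> (\<forall>n. linmap (W n) L (\<iota> n)) \<and>
    (\<forall>u\<in>carrier L. \<exists>n. \<exists>x\<in>carrier (W n). u = \<iota> n x) \<and>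
    (\<forall>n m. \<forall>x\<in>carrier (W n). \<forall>y\<in>carrier (W m). \<iota> n x = \<iota> m y \<longleftrightarrow> merges n x m y)"

lemma merges_F: "n \<le> m \<Longrightarrow> x \<in> carrier (W n) \<Longrightarrow> merges m (F n m x) n x"
  unfolding merges_def using F_id[OF F_in] by (intro exI[of _ m]) simp

text \<open>Operations are computed on representatives at a common stage; the axioms hold because they hold at every
  stage.\<close>

lemma colimit_exists: "\<exists>L \<iota>. is_colimit L \<iota>"
proof -
  obtain \<iota> :: "nat \<Rightarrow> 'a \<Rightarrow> 'a" where "\<forall>n m. \<forall>x\<in>carrier (W n). \<forall>y\<in>carrier (W m). \<iota> n x = \<iota> m y \<longleftrightarrow> merges n x m y"
    using encoding by (elim exE) (rule that)
  then have \<iota>: "\<iota> n x = \<iota> m y \<longleftrightarrow> merges n x m y" if "x \<in> carrier (W n)" "y \<in> carrier (W m)" for n m x y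
    using that by simp
  note v = vspace_W
  have \<iota>F: "\<iota> m (F n m x) = \<iota> n x" if "n \<le> m" "x \<in> carrier (W n)" for n m x
    using \<iota>[OF F_in[OF that] that(2)] merges_F[OF that] by simp
  define U where "U = {\<iota> n x | n x. x \<in> carrier (W n)}"
  define A where "A u w = (SOME r. \<exists>n x y. x \<in> carrier (W n) \<and> y \<in> carrier (W n) \<and> u = \<iota> n x \<and> w = \<iota> n y \<and>
      r = \<iota> n (x \<oplus>\<^bsub>W n\<^esub> y))" for u w
  define S where "S c u = (SOME r. \<exists>n x. x \<in> carrier (W n) \<and> u = \<iota> n x \<and> r = \<iota> n (c \<odot>\<^bsub>W n\<^esub> x))" for c u
  define L where "L = (\<lparr>carrier = U, mult = (\<lambda>_ _. undefined), one = undefined, zero = \<iota> 0 \<zero>\<^bsub>W 0\<^esub>, add = A, smult = S\<rparr> :: ('k, 'a) module)"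
  have A: "A (\<iota> n x) (\<iota> n y) = \<iota> n (x \<oplus>\<^bsub>W n\<^esub> y)" if xy: "x \<in> carrier (W n)" "y \<in> carrier (W n)" for n x y
  proof -
    have "\<exists>m x' y'. x' \<in> carrier (W m) \<and> y' \<in> carrier (W m) \<and> \<iota> n x = \<iota> m x' \<and> \<iota> n y = \<iota> m y' \<and>
        A (\<iota> n x) (\<iota> n y) = \<iota> m (x' \<oplus>\<^bsub>W m\<^esub> y')"
      unfolding A_def by (rule someI_ex) (use xy in blast)
    then obtain m x' y' where m: "x' \<in> carrier (W m)" "y' \<in> carrier (W m)" "\<iota> n x = \<iota> m x'" "\<iota> n y = \<iota> m y'"
      "A (\<iota> n x) (\<iota> n y) = \<iota> m (x' \<oplus>\<^bsub>W m\<^esub> y')" by metis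
    obtain i where i: "n \<le> i" "m \<le> i" "F n i x = F m i x'" using \<iota>[OF xy(1) m(1)] m(3) unfolding merges_def by metis
    obtain j where j: "n \<le> j" "m \<le> j" "F n j y = F m j y'" using \<iota>[OF xy(2) m(2)] m(4) unfolding merges_def by metis
    define k where "k = max i j"
    have k: "n \<le> k" "m \<le> k" "F n k x = F m k x'" "F n k y = F m k y'"
      using merges_later[OF i(3) xy(1) m(1) i(1,2), of k] merges_later[OF j(3) xy(2) m(2) j(1,2), of k] i j
      by (auto simp: k_def)
    then have "F n k (x \<oplus>\<^bsub>W n\<^esub> y) = F m k (x' \<oplus>\<^bsub>W m\<^esub> y')"
      using linmap_add[OF F_linear[OF k(1)] xy] linmap_add[OF F_linear[OF k(2)] m(1,2)] by simp
    then have "merges n (x \<oplus>\<^bsub>W n\<^esub> y) m (x' \<oplus>\<^bsub>W m\<^esub> y')" unfolding merges_def using k(1,2) by metis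
    then show ?thesis using iffD2[OF \<iota>[OF vs_add[OF v xy] vs_add[OF v m(1,2)]]] m(5) by simp
  qed
  have S: "S c (\<iota> n x) = \<iota> n (c \<odot>\<^bsub>W n\<^esub> x)" if x: "x \<in> carrier (W n)" for c n x
  proof -
    have "\<exists>m x'. x' \<in> carrier (W m) \<and> \<iota> n x = \<iota> m x' \<and> S c (\<iota> n x) = \<iota> m (c \<odot>\<^bsub>W m\<^esub> x')"
      unfolding S_def by (rule someI_ex) (use x in blast)
    then obtain m x' where m: "x' \<in> carrier (W m)" "\<iota> n x = \<iota> m x'" "S c (\<iota> n x) = \<iota> m (c \<odot>\<^bsub>W m\<^esub> x')" by metis
    obtain k where k: "n \<le> k" "m \<le> k" "F n k x = F m k x'" using \<iota>[OF x m(1)] m(2) unfolding merges_def by metis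
    then have "F n k (c \<odot>\<^bsub>W n\<^esub> x) = F m k (c \<odot>\<^bsub>W m\<^esub> x')"
      using linmap_smult[OF F_linear[OF k(1)] x] linmap_smult[OF F_linear[OF k(2)] m(1)] by simp
    then have "merges n (c \<odot>\<^bsub>W n\<^esub> x) m (c \<odot>\<^bsub>W m\<^esub> x')" unfolding merges_def using k(1,2) by metis
    then show ?thesis using iffD2[OF \<iota>[OF vs_smult[OF v x] vs_smult[OF v m(1)]]] m(3) by simp
  qed
  have Z: "\<iota> n \<zero>\<^bsub>W n\<^esub> = \<iota> 0 \<zero>\<^bsub>W 0\<^esub>" for n
    using \<iota>F[of 0 n "\<zero>\<^bsub>W 0\<^esub>"] linmap_zero[OF F_linear[of 0 n]] vs_zero[OF v] by simp
  have UE: "\<exists>x\<in>carrier (W k). u = \<iota> k x" if "u = \<iota> n z" "z \<in> carrier (W n)" "n \<le> k" for u n z k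
    using that \<iota>F F_in by metis
  have rep: "\<exists>n z. z \<in> carrier (W n) \<and> u = \<iota> n z" if "u \<in> U" for u using that by (auto simp: U_def)
  have rep2: "\<exists>n. \<exists>x\<in>carrier (W n). \<exists>y\<in>carrier (W n). u = \<iota> n x \<and> w = \<iota> n y" if u: "u \<in> U" "w \<in> U" for u w
  proof -
    obtain n x m y where "x \<in> carrier (W n)" "u = \<iota> n x" "y \<in> carrier (W m)" "w = \<iota> m y"
      using rep[OF u(1)] rep[OF u(2)] by metis
    then show ?thesis using UE[of u n x "max n m"] UE[of w m y "max n m"] by (metis max.cobounded1 max.cobounded2)
  qed
  have rep3: "\<exists>n. \<exists>x\<in>carrier (W n). \<exists>y\<in>carrier (W n). \<exists>z\<in>carrier (W n). u = \<iota> n x \<and> w = \<iota> n y \<and> r = \<iota> n z"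
    if u: "u \<in> U" "w \<in> U" "r \<in> U" for u w r
  proof -
    obtain n x y where n: "x \<in> carrier (W n)" "y \<in> carrier (W n)" "u = \<iota> n x" "w = \<iota> n y"
      using rep2[OF u(1,2)] by metis
    obtain m z where m: "z \<in> carrier (W m)" "r = \<iota> m z" using rep[OF u(3)] by metis
    show ?thesis
      using UE[of u n x "max n m"] UE[of w n y "max n m"] UE[of r m z "max n m"] n m
      by (metis max.cobounded1 max.cobounded2)
  qed
  have \<iota>U: "\<iota> n x \<in> U" if "x \<in> carrier (W n)" for n x using that by (auto simp: U_def)
  have rec: "carrier L = U" "u \<oplus>\<^bsub>L\<^esub> w = A u w" "c \<odot>\<^bsub>L\<^esub> u = S c u" "\<zero>\<^bsub>L\<^esub> = \<iota> 0 \<zero>\<^bsub>W 0\<^esub>" for u w c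
    by (simp_all add: L_def)
  note [simp] = A S vs_simps[OF v] \<iota>U
  have "vspace L"
  proof (rule vs_criteria, unfold rec)
    show "field (class_ring :: 'k ring)" by unfold_locales
    show "\<iota> 0 \<zero>\<^bsub>W 0\<^esub> \<in> U" by simp
    show "\<forall>u w. u \<in> U \<and> w \<in> U \<longrightarrow> A u w \<in> U"
    proof (intro allI impI, elim conjE)
      fix u w assume "u \<in> U" "w \<in> U"
      then obtain n x y where "x \<in> carrier (W n)" "y \<in> carrier (W n)" "u = \<iota> n x" "w = \<iota> n y" using rep2 by metis
      then show "A u w \<in> U" by simp
    qed
    show "\<forall>u\<in>U. \<exists>w\<in>U. A u w = \<iota> 0 \<zero>\<^bsub>W 0\<^esub>"
    proof
      fix u assume "u \<in> U"
      then obtain n x where x: "x \<in> carrier (W n)" "u = \<iota> n x" using rep by metis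
      then have "A u (\<iota> n ((- 1) \<odot>\<^bsub>W n\<^esub> x)) = \<iota> 0 \<zero>\<^bsub>W 0\<^esub>"
        using vs_right_neg[OF v x(1)] Z[of n] A[OF x(1) vs_smult[OF v x(1)], of "- 1"] by simp
      then show "\<exists>w\<in>U. A u w = \<iota> 0 \<zero>\<^bsub>W 0\<^esub>" using x by (intro bexI[of _ "\<iota> n ((- 1) \<odot>\<^bsub>W n\<^esub> x)"]) simp_all
    qed
    show "\<forall>c u. c \<in> carrier class_ring \<and> u \<in> U \<longrightarrow> S c u \<in> U"
    proof (intro allI impI, elim conjE)
      fix c u assume "u \<in> U"
      then obtain n x where "x \<in> carrier (W n)" "u = \<iota> n x" using rep by metis
      then show "S c u \<in> U" by simp
    qed
    show "\<forall>u w. u \<in> U \<and> w \<in> U \<longrightarrow> A u w = A w u"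
    proof (intro allI impI, elim conjE)
      fix u w assume "u \<in> U" "w \<in> U"
      then obtain n x y where "x \<in> carrier (W n)" "y \<in> carrier (W n)" "u = \<iota> n x" "w = \<iota> n y" using rep2 by metis
      then show "A u w = A w u" using vs_add_comm[OF v, of x n y] by simp
    qed
    show "\<forall>u w r. u \<in> U \<and> w \<in> U \<and> r \<in> U \<longrightarrow> A (A u w) r = A u (A w r)"
    proof (intro allI impI, elim conjE)
      fix u w r assume "u \<in> U" "w \<in> U" "r \<in> U"
      then obtain n x y z where "x \<in> carrier (W n)" "y \<in> carrier (W n)" "z \<in> carrier (W n)" "u = \<iota> n x" "w = \<iota> n y" "r = \<iota> n z"
        using rep3 by metis
      then show "A (A u w) r = A u (A w r)" using vs_add_assoc[OF v, of x n y z] by simp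
    qed
    show "\<forall>u\<in>U. A u (\<iota> 0 \<zero>\<^bsub>W 0\<^esub>) = u"
    proof
      fix u assume "u \<in> U"
      then obtain n x where x: "x \<in> carrier (W n)" "u = \<iota> n x" using rep by metis
      then show "A u (\<iota> 0 \<zero>\<^bsub>W 0\<^esub>) = u" unfolding Z[of n, symmetric] by simp
    qed
    show "\<forall>c d u. c \<in> carrier class_ring \<and> d \<in> carrier class_ring \<and> u \<in> U \<longrightarrow> S (c \<otimes>\<^bsub>class_ring\<^esub> d) u = S c (S d u)"
    proof (intro allI impI, elim conjE)
      fix c d u assume "u \<in> U"
      then obtain n x where x: "x \<in> carrier (W n)" "u = \<iota> n x" using rep by metis
      then show "S (c \<otimes>\<^bsub>class_ring\<^esub> d) u = S c (S d u)" by simp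
    qed
    show "\<forall>u\<in>U. S \<one>\<^bsub>class_ring\<^esub> u = u"
    proof
      fix u assume "u \<in> U"
      then obtain n x where x: "x \<in> carrier (W n)" "u = \<iota> n x" using rep by metis
      then show "S \<one>\<^bsub>class_ring\<^esub> u = u" by simp
    qed
    show "\<forall>c d u. c \<in> carrier class_ring \<and> d \<in> carrier class_ring \<and> u \<in> U \<longrightarrow>
        S (c \<oplus>\<^bsub>class_ring\<^esub> d) u = A (S c u) (S d u)"
    proof (intro allI impI, elim conjE)
      fix c d u assume "u \<in> U"
      then obtain n x where x: "x \<in> carrier (W n)" "u = \<iota> n x" using rep by metis
      then show "S (c \<oplus>\<^bsub>class_ring\<^esub> d) u = A (S c u) (S d u)" by simp
    qed
    show "\<forall>c u w. c \<in> carrier class_ring \<and> u \<in> U \<and> w \<in> U \<longrightarrow> S c (A u w) = A (S c u) (S c w)"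
    proof (intro allI impI, elim conjE)
      fix c u w assume "u \<in> U" "w \<in> U"
      then obtain n x y where "x \<in> carrier (W n)" "y \<in> carrier (W n)" "u = \<iota> n x" "w = \<iota> n y" using rep2 by metis
      then show "S c (A u w) = A (S c u) (S c w)" by simp
    qed
  qed
  then have "linmap (W n) L (\<iota> n)" for n by (subst linmap_iff[OF v]) (simp_all add: rec)
  moreover have "\<forall>u\<in>carrier L. \<exists>n. \<exists>x\<in>carrier (W n). u = \<iota> n x" using rep unfolding rec by metis
  ultimately have "is_colimit L \<iota>" using \<iota> by (simp add: is_colimit_def)
  then show ?thesis by metis
qed

context
  fixes L \<iota> assumes colim: "is_colimit L \<iota>"
begin

lemma colimit_linear: "linmap (W n) L (\<iota> n)"
  and colimit_eq_iff: "x \<in> carrier (W n) \<Longrightarrow> y \<in> carrier (W m) \<Longrightarrow> \<iota> n x = \<iota> m y \<longleftrightarrow> merges n x m y"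
  using colim by (auto simp: is_colimit_def)

lemma colimit_F: "n \<le> m \<Longrightarrow> x \<in> carrier (W n) \<Longrightarrow> \<iota> m (F n m x) = \<iota> n x"
  using colimit_eq_iff[OF F_in] merges_F by simp

lemma colimit_rep: "u \<in> carrier L \<Longrightarrow> \<exists>n\<ge>N. \<exists>x\<in>carrier (W n). u = \<iota> n x"
proof -
  assume "u \<in> carrier L"
  then obtain n x where "x \<in> carrier (W n)" "u = \<iota> n x" using colim unfolding is_colimit_def by metis
  then have "u = \<iota> (max n N) (F n (max n N) x)" "F n (max n N) x \<in> carrier (W (max n N))"
    using colimit_F F_in by simp_all
  then show ?thesis by (metis max.cobounded2)
qed

text \<open>A compatible family of maps defined only on the stages from \<open>N\<close> on suffices, as each element has
  representatives at arbitrarily late stages.\<close>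

lemma colimit_induced:
  assumes Z: "vspace Z" and g: "\<And>n. n \<ge> N \<Longrightarrow> linmap (W n) Z (g n)"
    and comp: "\<And>n m x. N \<le> n \<Longrightarrow> n \<le> m \<Longrightarrow> x \<in> carrier (W n) \<Longrightarrow> g m (F n m x) = g n x"
  shows "\<exists>h. linmap L Z h \<and> (\<forall>n\<ge>N. \<forall>x\<in>carrier (W n). h (\<iota> n x) = g n x)"
proof -
  have "\<exists>h. \<forall>u\<in>carrier L. \<exists>n\<ge>N. \<exists>x\<in>carrier (W n). u = \<iota> n x \<and> h u = g n x"
    by (rule bchoice) (use colimit_rep in metis)
  then obtain h where h: "\<And>u. u \<in> carrier L \<Longrightarrow> \<exists>n\<ge>N. \<exists>x\<in>carrier (W n). u = \<iota> n x \<and> h u = g n x" by metis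
  have h\<iota>: "h (\<iota> n x) = g n x" if n: "n \<ge> N" "x \<in> carrier (W n)" for n x
  proof -
    obtain m y where m: "m \<ge> N" "y \<in> carrier (W m)" "\<iota> n x = \<iota> m y" "h (\<iota> n x) = g m y"
      using h[OF linmap_in[OF colimit_linear n(2)]] by metis
    then obtain k where "n \<le> k" "m \<le> k" "F n k x = F m k y"
      using colimit_eq_iff[OF n(2) m(2)] unfolding merges_def by metis
    then show ?thesis using comp[OF n(1) _ n(2), of k] comp[OF m(1) _ m(2), of k] m(4) by simp
  qed
  have rep2: "\<exists>n\<ge>N. \<exists>x\<in>carrier (W n). \<exists>y\<in>carrier (W n). u = \<iota> n x \<and> w = \<iota> n y"
    if u: "u \<in> carrier L" "w \<in> carrier L" for u w
  proof -
    obtain n x where n: "n \<ge> N" "x \<in> carrier (W n)" "u = \<iota> n x" using colimit_rep[OF u(1)] by metis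
    obtain m y where m: "m \<ge> n" "y \<in> carrier (W m)" "w = \<iota> m y" using colimit_rep[OF u(2)] by metis
    show ?thesis using n m colimit_F[OF m(1) n(2)] F_in[OF m(1) n(2)] by (metis order_trans)
  qed
  have vL: "vspace L" using linmap_vspace(2)[OF colimit_linear] .
  have "linmap L Z h"
  proof (subst linmap_iff[OF vL Z], intro conjI ballI allI)
    fix u assume "u \<in> carrier L"
    then obtain n x where n: "n \<ge> N" "x \<in> carrier (W n)" "u = \<iota> n x" using colimit_rep by metis
    show "h u \<in> carrier Z" using n h\<iota>[OF n(1,2)] linmap_in[OF g[OF n(1)] n(2)] by simp
    show "h (c \<odot>\<^bsub>L\<^esub> u) = c \<odot>\<^bsub>Z\<^esub> h u" for c
      using n h\<iota>[OF n(1,2)] h\<iota>[OF n(1) vs_smult[OF vspace_W n(2)]] linmap_smult[OF g[OF n(1)] n(2)]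
        linmap_smult[OF colimit_linear n(2)] by simp
  next
    fix u w assume "u \<in> carrier L" "w \<in> carrier L"
    then obtain n x y where n: "n \<ge> N" "x \<in> carrier (W n)" "y \<in> carrier (W n)" "u = \<iota> n x" "w = \<iota> n y"
      using rep2 by metis
    show "h (u \<oplus>\<^bsub>L\<^esub> w) = h u \<oplus>\<^bsub>Z\<^esub> h w"
      using n h\<iota>[OF n(1,2)] h\<iota>[OF n(1,3)] h\<iota>[OF n(1) vs_add[OF vspace_W n(2,3)]]
        linmap_add[OF g[OF n(1)] n(2,3)] linmap_add[OF colimit_linear n(2,3)] by simp
  qed
  then show ?thesis using h\<iota> by metis
qed

end

end

section \<open>The limit of a rapidly converging sequence\<close>

text \<open>The degrees are halved in each step, so those of the steps from \<open>k\<close> on add up to \<open>2 * e k\<close>. The limit at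
  time \<open>a\<close> is the colimit of \<open>Y k\<close> at time \<open>a - \<delta> k\<close> along the interleaving maps. The shift \<open>\<delta> k\<close> is twice the
  total degree still to come: half of it accommodates the interleaving maps, and the other half is a
  reserve that makes the limit left generated.\<close>

locale rapid_sequence =
  fixes Y :: "nat \<Rightarrow> ('k::field, 'a) pmod" and \<phi> \<psi> :: "nat \<Rightarrow> real \<Rightarrow> real \<Rightarrow> 'a \<Rightarrow> 'a" and e :: "nat \<Rightarrow> real"
  assumes pm: "persistence_module (Y k)"
    and e_half: "e (Suc k) = e k / 2" and e_pos: "0 < e k"
    and step: "slack_interleaved (e k) (Y k) (Y (Suc k)) (\<phi> k) (\<psi> k)"
begin

definition \<delta> :: "nat \<Rightarrow> real" where "\<delta> k = 4 * e k"
text \<open>The sum of the degrees of the \<open>j\<close> steps starting from step \<open>k\<close>.\<close>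

definition gap :: "nat \<Rightarrow> nat \<Rightarrow> real" where "gap k j = 2 * e k - 2 * e (k + j)"

lemma gap_0: "gap k 0 = 0" and gap_Suc: "gap k (Suc j) = gap k j + e (k + j)"
  by (simp_all add: gap_def e_half)

lemma e_antimono: "e (k + j) \<le> e k"
proof (induction j)
  case (Suc j)
  then show ?case using e_pos[of "k + j"] e_half[of "k + j"] by simp
qed simp

lemma gap_nonneg: "0 \<le> gap k j"
  using e_antimono by (simp add: gap_def)

lemma gap_le: "gap k j \<le> \<delta> k - \<delta> (k + j)" "gap k j \<le> \<delta> k"
  using e_antimono[of k j] e_pos[of "k + j"] e_pos[of k] by (simp_all add: gap_def \<delta>_def)

lemma \<delta>_pos: "0 < \<delta> k"
  using e_pos by (simp add: \<delta>_def)

text \<open>The composites of \<open>j\<close> successive interleaving maps out of \<open>Y k\<close> and back into \<open>Y k\<close>. They are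
  defined for all pairs of times and meaningful if the later one leaves room for a shift by \<open>gap k j\<close>.\<close>

primrec up :: "nat \<Rightarrow> nat \<Rightarrow> real \<Rightarrow> real \<Rightarrow> 'a \<Rightarrow> 'a" where
  "up k 0 = pm_map (Y k)"
| "up k (Suc j) = (\<lambda>a b x. \<phi> (k + j) (b - e (k + j)) b (up k j a (b - e (k + j)) x))"

primrec down :: "nat \<Rightarrow> nat \<Rightarrow> real \<Rightarrow> real \<Rightarrow> 'a \<Rightarrow> 'a" where
  "down k 0 = pm_map (Y k)"
| "down k (Suc j) = (\<lambda>a b x. down k j (a + e (k + j)) b (\<psi> (k + j) a (a + e (k + j)) x))"

lemma up_down: "slack_interleaved (gap k j) (Y k) (Y (k + j)) (up k j) (down k j)"
proof (induction j)
  case 0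
  show ?case using slack_interleaved_refl[OF pm] by (simp add: gap_0)
next
  case (Suc j)
  show ?case
    using slack_interleaved_trans[OF gap_nonneg less_imp_le[OF e_pos] Suc step[of "k + j"]]
    by (simp add: gap_Suc)
qed

lemmas up_hom = slack_interleaved_hom(1)[OF up_down] and down_hom = slack_interleaved_hom(2)[OF up_down]

lemma up_up:
  assumes "x \<in> carrier (pm_at (Y k) a)" "a + gap k i \<le> b" "b + gap (k + i) j \<le> c"
  shows "up (k + i) j b c (up k i a b x) = up k (i + j) a c x"
  using assms(3)
proof (induction j arbitrary: c)
  case 0
  then show ?case using slack_push[OF up_hom assms(1,2)] by (simp add: gap_0)
next
  case (Suc j)
  have "b + gap (k + i) j \<le> c - e (k + (i + j))" using Suc.prems by (simp add: gap_Suc add.assoc)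
  from Suc.IH[OF this] show ?case by (simp add: add.assoc)
qed

text \<open>A step up followed by the corresponding step down is a structure map, so the way back from stage
  \<open>n + j + i\<close> to stage \<open>n\<close> extends the way back from stage \<open>n + j\<close>. This compatibility defines the maps out of
  the limit.\<close>

lemma down_up:
  assumes "x \<in> carrier (pm_at (Y (n + j)) a)" "a + gap (n + j) i \<le> c" "c + gap n (j + i) \<le> b"
  shows "down n (j + i) c b (up (n + j) i a c x) = down n j a b x"
  using assms(2,3)
proof (induction i arbitrary: c)
  case 0
  then show ?case using slack_pull[OF down_hom, of x n j a c b] assms(1) by (simp add: gap_0)
next
  case (Suc i)
  let ?e = "e (n + (j + i))"
  let ?z = "up (n + j) i a (c - ?e) x"
  have 1: "a + gap (n + j) i \<le> c - ?e" "(c + ?e) + gap n (j + i) \<le> b"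
    using Suc.prems by (simp_all add: gap_Suc add.assoc)
  have ep: "0 < ?e" by (rule e_pos)
  have z: "?z \<in> carrier (pm_at (Y (n + (j + i))) (c - ?e))"
    using slack_in[OF up_hom assms(1) 1(1)] by (simp add: add.assoc)
  have "down n (j + Suc i) c b (up (n + j) (Suc i) a c x) =
      down n (j + i) (c + ?e) b (\<psi> (n + (j + i)) c (c + ?e) (\<phi> (n + (j + i)) (c - ?e) c ?z))"
    by (simp add: add.assoc)
  also have "\<psi> (n + (j + i)) c (c + ?e) (\<phi> (n + (j + i)) (c - ?e) c ?z) =
      pm_map (Y (n + (j + i))) (c - ?e) (c + ?e) ?z"
    by (rule slack_interleaved_back[OF step z]) simp_all
  also have "\<dots> = up (n + j) i a (c + ?e) x"
    using slack_push[OF up_hom assms(1) 1(1), of "c + ?e"] ep by (simp add: add.assoc)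
  also have "down n (j + i) (c + ?e) b \<dots> = down n j a b x"
    by (rule Suc.IH) (use 1 ep in auto)
  finally show ?case .
qed

definition W :: "real \<Rightarrow> nat \<Rightarrow> ('k, 'a) module" where
  "W a k = pm_at (Y k) (a - \<delta> k)"

definition F :: "real \<Rightarrow> nat \<Rightarrow> nat \<Rightarrow> 'a \<Rightarrow> 'a" where
  "F a k m = up k (m - k) (a - \<delta> k) (a - \<delta> m)"

lemma F_add: "F a k (k + j) = up k j (a - \<delta> k) (a - \<delta> (k + j))"
  by (simp add: F_def)

lemma gap_shift: "a - \<delta> k + gap k j \<le> a - \<delta> (k + j)"
  using gap_le(1)[of k j] by simp

lemma system: "direct_system (W a) (F a)"
proof (rule direct_system.intro)
  fix n m :: nat assume "n \<le> m"
  then obtain j where m: "m = n + j" using le_Suc_ex by auto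
  show "linmap (W a n) (W a m) (F a n m)"
    unfolding m F_add W_def by (rule slack_linear[OF up_hom gap_shift])
next
  fix x n assume x: "x \<in> carrier (W a n)"
  interpret persistence_module "Y n" by (rule pm)
  show "F a n n x = x" using x by (simp add: F_def W_def pm_map_id)
next
  fix n m l x assume "n \<le> m" "m \<le> l" and x: "x \<in> carrier (W a n)"
  then obtain i j where m: "m = n + i" and l: "l = n + i + j" using le_Suc_ex by metis
  show "F a m l (F a n m x) = F a n l x"
    using up_up[of x n "a - \<delta> n" i "a - \<delta> m" j "a - \<delta> l"] x gap_shift[of a n i] gap_shift[of a "n + i" j]
    unfolding m l F_add W_def by (simp add: F_def)
qed

definition "lim_pair a = (SOME L\<iota>. direct_system.is_colimit (W a) (F a) (fst L\<iota>) (snd L\<iota>))"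
definition "lim_at a = fst (lim_pair a)"
definition "\<iota> a = snd (lim_pair a)"

lemma colimit: "direct_system.is_colimit (W a) (F a) (lim_at a) (\<iota> a)"
proof -
  obtain L i where "direct_system.is_colimit (W a) (F a) L i"
    using direct_system.colimit_exists[OF system[of a]] by (elim exE) (rule that)
  then have "\<exists>L\<iota>. direct_system.is_colimit (W a) (F a) (fst L\<iota>) (snd L\<iota>)"
    by (intro exI[of _ "(L, i)"]) simp
  then show ?thesis unfolding lim_at_def \<iota>_def lim_pair_def by (rule someI_ex)
qed

lemmas \<iota>_linear = direct_system.colimit_linear[OF system colimit]
  and \<iota>_F = direct_system.colimit_F[OF system colimit]
  and lim_at_rep = direct_system.colimit_rep[OF system colimit]
  and lim_at_induced = direct_system.colimit_induced[OF system colimit]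

lemma W_push: "a \<le> b \<Longrightarrow> linmap (W a k) (W b k) (pm_map (Y k) (a - \<delta> k) (b - \<delta> k))"
proof -
  assume ab: "a \<le> b"
  interpret persistence_module "Y k" by (rule pm)
  show ?thesis unfolding W_def by (rule linear_pm_map) (use ab in simp)
qed

lemma push_F:
  assumes ab: "a \<le> b" and nm: "n \<le> m" and x: "x \<in> carrier (W a n)"
  shows "F b n m (pm_map (Y n) (a - \<delta> n) (b - \<delta> n) x) = pm_map (Y m) (a - \<delta> m) (b - \<delta> m) (F a n m x)"
proof -
  obtain j where m: "m = n + j" using nm le_Suc_ex by auto
  have x': "x \<in> carrier (pm_at (Y n) (a - \<delta> n))" using x by (simp add: W_def)
  show ?thesis
    unfolding m F_add
    using slack_pull[OF up_hom x', of "b - \<delta> n" j "b - \<delta> (n + j)"] gap_shift[of b n j]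
      slack_push[OF up_hom x' gap_shift, of j "b - \<delta> (n + j)"] ab by simp
qed

lemma lim_push_exists:
  assumes ab: "a \<le> b"
  shows "\<exists>h. linmap (lim_at a) (lim_at b) h \<and>
    (\<forall>n\<ge>0. \<forall>x\<in>carrier (W a n). h (\<iota> a n x) = \<iota> b n (pm_map (Y n) (a - \<delta> n) (b - \<delta> n) x))"
proof (rule lim_at_induced)
  show "vspace (lim_at b)" by (rule linmap_vspace(2)[OF \<iota>_linear])
  show "linmap (W a n) (lim_at b) (\<lambda>x. \<iota> b n (pm_map (Y n) (a - \<delta> n) (b - \<delta> n) x))" for n
    by (rule linmap_comp[OF W_push[OF ab] \<iota>_linear])
  fix n m x assume nm: "n \<le> m" and x: "x \<in> carrier (W a n)"
  show "\<iota> b m (pm_map (Y m) (a - \<delta> m) (b - \<delta> m) (F a n m x)) = \<iota> b n (pm_map (Y n) (a - \<delta> n) (b - \<delta> n) x)"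
    unfolding push_F[OF ab nm x, symmetric] by (rule \<iota>_F[OF nm linmap_in[OF W_push[OF ab] x]])
qed

definition lim_push :: "real \<Rightarrow> real \<Rightarrow> 'a \<Rightarrow> 'a" where
  "lim_push a b = (SOME h. linmap (lim_at a) (lim_at b) h \<and>
    (\<forall>n\<ge>0. \<forall>x\<in>carrier (W a n). h (\<iota> a n x) = \<iota> b n (pm_map (Y n) (a - \<delta> n) (b - \<delta> n) x)))"

lemma
  assumes ab: "a \<le> b"
  shows lim_push_linear: "linmap (lim_at a) (lim_at b) (lim_push a b)"
    and lim_push: "x \<in> carrier (W a n) \<Longrightarrow>
      lim_push a b (\<iota> a n x) = \<iota> b n (pm_map (Y n) (a - \<delta> n) (b - \<delta> n) x)"
proof -
  have *: "linmap (lim_at a) (lim_at b) (lim_push a b) \<and>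
    (\<forall>n\<ge>0. \<forall>x\<in>carrier (W a n). lim_push a b (\<iota> a n x) = \<iota> b n (pm_map (Y n) (a - \<delta> n) (b - \<delta> n) x))"
    unfolding lim_push_def by (rule someI_ex[OF lim_push_exists[OF ab]])
  show "linmap (lim_at a) (lim_at b) (lim_push a b)" by (rule conjunct1[OF *])
  show "x \<in> carrier (W a n) \<Longrightarrow> lim_push a b (\<iota> a n x) = \<iota> b n (pm_map (Y n) (a - \<delta> n) (b - \<delta> n) x)"
    using conjunct2[OF *] by simp
qed

definition limit_module :: "('k, 'a) pmod" where
  "limit_module = \<lparr>pm_at = lim_at, pm_map = lim_push\<rparr>"

lemma limit_module_simps [simp]: "pm_at limit_module = lim_at" "pm_map limit_module = lim_push"
  by (simp_all add: limit_module_def)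

lemma limit_module_pm: "persistence_module limit_module"
proof (rule persistence_module.intro, unfold limit_module_simps)
  show "vspace (lim_at a)" for a by (rule linmap_vspace(2)[OF \<iota>_linear])
  show "a \<le> b \<Longrightarrow> linmap (lim_at a) (lim_at b) (lim_push a b)" for a b by (rule lim_push_linear)
  show "lim_push a a u = u" if u: "u \<in> carrier (lim_at a)" for a u
  proof -
    obtain n x where x: "x \<in> carrier (W a n)" "u = \<iota> a n x" using lim_at_rep[OF u, of 0] by auto
    interpret persistence_module "Y n" by (rule pm)
    show ?thesis using x by (simp add: lim_push W_def pm_map_id)
  qed
  show "lim_push b c (lim_push a b u) = lim_push a c u"
    if abc: "a \<le> b" "b \<le> c" and u: "u \<in> carrier (lim_at a)" for a b c u
  proof -
    obtain n x where x: "x \<in> carrier (W a n)" "u = \<iota> a n x" using lim_at_rep[OF u, of 0] by auto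
    interpret persistence_module "Y n" by (rule pm)
    have "pm_map (Y n) (b - \<delta> n) (c - \<delta> n) (pm_map (Y n) (a - \<delta> n) (b - \<delta> n) x) = pm_map (Y n) (a - \<delta> n) (c - \<delta> n) x"
      using x abc by (simp add: W_def pm_map_comp)
    then show ?thesis
      using x(2) lim_push[OF abc(1) x(1)] lim_push[OF abc(2) linmap_in[OF W_push[OF abc(1)] x(1)]]
        lim_push[OF order_trans[OF abc] x(1)] by simp
  qed
qed

text \<open>Moving a representative from stage \<open>n\<close> to stage \<open>n + 1\<close> costs only \<open>e n\<close> of the available shift
  \<open>\<delta> n - \<delta> (n + 1) = 2 * e n\<close>; hence it also represents an element at time \<open>t - e n\<close>.\<close>

lemma limit_module_left_generated: "persistence_module.left_generated limit_module (\<lambda>t. carrier (pm_at limit_module t))"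
proof -
  have "\<exists>s<t. \<exists>z\<in>carrier (lim_at s). lim_push s t z = u" if u: "u \<in> carrier (lim_at t)" for t u
  proof -
    obtain n x where x: "x \<in> carrier (W t n)" "u = \<iota> t n x" using lim_at_rep[OF u, of 0] by auto
    interpret persistence_module "Y n" by (rule pm)
    let ?m = "Suc n"
    define s where "s = t - e n"
    have st: "s < t" using e_pos[of n] by (simp add: s_def)
    have x': "x \<in> carrier (pm_at (Y n) (t - \<delta> n))" using x(1) by (simp add: W_def)
    have le: "t - \<delta> n + e n \<le> s - \<delta> ?m" by (simp add: s_def \<delta>_def e_half)
    define y where "y = \<phi> n (t - \<delta> n) (s - \<delta> ?m) x"
    have y: "y \<in> carrier (W s ?m)"
      unfolding y_def W_def by (rule slack_in[OF slack_interleaved_hom(1)[OF step] x' le])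
    have "pm_map (Y ?m) (s - \<delta> ?m) (t - \<delta> ?m) y = \<phi> n (t - \<delta> n) (t - \<delta> ?m) x"
      unfolding y_def by (rule slack_push[OF slack_interleaved_hom(1)[OF step] x' le]) (use st in simp)
    also have "\<dots> = F t n ?m x"
      using slack_pull[OF slack_interleaved_hom(1)[OF step] x', of "t - \<delta> ?m - e n" "t - \<delta> ?m"] le st
      by (simp add: F_def)
    finally have "lim_push s t (\<iota> s ?m y) = \<iota> t ?m (F t n ?m x)" using lim_push[OF _ y, of t] st by simp
    also have "\<dots> = u" using \<iota>_F[OF _ x(1), of ?m] x(2) by simp
    finally show ?thesis using st linmap_in[OF \<iota>_linear y] by auto
  qed
  then show ?thesis unfolding persistence_module.left_generated_def[OF limit_module_pm] by simp
qed

definition into_lim :: "nat \<Rightarrow> real \<Rightarrow> real \<Rightarrow> 'a \<Rightarrow> 'a" where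
  "into_lim n a b x = \<iota> b n (pm_map (Y n) a (b - \<delta> n) x)"

lemma from_lim_exists:
  assumes ab: "a + \<delta> n \<le> b"
  shows "\<exists>h. linmap (lim_at a) (pm_at (Y n) b) h \<and>
    (\<forall>m\<ge>n. \<forall>x\<in>carrier (W a m). h (\<iota> a m x) = down n (m - n) (a - \<delta> m) b x)"
proof (rule lim_at_induced)
  have le: "a - \<delta> (n + j) + gap n j \<le> b" for j
    using gap_le(2)[of n j] \<delta>_pos[of "n + j"] ab by simp
  show "vspace (pm_at (Y n) b)" using persistence_module.vectorspace_at[OF pm] .
  show "linmap (W a m) (pm_at (Y n) b) (down n (m - n) (a - \<delta> m) b)" if nm: "n \<le> m" for m
  proof -
    obtain j where m: "m = n + j" using nm le_Suc_ex by auto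
    show ?thesis unfolding m W_def by (rule slack_linear) (use down_hom le in simp_all)
  qed
  fix m l x assume nm: "n \<le> m" and ml: "m \<le> l" and x: "x \<in> carrier (W a m)"
  obtain j where m: "m = n + j" using nm le_Suc_ex by auto
  obtain i where l: "l = n + j + i" using ml m le_Suc_ex by auto
  show "down n (l - n) (a - \<delta> l) b (F a m l x) = down n (m - n) (a - \<delta> m) b x"
    using down_up[of x n j "a - \<delta> m" i "a - \<delta> l" b] x gap_shift[of a "n + j" i] le[of "j + i"]
    unfolding m l F_add W_def by (simp add: add.assoc)
qed

definition from_lim :: "nat \<Rightarrow> real \<Rightarrow> real \<Rightarrow> 'a \<Rightarrow> 'a" where
  "from_lim n a b = (SOME h. linmap (lim_at a) (pm_at (Y n) b) h \<and>
    (\<forall>m\<ge>n. \<forall>x\<in>carrier (W a m). h (\<iota> a m x) = down n (m - n) (a - \<delta> m) b x))"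

lemma
  assumes ab: "a + \<delta> n \<le> b"
  shows from_lim_linear: "linmap (lim_at a) (pm_at (Y n) b) (from_lim n a b)"
    and from_lim: "x \<in> carrier (W a (n + j)) \<Longrightarrow> from_lim n a b (\<iota> a (n + j) x) = down n j (a - \<delta> (n + j)) b x"
proof -
  have *: "linmap (lim_at a) (pm_at (Y n) b) (from_lim n a b) \<and>
    (\<forall>m\<ge>n. \<forall>x\<in>carrier (W a m). from_lim n a b (\<iota> a m x) = down n (m - n) (a - \<delta> m) b x)"
    unfolding from_lim_def by (rule someI_ex[OF from_lim_exists[OF ab]])
  show "linmap (lim_at a) (pm_at (Y n) b) (from_lim n a b)" by (rule conjunct1[OF *])
  show "x \<in> carrier (W a (n + j)) \<Longrightarrow> from_lim n a b (\<iota> a (n + j) x) = down n j (a - \<delta> (n + j)) b x"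
    using conjunct2[OF *] by simp
qed

text \<open>The map into the limit is the inclusion of stage \<open>n\<close>, and the map out of it is induced by the ways back to
  stage \<open>n\<close>. Both composites are computed on representatives.\<close>

lemma limit_module_inter: "slack_interleaved (\<delta> n) (Y n) limit_module (into_lim n) (from_lim n)"
proof -
  interpret persistence_module "Y n" by (rule pm)
  have rep: "\<exists>j. \<exists>x\<in>carrier (W a (n + j)). u = \<iota> a (n + j) x" if "u \<in> carrier (lim_at a)" for a u
    using lim_at_rep[OF that, of n] le_Suc_ex by metis
  show ?thesis
    unfolding slack_interleaved_def slack_hom_def limit_module_simps
  proof (intro conjI allI ballI impI)
    show "linmap (pm_at (Y n) a) (lim_at b) (into_lim n a b)" if "a + \<delta> n \<le> b" for a b
      unfolding into_lim_def using that
      by (intro linmap_comp[OF linear_pm_map \<iota>_linear[of b n, unfolded W_def]]) simp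
    show "lim_push b c (into_lim n a b x) = into_lim n a c x"
      if "x \<in> carrier (pm_at (Y n) a)" "a + \<delta> n \<le> b" "b \<le> c" for a b c x
      using lim_push[of b c "pm_map (Y n) a (b - \<delta> n) x" n] that
      by (simp add: into_lim_def W_def push_in pm_map_comp)
    show "into_lim n b c (pm_map (Y n) a b x) = into_lim n a c x"
      if "x \<in> carrier (pm_at (Y n) a)" "a \<le> b" "b + \<delta> n \<le> c" for a b c x
      using that by (simp add: into_lim_def pm_map_comp)
    show "linmap (lim_at a) (pm_at (Y n) b) (from_lim n a b)" if "a + \<delta> n \<le> b" for a b
      by (rule from_lim_linear[OF that])
    show "pm_map (Y n) b c (from_lim n a b u) = from_lim n a c u"
      if u: "u \<in> carrier (lim_at a)" and ab: "a + \<delta> n \<le> b" "b \<le> c" for a b c u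
    proof -
      obtain j x where x: "x \<in> carrier (W a (n + j))" "u = \<iota> a (n + j) x" using rep[OF u] by auto
      then show ?thesis
        using from_lim[OF ab(1) x(1)] from_lim[of a n c x j] ab slack_push[OF down_hom, of x n j "a - \<delta> (n + j)" b c]
          gap_le(2)[of n j] \<delta>_pos[of "n + j"]
        by (simp add: W_def)
    qed
    show "from_lim n b c (lim_push a b u) = from_lim n a c u"
      if u: "u \<in> carrier (lim_at a)" and ab: "a \<le> b" "b + \<delta> n \<le> c" for a b c u
    proof -
      obtain j x where x: "x \<in> carrier (W a (n + j))" "u = \<iota> a (n + j) x" using rep[OF u] by auto
      then show ?thesis
        using from_lim[OF ab(2) linmap_in[OF W_push[OF ab(1)] x(1)]] from_lim[of a n c x j] ab
          lim_push[OF ab(1) x(1)] slack_pull[OF down_hom, of x n j "a - \<delta> (n + j)" "b - \<delta> (n + j)" c]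
          gap_le(2)[of n j] \<delta>_pos[of "n + j"]
        by (simp add: W_def)
    qed
    show "from_lim n b c (into_lim n a b x) = pm_map (Y n) a c x"
      if x: "x \<in> carrier (pm_at (Y n) a)" and ab: "a + \<delta> n \<le> b" "b + \<delta> n \<le> c" for a b c x
    proof -
      have "pm_map (Y n) a (b - \<delta> n) x \<in> carrier (W b (n + 0))" using x ab by (simp add: W_def push_in)
      from from_lim[OF ab(2) this] show ?thesis
        using x ab \<delta>_pos[of n] by (simp add: into_lim_def pm_map_comp)
    qed
    show "into_lim n b c (from_lim n a b u) = lim_push a c u"
      if u: "u \<in> carrier (lim_at a)" and ab: "a + \<delta> n \<le> b" "b + \<delta> n \<le> c" for a b c u
    proof -
      obtain j x where x: "x \<in> carrier (W a (n + j))" "u = \<iota> a (n + j) x" using rep[OF u] by auto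
      have x': "x \<in> carrier (pm_at (Y (n + j)) (a - \<delta> (n + j)))" using x(1) by (simp add: W_def)
      have g: "gap n j \<le> \<delta> n" "0 < \<delta> n" "0 < \<delta> (n + j)" using gap_le(2) \<delta>_pos by simp_all
      have le1: "a - \<delta> (n + j) + gap n j \<le> b" using g ab by simp
      have le2: "b \<le> c - \<delta> n" using ab by simp
      have d: "down n j (a - \<delta> (n + j)) (c - \<delta> n) x \<in> carrier (W c n)"
        unfolding W_def by (rule slack_in[OF down_hom x']) (use le1 le2 in simp)
      have "into_lim n b c (from_lim n a b u) = \<iota> c n (pm_map (Y n) b (c - \<delta> n) (down n j (a - \<delta> (n + j)) b x))"
        unfolding x(2) from_lim[OF ab(1) x(1)] by (simp add: into_lim_def)
      also have "pm_map (Y n) b (c - \<delta> n) (down n j (a - \<delta> (n + j)) b x) = down n j (a - \<delta> (n + j)) (c - \<delta> n) x"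
        by (rule slack_push[OF down_hom x' le1 le2])
      also have "\<iota> c n \<dots> = \<iota> c (n + j) (F c n (n + j) (down n j (a - \<delta> (n + j)) (c - \<delta> n) x))"
        using \<iota>_F[OF _ d, of "n + j"] by simp
      also have "F c n (n + j) (down n j (a - \<delta> (n + j)) (c - \<delta> n) x) = pm_map (Y (n + j)) (a - \<delta> (n + j)) (c - \<delta> (n + j)) x"
        unfolding F_add by (rule slack_interleaved_forth[OF up_down x' _ gap_shift]) (use le1 le2 in simp)
      also have "\<iota> c (n + j) \<dots> = lim_push a c u"
        using lim_push[OF _ x(1), of c] x(2) ab g by simp
      finally show ?thesis .
    qed
  qed
qed

end

section \<open>Completeness\<close>

lemma rapid_subsequence:
  assumes C: "pm_Cauchy X"
  obtains K :: "nat \<Rightarrow> nat" where "\<And>k n m. K k \<le> n \<Longrightarrow> K k \<le> m \<Longrightarrow> interleaving_dist (X n) (X m) < ereal ((1/2) ^ k)"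
    "\<And>k. K k \<le> K (Suc k)"
proof -
  have "\<exists>K0. \<forall>n\<ge>K0. \<forall>m\<ge>K0. interleaving_dist (X n) (X m) < ereal ((1/2) ^ k)" for k
    using C unfolding pm_Cauchy_def by simp
  then obtain K0 where K0: "\<And>k n m. K0 k \<le> n \<Longrightarrow> K0 k \<le> m \<Longrightarrow> interleaving_dist (X n) (X m) < ereal ((1/2) ^ k)"
    by metis
  define K where "K k = Max (K0 ` {..k})" for k
  have "K0 k \<le> K k" for k unfolding K_def by (rule Max_ge) auto
  moreover have "K k \<le> K (Suc k)" for k unfolding K_def by (rule Max_mono) auto
  ultimately show ?thesis using that[of K] K0 by (meson order_trans)
qed

lemma slack_interleaved_shift:
  assumes "slack_interleaved \<epsilon> M N \<phi> \<psi>" "slack_interleaved \<delta> N P \<phi>' \<psi>'" "0 \<le> \<epsilon>" "0 \<le> \<delta>"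
  shows "\<exists>\<phi> \<psi>. slack_interleaved (\<epsilon> + \<delta>) M P \<phi> \<psi>"
  using slack_interleaved_trans[OF assms(3,4,1,2)] by (intro exI)

text \<open>It suffices to find a limit of a subsequence with rapidly decreasing distances.\<close>

theorem Cauchy_limit:
  fixes X :: "nat \<Rightarrow> ('k::field, 'a) pmod"
  assumes X: "\<And>n. persistence_module (X n)" and C: "pm_Cauchy X"
  obtains L :: "('k, 'a) pmod" where "persistence_module L" "pm_limit X L"
    "persistence_module.left_generated L (\<lambda>t. carrier (pm_at L t))"
    "\<And>\<epsilon>. 0 < \<epsilon> \<Longrightarrow> \<exists>n \<phi> \<psi>. slack_interleaved \<epsilon> (X n) L \<phi> \<psi>"
proof -
  obtain K :: "nat \<Rightarrow> nat" where K: "\<And>k n m. K k \<le> n \<Longrightarrow> K k \<le> m \<Longrightarrow> interleaving_dist (X n) (X m) < ereal ((1/2) ^ k)"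
    "\<And>k. K k \<le> K (Suc k)"
    using rapid_subsequence[OF C] by metis
  have "\<exists>p. slack_interleaved ((1/2) ^ k) (X (K k)) (X (K (Suc k))) (fst p) (snd p)" for k
  proof -
    obtain \<phi> \<psi> where "slack_interleaved ((1/2) ^ k) (X (K k)) (X (K (Suc k))) \<phi> \<psi>"
      using dist_less_imp_slack[OF X X K(1)[of k "K k" "K (Suc k)"]] K(2) by auto
    then show ?thesis by (intro exI[of _ "(\<phi>, \<psi>)"]) simp
  qed
  then obtain p where p: "\<And>k. slack_interleaved ((1/2) ^ k) (X (K k)) (X (K (Suc k))) (fst (p k)) (snd (p k))"
    by metis
  interpret rapid_sequence "\<lambda>k. X (K k)" "\<lambda>k. fst (p k)" "\<lambda>k. snd (p k)" "\<lambda>k. (1/2) ^ k"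
    by (rule rapid_sequence.intro) (use X p in simp_all)
  have \<delta>: "\<delta> k = 4 * (1/2) ^ k" for k by (simp add: \<delta>_def)
  have small: "\<exists>k. 5 * (1/2) ^ k < \<epsilon>" if "0 < \<epsilon>" for \<epsilon> :: real
    using real_arch_pow_inv[of "\<epsilon> / 5" "1/2"] that by (auto simp: field_simps)
  \<comment> \<open>one unit from \<open>X n\<close> to the subsequence and the four units of \<open>\<delta> k\<close> from there to the limit\<close>
  have near: "\<exists>\<phi> \<psi>. slack_interleaved (5 * (1/2) ^ k) (X n) limit_module \<phi> \<psi>" if n: "n \<ge> K k" for n k
  proof -
    obtain \<phi> \<psi> where "slack_interleaved ((1/2) ^ k) (X n) (X (K k)) \<phi> \<psi>"
      using dist_less_imp_slack[OF X X K(1)[OF n order_refl]] by (elim exE) (rule that)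
    from slack_interleaved_shift[OF this limit_module_inter[of k]] show ?thesis by (simp add: \<delta>)
  qed
  have "pm_limit X limit_module"
    unfolding pm_limit_def
  proof (rule order_tendstoI)
    show "\<forall>\<^sub>F n in sequentially. a < interleaving_dist (X n) limit_module" if "a < 0" for a
      using that dist_nonneg by (auto intro: always_eventually less_le_trans)
    fix a :: ereal assume "0 < a"
    then obtain r where r: "0 < r" "ereal r < a" using ereal_dense2[of 0 a] by (auto simp: zero_ereal_def)
    obtain k where k: "5 * (1/2) ^ k < r" using small[OF r(1)] by auto
    have "interleaving_dist (X n) limit_module < a" if n: "n \<ge> K k" for n
    proof -
      obtain \<phi> \<psi> where "slack_interleaved (5 * (1/2) ^ k) (X n) limit_module \<phi> \<psi>" using near[OF n] by (elim exE) (rule that)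
      then have "interleaving_dist (X n) limit_module \<le> ereal (5 * (1/2) ^ k)" by (rule slack_imp_dist_le) simp
      also have "\<dots> < ereal r" using k by simp
      also have "\<dots> < a" by (rule r(2))
      finally show ?thesis .
    qed
    then show "\<forall>\<^sub>F n in sequentially. interleaving_dist (X n) limit_module < a"
      by (auto simp: eventually_sequentially)
  qed
  moreover have "\<exists>n \<phi> \<psi>. slack_interleaved \<epsilon> (X n) limit_module \<phi> \<psi>" if \<epsilon>: "0 < \<epsilon>" for \<epsilon>
  proof -
    obtain k where k: "5 * (1/2) ^ k < \<epsilon>" using small[OF \<epsilon>] by auto
    obtain \<phi> \<psi> where "slack_interleaved (5 * (1/2) ^ k) (X (K k)) limit_module \<phi> \<psi>"
      using near[of k "K k", OF order_refl] by (elim exE) (rule that)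
    then have "slack_interleaved \<epsilon> (X (K k)) limit_module \<phi> \<psi>" by (rule slack_interleaved_mono) (use k in simp)
    then show ?thesis by (intro exI)
  qed
  ultimately show ?thesis by (rule that[OF limit_module_pm _ limit_module_left_generated])
qed

text \<open>A map from time \<open>a\<close> to time \<open>b\<close> in \<open>L\<close> factors through the map from \<open>a + \<epsilon>\<close> to \<open>b - \<epsilon>\<close> in \<open>N\<close>, which has
  positive length for \<open>\<epsilon> = (b - a) / 3\<close>.\<close>

lemma qtame_limit:
  fixes L :: "('k::field, 'a) pmod"
  assumes L: "persistence_module L" and near: "\<And>\<epsilon>. 0 < \<epsilon> \<Longrightarrow> \<exists>(N :: ('k, 'b) pmod) \<phi> \<psi>. qtame N \<and> slack_interleaved \<epsilon> N L \<phi> \<psi>"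
  shows "qtame L"
  unfolding qtame_def
proof (intro conjI L allI impI)
  fix a b :: real assume ab: "a < b"
  interpret L: persistence_module L by (rule L)
  define \<epsilon> where "\<epsilon> = (b - a) / 3"
  have \<epsilon>: "0 < \<epsilon>" using ab by (simp add: \<epsilon>_def)
  obtain N :: "('k, 'b) pmod" and \<phi> \<psi> where N: "qtame N" and int: "slack_interleaved \<epsilon> N L \<phi> \<psi>" using near[OF \<epsilon>] by auto
  interpret N: persistence_module N using N by (simp add: qtame_def)
  define p where "p = a + \<epsilon>" define q where "q = b - \<epsilon>"
  have pq: "p < q" "a + \<epsilon> \<le> p" "q + \<epsilon> \<le> b" using \<epsilon> by (simp_all add: p_def q_def \<epsilon>_def field_simps)
  note h = slack_interleaved_hom[OF int]
  let ?I = "pm_map N p q ` carrier (pm_at N p)"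
  have I: "subsp ?I (pm_at N q)"
    using pq by (intro subsp_image[OF N.linear_pm_map subsp_carrier[OF N.vectorspace_at]]) simp
  have "fin_dim (pm_at N q\<lparr>carrier := ?I\<rparr>)"
    using N pq(1) by (simp add: qtame_def finite_rank_def)
  then have fd: "fin_dim (pm_at L b\<lparr>carrier := \<phi> q b ` ?I\<rparr>)"
    by (rule fin_dim_image[OF slack_linear[OF h(1) pq(3)] I])
  have \<phi>I: "subsp (\<phi> q b ` ?I) (pm_at L b)" by (rule subsp_image[OF slack_linear[OF h(1) pq(3)] I])
  let ?J = "pm_map L a b ` carrier (pm_at L a)"
  have J: "subsp ?J (pm_at L b)"
    using ab by (intro subsp_image[OF L.linear_pm_map subsp_carrier[OF L.vectorspace_at]]) simp
  have "?J \<subseteq> \<phi> q b ` ?I"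
  proof
    fix u assume "u \<in> ?J"
    then obtain y where y: "y \<in> carrier (pm_at L a)" "u = pm_map L a b y" by blast
    have z: "\<psi> a p y \<in> carrier (pm_at N p)" by (rule slack_in[OF h(2) y(1) pq(2)])
    have "u = \<phi> q b (pm_map N p q (\<psi> a p y))"
      using slack_interleaved_forth[OF int y(1), of q b] slack_push[OF h(2) y(1) pq(2), of q] pq y(2) by simp
    then show "u \<in> \<phi> q b ` ?I" using z by blast
  qed
  then have "subsp ?J (pm_at L b\<lparr>carrier := \<phi> q b ` ?I\<rparr>)" by (rule subsp_of_subsp[OF \<phi>I J])
  from fin_dim_subsp[OF vspace_subsp[OF \<phi>I] fd this]
  show "finite_rank (pm_at L a) (pm_at L b) (pm_map L a b)" by (simp add: finite_rank_def)
qed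

text \<open>Together with \<open>nothing_old\<close> this expresses boundedness of the intervals of a q-tame sum of
  intervals in terms that pass to interleaved modules.\<close>

definition eventually_dies :: "('k::field, 'a) pmod \<Rightarrow> bool" where
  "eventually_dies M \<longleftrightarrow> (\<forall>t. \<forall>y\<in>carrier (pm_at M t). \<exists>u. \<forall>v\<ge>u. t \<le> v \<longrightarrow> pm_map M t v y = \<zero>\<^bsub>pm_at M v\<^esub>)"

definition nothing_old :: "('k::field, 'a) pmod \<Rightarrow> bool" where
  "nothing_old M \<longleftrightarrow> (\<forall>t. \<exists>r. \<forall>s\<le>r. s \<le> t \<longrightarrow> (\<forall>y\<in>carrier (pm_at M s). pm_map M s t y = \<zero>\<^bsub>pm_at M t\<^esub>))"

lemma eventually_dies_transfer:
  assumes M: "eventually_dies M" and int: "slack_interleaved \<epsilon> M L \<phi> \<psi>" and \<epsilon>: "0 \<le> \<epsilon>"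
  shows "eventually_dies L"
  unfolding eventually_dies_def
proof (intro allI ballI)
  fix t y assume y: "y \<in> carrier (pm_at L t)"
  note h = slack_interleaved_hom[OF int]
  let ?z = "\<psi> t (t + \<epsilon>) y"
  have z: "?z \<in> carrier (pm_at M (t + \<epsilon>))" using slack_in[OF h(2) y] by simp
  obtain u where u: "\<And>v. v \<ge> u \<Longrightarrow> t + \<epsilon> \<le> v \<Longrightarrow> pm_map M (t + \<epsilon>) v ?z = \<zero>\<^bsub>pm_at M v\<^esub>"
    using M z unfolding eventually_dies_def by metis
  have "pm_map L t v y = \<zero>\<^bsub>pm_at L v\<^esub>" if v: "v \<ge> max u (t + \<epsilon>) + \<epsilon>" for v
  proof -
    have "\<phi> (v - \<epsilon>) v (pm_map M (t + \<epsilon>) (v - \<epsilon>) ?z) = pm_map L t v y"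
      using slack_push[OF h(2) y, of "t + \<epsilon>" "v - \<epsilon>"] slack_interleaved_forth[OF int y, of "v - \<epsilon>" v] v by simp
    then show ?thesis
      using u[of "v - \<epsilon>"] linmap_zero[OF slack_linear[OF h(1)], of "v - \<epsilon>" v] v by simp
  qed
  then show "\<exists>u. \<forall>v\<ge>u. t \<le> v \<longrightarrow> pm_map L t v y = \<zero>\<^bsub>pm_at L v\<^esub>" by blast
qed

lemma nothing_old_transfer:
  assumes M: "nothing_old M" and int: "slack_interleaved \<epsilon> M L \<phi> \<psi>" and \<epsilon>: "0 \<le> \<epsilon>"
  shows "nothing_old L"
  unfolding nothing_old_def
proof (intro allI)
  fix t
  note h = slack_interleaved_hom[OF int]
  obtain r where r: "\<And>s y. s \<le> r \<Longrightarrow> s \<le> t - \<epsilon> \<Longrightarrow> y \<in> carrier (pm_at M s) \<Longrightarrow>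
      pm_map M s (t - \<epsilon>) y = \<zero>\<^bsub>pm_at M (t - \<epsilon>)\<^esub>"
    using M unfolding nothing_old_def by metis
  have "pm_map L s t y = \<zero>\<^bsub>pm_at L t\<^esub>"
    if s: "s \<le> min r (t - \<epsilon>) - \<epsilon>" and y: "y \<in> carrier (pm_at L s)" for s y
  proof -
    have z: "\<psi> s (s + \<epsilon>) y \<in> carrier (pm_at M (s + \<epsilon>))" using slack_in[OF h(2) y] by simp
    have "\<phi> (t - \<epsilon>) t (pm_map M (s + \<epsilon>) (t - \<epsilon>) (\<psi> s (s + \<epsilon>) y)) = pm_map L s t y"
      using slack_push[OF h(2) y, of "s + \<epsilon>" "t - \<epsilon>"] slack_interleaved_forth[OF int y, of "t - \<epsilon>" t] s by simp
    then show ?thesis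
      using r[OF _ _ z] linmap_zero[OF slack_linear[OF h(1)], of "t - \<epsilon>" t] s by simp
  qed
  then show "\<exists>r. \<forall>s\<le>r. s \<le> t \<longrightarrow> (\<forall>y\<in>carrier (pm_at L s). pm_map L s t y = \<zero>\<^bsub>pm_at L t\<^esub>)" by blast
qed

locale interval_decomposition =
  fixes M :: "('k::field, 'a) pmod" and I :: "nat set" and J :: "nat \<Rightarrow> real set"
    and f :: "real \<Rightarrow> 'a \<Rightarrow> nat \<Rightarrow> 'k"
  assumes M: "persistence_module M"
    and f_linear: "linmap (pm_at M t) (pm_at (pm_direct_sum I (\<lambda>i. interval_module (J i))) t) (f t)"
    and f_bij: "bij_betw (f t) (carrier (pm_at M t)) (carrier (pm_at (pm_direct_sum I (\<lambda>i. interval_module (J i))) t))"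
    and f_natural: "s \<le> t \<Longrightarrow> y \<in> carrier (pm_at M s) \<Longrightarrow>
      f t (pm_map M s t y) = pm_map (pm_direct_sum I (\<lambda>i. interval_module (J i))) s t (f s y)"
begin

abbreviation S :: "('k, nat \<Rightarrow> 'k) pmod" where
  "S \<equiv> pm_direct_sum I (\<lambda>i. interval_module (J i))"

sublocale persistence_module M by (rule M)

lemma S_carrier: "h \<in> carrier (pm_at S t) \<longleftrightarrow>
    h \<in> extensional I \<and> (\<forall>i\<in>I. t \<notin> J i \<longrightarrow> h i = 0) \<and> finite {i\<in>I. h i \<noteq> 0}"
  by (auto simp: pm_direct_sum_def vs_direct_sum_def interval_module_def PiE_iff)

lemma S_map: "i \<in> I \<Longrightarrow> pm_map S s t h i = (if s \<in> J i \<and> t \<in> J i then h i else 0)"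
  by (auto simp: pm_direct_sum_def interval_module_def)

lemma S_zero: "\<zero>\<^bsub>pm_at S t\<^esub> = (\<lambda>i\<in>I. 0)"
  by (simp add: pm_direct_sum_def vs_direct_sum_def interval_module_def)

lemma eq_zero_iff:
  assumes y: "y \<in> carrier (V t)"
  shows "y = \<zero>\<^bsub>V t\<^esub> \<longleftrightarrow> (\<forall>i\<in>I. f t y i = 0)"
proof
  assume "y = \<zero>\<^bsub>V t\<^esub>"
  then show "\<forall>i\<in>I. f t y i = 0" using linmap_zero[OF f_linear[of t]] by (simp add: S_zero)
next
  assume "\<forall>i\<in>I. f t y i = 0"
  moreover have "f t y \<in> carrier (pm_at S t)" by (rule linmap_in[OF f_linear y])
  ultimately have "f t y = f t \<zero>\<^bsub>V t\<^esub>"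
    unfolding linmap_zero[OF f_linear] S_zero by (auto simp: S_carrier extensional_def)
  then show "y = \<zero>\<^bsub>V t\<^esub>"
    using bij_betw_imp_inj_on[OF f_bij] y vs_zero[OF vectorspace_at] by (auto dest: inj_onD)
qed

lemma f_push: "s \<le> t \<Longrightarrow> y \<in> carrier (V s) \<Longrightarrow> i \<in> I \<Longrightarrow>
    f t (push s t y) i = (if s \<in> J i \<and> t \<in> J i then f s y i else 0)"
  by (simp add: f_natural S_map)

lemma support_finite: "y \<in> carrier (V t) \<Longrightarrow> finite {i\<in>I. f t y i \<noteq> 0}"
  using linmap_in[OF f_linear, of y t] by (simp add: S_carrier)

lemma generator: "i \<in> I \<Longrightarrow> t \<in> J i \<Longrightarrow> \<exists>y\<in>carrier (V t). f t y i = 1"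
proof -
  assume i: "i \<in> I" "t \<in> J i"
  have "(\<lambda>j\<in>I. if j = i then 1 else 0) \<in> carrier (pm_at S t)"
    using i by (auto simp: S_carrier)
  then obtain y where "y \<in> carrier (V t)" "f t y = (\<lambda>j\<in>I. if j = i then 1 else 0)"
    using bij_betw_imp_surj_on[OF f_bij[of t]] by (metis imageE)
  then show ?thesis using i(1) by (intro bexI[of _ y]) simp
qed

lemma bounded_imp_eventually_dies:
  assumes bd: "\<And>i. i \<in> I \<Longrightarrow> bounded (J i)"
  shows "eventually_dies M"
  unfolding eventually_dies_def
proof (intro allI ballI)
  fix t y assume y: "y \<in> carrier (V t)"
  let ?s = "{i\<in>I. f t y i \<noteq> 0}"
  have "bounded (\<Union>i\<in>?s. J i)" using support_finite[OF y] bd by (intro bounded_UN) auto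
  then obtain B where B: "\<And>x. x \<in> (\<Union>i\<in>?s. J i) \<Longrightarrow> \<bar>x\<bar> \<le> B" by (auto simp: bounded_iff)
  have "push t v y = \<zero>\<^bsub>V v\<^esub>" if v: "v \<ge> B + 1" "t \<le> v" for v
  proof -
    have "f v (push t v y) i = 0" if i: "i \<in> I" for i
    proof (cases "f t y i = 0")
      case False
      then have "v \<notin> J i" using B[of v] i v(1) by fastforce
      then show ?thesis using f_push[OF v(2) y i] by simp
    qed (use f_push[OF v(2) y i] in simp)
    then show ?thesis using eq_zero_iff[OF push_in[OF v(2) y]] by simp
  qed
  then show "\<exists>u. \<forall>v\<ge>u. t \<le> v \<longrightarrow> push t v y = \<zero>\<^bsub>V v\<^esub>" by blast
qed

text \<open>There may be infinitely many intervals, without a common lower bound. But by q-tameness the images of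
  the times \<open>s\<close> in time \<open>t\<close> are constant for small \<open>s\<close>, and an element of this constant image has coordinate
  zero along each interval since \<open>s\<close> may be chosen to the left of it.\<close>

lemma bounded_imp_nothing_old:
  assumes bd: "\<And>i. i \<in> I \<Longrightarrow> bounded (J i)" and qt: "qtame M"
  shows "nothing_old M"
  unfolding nothing_old_def
proof (intro allI)
  fix t
  interpret q_tame_module M
    using qt unfolding qtame_def q_tame_module_def q_tame_module_axioms_def by simp
  have im_mono: "push s t ` carrier (V s) \<subseteq> push s' t ` carrier (V s')" if "s \<le> s'" "s' \<le> t" for s s'
  proof
    fix u assume "u \<in> push s t ` carrier (V s)"
    then obtain z where "z \<in> carrier (V s)" "u = push s t z" by auto
    then have "u = push s' t (push s s' z)" "push s s' z \<in> carrier (V s')"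
      using that by (simp_all add: pm_map_comp push_in)
    then show "u \<in> push s' t ` carrier (V s')" by auto
  qed
  have "\<exists>s\<in>{..t - 1}. \<forall>s'\<in>{..t - 1}. push s t ` carrier (V s) \<subseteq> push s' t ` carrier (V s')"
  proof (rule least_image[where A = "\<lambda>_ t. carrier (V t)" and r = "\<lambda>s. s" and a = "t - 1"])
    fix i j assume "i \<in> {..t - 1}" "j \<in> {..t - 1}"
    then show "push i t ` carrier (V i) \<subseteq> push j t ` carrier (V j) \<or> push j t ` carrier (V j) \<subseteq> push i t ` carrier (V i)"
      using im_mono[of i j] im_mono[of j i] by (cases "i \<le> j") auto
  qed (use pm_sub_carriers in auto)
  then obtain r where r: "r \<le> t - 1" "\<And>s. s \<le> t - 1 \<Longrightarrow> push r t ` carrier (V r) \<subseteq> push s t ` carrier (V s)"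
    by auto
  have "push s t y = \<zero>\<^bsub>V t\<^esub>" if s: "s \<le> r" "y \<in> carrier (V s)" for s y
  proof -
    have st: "s \<le> t" using s r(1) by simp
    have "f t (push s t y) i = 0" if i: "i \<in> I" for i
    proof -
      obtain B where B: "\<And>x. x \<in> J i \<Longrightarrow> \<bar>x\<bar> \<le> B" using bd[OF i] by (auto simp: bounded_iff)
      define w where "w = min r (- B - 1)"
      have w: "w \<notin> J i" "w \<le> t - 1" using B[of w] r(1) by (auto simp: w_def min_def split: if_splits)
      have "push s t y \<in> push w t ` carrier (V w)"
        using im_mono[of s r] r(2)[OF w(2)] s r(1) by auto
      then obtain z where "z \<in> carrier (V w)" "push s t y = push w t z" by auto
      then show ?thesis using f_push[of w t z i] w i by simp
    qed
    then show ?thesis using eq_zero_iff[OF push_in[OF st s(2)]] by simp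
  qed
  then show "\<exists>r. \<forall>s\<le>r. s \<le> t \<longrightarrow> (\<forall>y\<in>carrier (V s). push s t y = \<zero>\<^bsub>V t\<^esub>)" by blast
qed

text \<open>The generator of an interval dies, which bounds the interval above; generators from very early times
  would have to be dead by a fixed time of the interval, which bounds it below.\<close>

lemma bounded_intervals:
  assumes dies: "eventually_dies M" and old: "nothing_old M" and i: "i \<in> I"
  shows "bounded (J i)"
proof (cases "J i = {}")
  case False
  then obtain t where t: "t \<in> J i" by auto
  obtain y where y: "y \<in> carrier (V t)" "f t y i = 1" using generator[OF i t] by auto
  obtain u where u: "\<And>v. v \<ge> u \<Longrightarrow> t \<le> v \<Longrightarrow> push t v y = \<zero>\<^bsub>V v\<^esub>"
    using dies y(1) unfolding eventually_dies_def by metis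
  obtain r where r: "\<And>s z. s \<le> r \<Longrightarrow> s \<le> t \<Longrightarrow> z \<in> carrier (V s) \<Longrightarrow> push s t z = \<zero>\<^bsub>V t\<^esub>"
    using old unfolding nothing_old_def by metis
  have upper: "v \<le> max u t" if v: "v \<in> J i" for v
  proof (rule ccontr)
    assume "\<not> v \<le> max u t"
    then have le: "u \<le> v" "t \<le> v" by auto
    have "f v (push t v y) i = 1" using f_push[OF le(2) y(1) i] y(2) t v by simp
    moreover have "f v (push t v y) i = 0"
      using eq_zero_iff[OF push_in[OF le(2) y(1)]] u[OF le] i by simp
    ultimately show False by simp
  qed
  have lower: "min r t \<le> s" if s: "s \<in> J i" for s
  proof (rule ccontr)
    assume "\<not> min r t \<le> s"
    then have le: "s \<le> r" "s \<le> t" by auto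
    obtain z where z: "z \<in> carrier (V s)" "f s z i = 1" using generator[OF i s] by auto
    have "f t (push s t z) i = 1" using f_push[OF le(2) z(1) i] z(2) t s by simp
    moreover have "f t (push s t z) i = 0"
      using eq_zero_iff[OF push_in[OF le(2) z(1)]] r[OF le z(1)] i by simp
    ultimately show False by simp
  qed
  have "J i \<subseteq> {min r t .. max u t}" using upper lower by auto
  then show ?thesis by (rule bounded_subset[OF bounded_closed_interval])
qed simp

end

lemma interval_decomposition_exists:
  assumes M: "persistence_module M" and iso: "pm_isomorphic M (pm_direct_sum I (\<lambda>i. interval_module (J i)))"
  obtains f where "interval_decomposition M I J f"
proof -
  obtain f where "(\<forall>t. linmap (pm_at M t) (pm_at (pm_direct_sum I (\<lambda>i. interval_module (J i))) t) (f t) \<and>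
      bij_betw (f t) (carrier (pm_at M t)) (carrier (pm_at (pm_direct_sum I (\<lambda>i. interval_module (J i))) t))) \<and>
    (\<forall>a b. a \<le> b \<longrightarrow> (\<forall>x \<in> carrier (pm_at M a).
      f b (pm_map M a b x) = pm_map (pm_direct_sum I (\<lambda>i. interval_module (J i))) a b (f a x)))"
    using iso unfolding pm_isomorphic_def by (elim exE) (rule that)
  then have "interval_decomposition M I J f" by (intro interval_decomposition.intro M) simp_all
  then show ?thesis by (rule that)
qed

lemma cfid_properties:
  assumes c: "cfid M" and q: "qtame M"
  shows "eventually_dies M" "nothing_old M"
proof -
  obtain I :: "nat set" and J where J: "\<And>i. i \<in> I \<Longrightarrow> bounded (J i)"
    and iso: "pm_isomorphic M (pm_direct_sum I (\<lambda>i. interval_module (J i)))"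
    using c unfolding cfid_def by auto
  have "persistence_module M" using c by (simp add: cfid_def)
  then obtain f where f: "interval_decomposition M I J f" using interval_decomposition_exists iso by metis
  show "eventually_dies M" by (rule interval_decomposition.bounded_imp_eventually_dies[OF f J])
  show "nothing_old M" by (rule interval_decomposition.bounded_imp_nothing_old[OF f J q])
qed

lemma cid_imp_cfid:
  assumes c: "cid M" and d: "eventually_dies M" "nothing_old M"
  shows "cfid M"
proof -
  obtain I :: "nat set" and J where J: "\<forall>i\<in>I. is_interval (J i) \<and> J i \<noteq> {}"
    and iso: "pm_isomorphic M (pm_direct_sum I (\<lambda>i. interval_module (J i)))"
    using c unfolding cid_def by auto
  have M: "persistence_module M" using c by (simp add: cid_def)
  then obtain f where f: "interval_decomposition M I J f" using interval_decomposition_exists iso by metis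
  have "\<forall>i\<in>I. bounded (J i)" using interval_decomposition.bounded_intervals[OF f d] by simp
  then show ?thesis unfolding cfid_def using M J iso by metis
qed

theorem theorem4p25:
  shows "pm_complete {M :: ('k::field, 'a) pmod. persistence_module M} \<and>
    pm_complete {M :: ('k, 'a) pmod. qtame M} \<and>
    pm_complete {M :: ('k, 'a) pmod. cid M \<and> qtame M} \<and>
    pm_complete {M :: ('k, 'a) pmod. cfid M \<and> qtame M}"
proof -
  have main: "\<exists>L. persistence_module L \<and> pm_limit X L \<and> ((\<forall>n. qtame (X n)) \<longrightarrow> qtame L \<and> cid L) \<and>
      ((\<forall>n. cfid (X n) \<and> qtame (X n)) \<longrightarrow> cfid L)"
    if X: "\<And>n. persistence_module (X n)" and C: "pm_Cauchy X" for X :: "nat \<Rightarrow> ('k, 'a) pmod"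
  proof (rule Cauchy_limit[OF X C])
    fix L :: "('k, 'a) pmod"
    assume L: "persistence_module L" "pm_limit X L"
      "persistence_module.left_generated L (\<lambda>t. carrier (pm_at L t))"
      and near: "\<And>\<epsilon>. 0 < \<epsilon> \<Longrightarrow> \<exists>n \<phi> \<psi>. slack_interleaved \<epsilon> (X n) L \<phi> \<psi>"
    have q: "qtame L \<and> cid L" if "\<forall>n. qtame (X n)"
    proof -
      have "\<exists>(N :: ('k, 'a) pmod) \<phi> \<psi>. qtame N \<and> slack_interleaved \<epsilon> N L \<phi> \<psi>" if "0 < \<epsilon>" for \<epsilon>
        using near[OF that] \<open>\<forall>n. qtame (X n)\<close> by auto
      then have "qtame L" by (rule qtame_limit[OF L(1)])
      then show ?thesis using q_tame_left_generated_cid[OF _ L(3)] by simp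
    qed
    have "cfid L" if X': "\<forall>n. cfid (X n) \<and> qtame (X n)"
    proof -
      obtain n \<phi> \<psi> where int: "slack_interleaved 1 (X n) L \<phi> \<psi>" using near[of 1] by auto
      have "eventually_dies L" "nothing_old L"
        using eventually_dies_transfer[OF _ int] nothing_old_transfer[OF _ int] cfid_properties X' by auto
      moreover have "cid L" using q X' by simp
      ultimately show ?thesis by (intro cid_imp_cfid)
    qed
    then show ?thesis using L q by (intro exI[of _ L]) simp
  qed
  show ?thesis
    unfolding pm_complete_def
  proof (intro conjI allI impI; elim conjE)
    fix X :: "nat \<Rightarrow> ('k, 'a) pmod"
    assume C: "pm_Cauchy X"
    {
      assume "\<forall>n. X n \<in> {M. persistence_module M}"
      then show "\<exists>L\<in>{M. persistence_module M}. pm_limit X L" using main[OF _ C] by auto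
    next
      assume "\<forall>n. X n \<in> {M. qtame M}"
      then show "\<exists>L\<in>{M. qtame M}. pm_limit X L" using main[OF _ C] by (auto simp: qtame_def)
    next
      assume "\<forall>n. X n \<in> {M. cid M \<and> qtame M}"
      then show "\<exists>L\<in>{M. cid M \<and> qtame M}. pm_limit X L" using main[OF _ C] by (auto simp: qtame_def)
    next
      assume "\<forall>n. X n \<in> {M. cfid M \<and> qtame M}"
      then show "\<exists>L\<in>{M. cfid M \<and> qtame M}. pm_limit X L" using main[OF _ C] by (auto simp: qtame_def)
    }
  qed
qed

end
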